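(* Let $\mathcal{T}=(T(t))_{t\ge0}$ be a bounded $C_0$-semigroup on a Banach space $X$ with infinitesimal generator $A$, and let $x\in X$. The following properties are equivalent: (a) $\lim_{t\to\infty}\|T(t)x\|_X=0$; (b) $\sigma_{PF}(A,x)=\varnothing$; (c) $\sigma_{PF}(A,x)$ is countable and, for each $i\xi\in\sigma_{PF}(A,x)$, $$\lim_{\alpha\to0^+}\alpha\|R(\alpha+i\xi,A)x\|_X=0.$$
   Context: Vector-valued distributions: for a Banach space $Z$ and an open set $I\subseteq\mathbb{R}$, $\mathcal{D}'(I;Z)$ is the space of continuous linear maps $\mathcal{D}(I)=C_c^\infty(I)\to Z$, and $\mathcal{S}'(\mathbb{R};Z)$ is the space of continuous linear maps $\mathcal{S}(\mathbb{R})\to Z$ (Schwartz space). The Fourier transform is $\widehat{\varphi}(\xi)=\int_{-\infty}^{\infty}e^{-i\xi t}\varphi(t)\,dt$ on $\mathcal{S}(\mathbb{R})$, extended to $\mathcal{S}'(\mathbb{R};Z)$ by $\langle\widehat f,\varphi\rangle=\langle f,\widehat\varphi\rangle$. $C_0(\mathbb{R};Z)$ is the space of continuous $Z$-valued functions vanishing at infinity, and $PF(\mathbb{R};Z)=\{\widehat g: g\in C_0(\mathbb{R};Z)\}$. A distribution $f\in\mathcal{D}'(I;Z)$ is a local pseudofunction on $I$ if each $\xi_0\in I$ has an open neighborhood $I'\subseteq I$ on which $f$ coincides with an element of $PF(\mathbb{R};Z)$. For $f\in\mathcal{D}'(\mathbb{R};Z)$, $\operatorname{sing\,supp}_{PF}f$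 is the complement in $\mathbb{R}$ of the largest open set on which $f$ is a local pseudofunction. Semigroups: $\mathcal{T}$ is bounded if $\sup_{t\ge0}\|T(t)\|_{L(X)}<\infty$; $R(\lambda,A)=(\lambda-A)^{-1}$ is the resolvent. For bounded $\mathcal{T}$ and $x\in X$, the limit $\langle R(i\xi,A)x,\varphi(\xi)\rangle=\lim_{\alpha\to0^+}\int_{-\infty}^\infty\varphi(\xi)R(\alpha+i\xi,A)x\,d\xi$ defines $R(i\,\cdot,A)x\in\mathcal{S}'(\mathbb{R};X)$ (it is the Fourier transform of $t\mapsto T(t)x$, extended by $0$ to $t<0$). The local pseudofunction spectrum of $A$ at $x$ is $\sigma_{PF}(A,x)=i\operatorname{sing\,supp}_{PF}R(i\,\cdot,A)x\subseteq i\mathbb{R}$. Countable includes finite and empty. *)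

theory Defs
  imports "HOL-Analysis.Analysis"
begin

section \<open>Complex Banach spaces\<close>

text \<open>HOL-Analysis only provides real Banach spaces. A complex Banach space is a real one with a
  complex scalar multiplication that extends the real one and for which the norm is homogeneous.\<close>

class complex_banach = banach +
  fixes scaleC :: "complex \<Rightarrow> 'a \<Rightarrow> 'a"  (infixr "*\<^sub>C" 75)
  assumes scaleC_add_right: "c *\<^sub>C (u + v) = c *\<^sub>C u + c *\<^sub>C v"
    and scaleC_add_left: "(c + d) *\<^sub>C u = c *\<^sub>C u + d *\<^sub>C u"
    and scaleC_scaleC: "c *\<^sub>C d *\<^sub>C u = (c * d) *\<^sub>C u"
    and scaleC_of_real: "complex_of_real r *\<^sub>C u = r *\<^sub>R u"
    and norm_scaleC: "norm (c *\<^sub>C u) = cmod c * norm u"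


section \<open>Test functions and vector-valued distributions\<close>

definition iterated_deriv :: "nat \<Rightarrow> (real \<Rightarrow> complex) \<Rightarrow> real \<Rightarrow> complex" where
  "iterated_deriv k = (\<lambda>\<phi> t. vector_derivative \<phi> (at t)) ^^ k"

definition smooth_fun :: "(real \<Rightarrow> complex) \<Rightarrow> bool" where
  "smooth_fun \<phi> \<longleftrightarrow> (\<forall>k t. iterated_deriv k \<phi> differentiable (at t))"

definition fun_support :: "(real \<Rightarrow> complex) \<Rightarrow> real set" where
  "fun_support \<phi> = closure {t. \<phi> t \<noteq> 0}"

definition test_functions :: "real set \<Rightarrow> (real \<Rightarrow> complex) set" where
  "test_functions I = {\<phi>. smooth_fun \<phi> \<and> compact (fun_support \<phi>) \<and> fun_support \<phi> \<subseteq> I}"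

text \<open>The locally convex topology on \<open>V\<close> given by a family \<open>p\<close> of seminorms.\<close>

definition seminorm_topology ::
    "(real \<Rightarrow> complex) set \<Rightarrow> (nat \<Rightarrow> (real \<Rightarrow> complex) \<Rightarrow> real) \<Rightarrow> (real \<Rightarrow> complex) topology" where
  "seminorm_topology V p =
     topology_generated_by
       {{\<psi> \<in> V. p k (\<lambda>t. \<psi> t - \<phi> t) < r} | k \<phi> r. \<phi> \<in> V \<and> r > 0}"

text \<open>For compact \<open>K\<close>, the space of test functions supported in \<open>K\<close>, with the topology of uniform
  convergence of all derivatives.\<close>

definition test_topology :: "real set \<Rightarrow> (real \<Rightarrow> complex) topology" where
  "test_topology K =
     seminorm_topology (test_functions K) (\<lambda>k \<phi>. SUP t. cmod (iterated_deriv k \<phi> t))"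

text \<open>A distribution is a total function on \<open>real \<Rightarrow> complex\<close>; only its values on test functions
  are meaningful. Since \<open>test_functions I\<close> carries the inductive limit topology of
  its subspaces \<open>test_functions K\<close> with \<open>K \<subseteq> I\<close> compact, a linear map on it is
  continuous iff its restrictions to these subspaces are.\<close>

definition distribution_on ::
    "real set \<Rightarrow> ((real \<Rightarrow> complex) \<Rightarrow> 'z::complex_banach) \<Rightarrow> bool" where
  "distribution_on I f \<longleftrightarrow>
     (\<forall>\<phi>\<in>test_functions I. \<forall>\<psi>\<in>test_functions I. f (\<lambda>t. \<phi> t + \<psi> t) = f \<phi> + f \<psi>) \<and>
     (\<forall>c. \<forall>\<phi>\<in>test_functions I. f (\<lambda>t. c * \<phi> t) = c *\<^sub>C f \<phi>) \<and>
     (\<forall>K. compact K \<and> K \<subseteq> I \<longrightarrow> continuous_map (test_topology K) euclidean f)"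


section \<open>Pseudofunctions\<close>

text \<open>Vector-valued integrals below are gauge integrals, because the Bochner integral of the library
  requires a separable range. The integrands of interest are continuous and absolutely integrable, and for
  these the gauge integral is the usual one.\<close>

definition fourier :: "(real \<Rightarrow> complex) \<Rightarrow> real \<Rightarrow> complex" where
  "fourier \<phi> \<xi> = integral UNIV (\<lambda>t. exp (- \<i> * of_real \<xi> * of_real t) * \<phi> t)"

definition function_distribution ::
    "(real \<Rightarrow> 'z::complex_banach) \<Rightarrow> (real \<Rightarrow> complex) \<Rightarrow> 'z" where
  "function_distribution g \<phi> = integral UNIV (\<lambda>t. \<phi> t *\<^sub>C g t)"

text \<open>\<open>\<langle>f^, \<phi>\<rangle> = \<langle>f, \<phi>^\<rangle>\<close> for tempered \<open>f\<close>. Here \<open>\<phi>^\<close> is in general only a Schwartz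
  function, even if \<open>\<phi>\<close> has compact support; a tempered distribution is again a total function, and
  for singular supports only the values of \<open>f^\<close> on compactly supported \<open>\<phi>\<close> are used.\<close>

definition fourier_distribution ::
    "((real \<Rightarrow> complex) \<Rightarrow> 'z) \<Rightarrow> (real \<Rightarrow> complex) \<Rightarrow> 'z" where
  "fourier_distribution f \<phi> = f (fourier \<phi>)"

definition C0_functions :: "(real \<Rightarrow> 'z::complex_banach) set" where
  "C0_functions = {g. continuous_on UNIV g \<and> (g \<longlongrightarrow> 0) at_infinity}"

definition pseudofunctions :: "((real \<Rightarrow> complex) \<Rightarrow> 'z::complex_banach) set" where
  "pseudofunctions = {fourier_distribution (function_distribution g) | g. g \<in> C0_functions}"

definition local_pseudofunction ::
    "real set \<Rightarrow> ((real \<Rightarrow> complex) \<Rightarrow> 'z::complex_banach) \<Rightarrow> bool" where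
  "local_pseudofunction I f \<longleftrightarrow>
     distribution_on I f \<and>
     (\<forall>\<xi>\<^sub>0\<in>I. \<exists>I'. open I' \<and> \<xi>\<^sub>0 \<in> I' \<and> I' \<subseteq> I \<and>
        (\<exists>h\<in>pseudofunctions. \<forall>\<phi>\<in>test_functions I'. f \<phi> = h \<phi>))"

definition sing_supp_PF :: "((real \<Rightarrow> complex) \<Rightarrow> 'z::complex_banach) \<Rightarrow> real set" where
  "sing_supp_PF f = - \<Union>{U. open U \<and> local_pseudofunction U f}"


section \<open>Semigroups, generators and resolvents\<close>

definition bounded_clinear :: "('a::complex_banach \<Rightarrow> 'a) \<Rightarrow> bool" where
  "bounded_clinear S \<longleftrightarrow> bounded_linear S \<and> (\<forall>c u. S (c *\<^sub>C u) = c *\<^sub>C S u)"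

definition C0_semigroup :: "(real \<Rightarrow> 'a::complex_banach \<Rightarrow> 'a) \<Rightarrow> bool" where
  "C0_semigroup T \<longleftrightarrow>
     (\<forall>t\<ge>0. bounded_clinear (T t)) \<and>
     (\<forall>u. T 0 u = u) \<and>
     (\<forall>s\<ge>0. \<forall>t\<ge>0. \<forall>u. T (s + t) u = T s (T t u)) \<and>
     (\<forall>u. ((\<lambda>t. T t u) \<longlongrightarrow> u) (at_right 0))"

definition bounded_semigroup :: "(real \<Rightarrow> 'a::complex_banach \<Rightarrow> 'a) \<Rightarrow> bool" where
  "bounded_semigroup T \<longleftrightarrow> bdd_above ((\<lambda>t. onorm (T t)) ` {0..})"

text \<open>An unbounded operator is a pair of its domain and a total function, whose
  values outside the domain are irrelevant.\<close>

type_synonym 'a unbounded_op = "'a set \<times> ('a \<Rightarrow> 'a)"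

definition generator :: "(real \<Rightarrow> 'a::complex_banach \<Rightarrow> 'a) \<Rightarrow> 'a unbounded_op" where
  "generator T =
     ({u. \<exists>v. ((\<lambda>h. (1 / h) *\<^sub>R (T h u - u)) \<longlongrightarrow> v) (at_right 0)},
      \<lambda>u. Lim (at_right 0) (\<lambda>h. (1 / h) *\<^sub>R (T h u - u)))"

text \<open>The inverse of \<open>\<mu> - A\<close> on the domain of \<open>A\<close>; meaningful for \<open>\<mu>\<close> in the resolvent set, which
  contains the open right half-plane if \<open>A\<close> generates a bounded semigroup.\<close>

definition resolvent :: "complex \<Rightarrow> 'a::complex_banach unbounded_op \<Rightarrow> 'a \<Rightarrow> 'a" where
  "resolvent \<mu> A = inv_into (fst A) (\<lambda>u. \<mu> *\<^sub>C u - snd A u)"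

text \<open>The boundary distribution \<open>R(i\<cdot>,A)x\<close>, that is the distributional limit of
  \<open>\<xi> \<mapsto> R(\<alpha> + i\<xi>,A)x\<close> as \<open>\<alpha> \<rightarrow> 0+\<close>.\<close>

definition boundary_resolvent ::
    "'a::complex_banach unbounded_op \<Rightarrow> 'a \<Rightarrow> (real \<Rightarrow> complex) \<Rightarrow> 'a" where
  "boundary_resolvent A x \<phi> =
     Lim (at_right 0) (\<lambda>\<alpha>. integral UNIV (\<lambda>\<xi>. \<phi> \<xi> *\<^sub>C resolvent (Complex \<alpha> \<xi>) A x))"

definition PF_spectrum :: "'a::complex_banach unbounded_op \<Rightarrow> 'a \<Rightarrow> complex set" where
  "PF_spectrum A x = (\<lambda>\<xi>. \<i> * complex_of_real \<xi>) ` sing_supp_PF (boundary_resolvent A x)"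

end

theory Submission
  imports Defs "HOL-Probability.Sinc_Integral" "HOL-Probability.Characteristic_Functions" "HOL-Real_Asymp.Real_Asymp"
begin

text \<open>For a bounded semigroup, the boundary resolvent \<open>R(i\<sqdot>,A)x\<close> is the Fourier transform of the orbit
  \<open>t \<mapsto> T(t)x\<close> extended by \<open>0\<close> to \<open>t < 0\<close> (\<open>boundary_resolvent_eq\<close>). For a test function \<open>\<phi>\<close> let
  \<open>F\<^sub>\<phi>(s)\<close> be its pairing with \<open>e\<^sup>i\<^sup>s\<^sup>\<xi> \<phi>(\<xi>)\<close>; this is a convolution of the orbit with an integrable
  kernel (\<open>smoothed_orbit\<close>). The proof rests on two facts about the singular support: a point lies
  outside it if \<open>F\<^sub>\<phi> \<rightarrow> 0\<close> at infinity for some \<open>\<phi>\<close> equal to \<open>1\<close> near the point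
  (\<open>not_in_sing_suppI\<close>), and conversely \<open>F\<^sub>\<phi> \<rightarrow> 0\<close> for every \<open>\<phi>\<close> supported off the singular
  support (\<open>smoothed_orbit_tendsto_0\<close>, by a partition of unity).

  If the orbit tends to \<open>0\<close>, so does every \<open>F\<^sub>\<phi>\<close>, and the singular support is empty. Conversely, if
  the latter is empty, then all \<open>F\<^sub>\<phi>\<close> tend to \<open>0\<close>; since the orbit is uniformly continuous, it is
  approximated by convolutions of this kind, uniformly for large times, and tends to \<open>0\<close> as well
  (\<open>smoothed_imp_orbit_tendsto_0\<close>).

  If the singular support is countable but not empty, it has an isolated point \<open>\<xi>\<^sub>0\<close>, by Baire's
  theorem. An isolated point at which \<open>\<alpha> R(\<alpha> + i \<xi>\<^sub>0,A)x \<rightarrow> 0\<close> is removable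
  (\<open>isolated_not_in_sing_supp\<close>): the splitting \<open>x = \<alpha> z + (i \<xi>\<^sub>0 - A) z\<close> with
  \<open>z = R(\<alpha> + i \<xi>\<^sub>0,A)x\<close> has a small first part, uniformly along the orbit, while in the second part
  \<open>i \<xi>\<^sub>0 - A\<close> acts on \<open>F\<^sub>\<phi>\<close> as multiplication of \<open>\<phi>\<close> by \<open>\<xi> - \<xi>\<^sub>0\<close>, up to a factor and a boundary
  term. A test function that vanishes at \<open>\<xi>\<^sub>0\<close> only sees the complement of \<open>\<xi>\<^sub>0\<close>, where the
  distribution is a local pseudofunction. Hence the singular support is empty.

  Vector-valued integrals are improper gauge integrals of dominated continuous functions;
  \<open>Fubini_dominated\<close> exchanges them. Fourier inversion for test functions comes from Gaussian
  summation (\<open>integral_fourier\<close>).\<close>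

section \<open>Smooth functions and cutoffs\<close>

lemma iterated_deriv_0 [simp]: "iterated_deriv 0 \<phi> = \<phi>"
  by (simp add: iterated_deriv_def)

lemma iterated_deriv_Suc:
  "iterated_deriv (Suc k) \<phi> = (\<lambda>t. vector_derivative (iterated_deriv k \<phi>) (at t))"
  by (simp add: iterated_deriv_def)

lemma iterated_deriv_add:
  "iterated_deriv j (iterated_deriv k \<phi>) = iterated_deriv (j + k) \<phi>"
  by (simp add: iterated_deriv_def funpow_add)

lemma smooth_fun_has_derivative:
  assumes "smooth_fun \<phi>"
  shows "(iterated_deriv k \<phi> has_vector_derivative iterated_deriv (Suc k) \<phi> t) (at t within S)"
  using assms
  by (metis smooth_fun_def iterated_deriv_Suc vector_derivative_works has_vector_derivative_at_within)

lemma smooth_fun_iterated_deriv: "smooth_fun \<phi> \<Longrightarrow> smooth_fun (iterated_deriv k \<phi>)"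
  by (simp add: smooth_fun_def iterated_deriv_add)

lemma smooth_fun_continuous_on: "smooth_fun \<phi> \<Longrightarrow> continuous_on S (iterated_deriv k \<phi>)"
  by (meson continuous_on_eq_continuous_within differentiable_imp_continuous_within
      smooth_fun_def continuous_at_imp_continuous_at_within)

text \<open>A function is smooth if it lies in a set in which every function has a derivative that is in the
  set again or already known to be smooth. This avoids formulas for iterated derivatives.\<close>

lemma smooth_fun_coinduct:
  assumes "\<phi> \<in> S"
    and "\<And>f. f \<in> S \<Longrightarrow> \<exists>f'. (f' \<in> S \<or> smooth_fun f') \<and> (\<forall>t. (f has_vector_derivative f' t) (at t))"
  shows "smooth_fun \<phi>"
proof -
  have "iterated_deriv k \<phi> \<in> S \<or> smooth_fun (iterated_deriv k \<phi>)" for k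
  proof (induction k)
    case 0 then show ?case using assms by simp
  next
    case (Suc k)
    show ?case
    proof (cases "smooth_fun (iterated_deriv k \<phi>)")
      case True
      then show ?thesis
        using smooth_fun_iterated_deriv[OF True, of 1] by (simp add: iterated_deriv_add)
    next
      case False
      with Suc assms(2)[of "iterated_deriv k \<phi>"] obtain f' where
        f': "f' \<in> S \<or> smooth_fun f'" "\<And>t. (iterated_deriv k \<phi> has_vector_derivative f' t) (at t)"
        by auto
      then have "iterated_deriv (Suc k) \<phi> = f'"
        by (auto simp: iterated_deriv_Suc fun_eq_iff intro!: vector_derivative_at)
      with f' show ?thesis by simp
    qed
  qed
  then have "iterated_deriv k \<phi> differentiable at t" for k t
    using assms(2)[of "iterated_deriv k \<phi>"]
    by (metis differentiableI_vector smooth_fun_def iterated_deriv_0)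
  then show ?thesis by (simp add: smooth_fun_def)
qed

lemma smooth_fun_add:
  assumes "smooth_fun \<phi>" "smooth_fun \<psi>"
  shows "smooth_fun (\<lambda>t. \<phi> t + \<psi> t)"
proof (rule smooth_fun_coinduct)
  let ?S = "{(\<lambda>t. \<phi> t + \<psi> t) |\<phi> \<psi>. smooth_fun \<phi> \<and> smooth_fun \<psi>}"
  show "(\<lambda>t. \<phi> t + \<psi> t) \<in> ?S" using assms by blast
  fix f assume "f \<in> ?S"
  then obtain \<phi> \<psi> where f: "f = (\<lambda>t. \<phi> t + \<psi> t)" "smooth_fun \<phi>" "smooth_fun \<psi>" by blast
  show "\<exists>f'. (f' \<in> ?S \<or> smooth_fun f') \<and> (\<forall>t. (f has_vector_derivative f' t) (at t))"
    using smooth_fun_has_derivative[OF f(2), of 0] smooth_fun_has_derivative[OF f(3), of 0]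
      smooth_fun_iterated_deriv[OF f(2), of 1] smooth_fun_iterated_deriv[OF f(3), of 1] f(1)
    by (intro exI[of _ "\<lambda>t. iterated_deriv 1 \<phi> t + iterated_deriv 1 \<psi> t"])
      (auto intro!: has_vector_derivative_add)
qed

lemma smooth_fun_zero: "smooth_fun (\<lambda>t. 0)"
  by (rule smooth_fun_coinduct[of _ "{\<lambda>t. 0}"]) (auto intro!: exI[of _ "\<lambda>t. 0"] derivative_eq_intros)

text \<open>Products are not closed under differentiation, but sums of products are; this is the
  class to which the coinduction rule applies.\<close>

inductive_set product_sums :: "(real \<Rightarrow> complex) set" where
  "smooth_fun \<phi> \<Longrightarrow> smooth_fun \<psi> \<Longrightarrow> (\<lambda>t. \<phi> t * \<psi> t) \<in> product_sums"
| "f \<in> product_sums \<Longrightarrow> g \<in> product_sums \<Longrightarrow> (\<lambda>t. f t + g t) \<in> product_sums"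

lemma smooth_fun_mult:
  assumes "smooth_fun \<phi>" "smooth_fun \<psi>"
  shows "smooth_fun (\<lambda>t. \<phi> t * \<psi> t)"
proof (rule smooth_fun_coinduct)
  show "(\<lambda>t. \<phi> t * \<psi> t) \<in> product_sums" using assms by (rule product_sums.intros)
  fix f assume "f \<in> product_sums"
  then have "\<exists>f'. f' \<in> product_sums \<and> (\<forall>t. (f has_vector_derivative f' t) (at t))"
  proof induction
    case (1 \<phi> \<psi>)
    show ?case
      using smooth_fun_has_derivative[OF 1(1), of 0] smooth_fun_has_derivative[OF 1(2), of 0]
        smooth_fun_iterated_deriv[OF 1(1), of 1] smooth_fun_iterated_deriv[OF 1(2), of 1] 1
      by (intro exI[of _ "\<lambda>t. \<phi> t * iterated_deriv 1 \<psi> t + iterated_deriv 1 \<phi> t * \<psi> t"])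
        (auto intro!: has_vector_derivative_mult product_sums.intros)
  next
    case (2 f g)
    then obtain f' g' where "f' \<in> product_sums" "g' \<in> product_sums"
      "\<forall>t. (f has_vector_derivative f' t) (at t)" "\<forall>t. (g has_vector_derivative g' t) (at t)" by blast
    then show ?case
      by (intro exI[of _ "\<lambda>t. f' t + g' t"]) (auto intro!: has_vector_derivative_add product_sums.intros)
  qed
  then show "\<exists>f'. (f' \<in> product_sums \<or> smooth_fun f') \<and> (\<forall>t. (f has_vector_derivative f' t) (at t))"
    by blast
qed

lemma smooth_fun_linear: "smooth_fun (\<lambda>t. a + b * complex_of_real t)"
proof (rule smooth_fun_coinduct)
  let ?S = "{\<lambda>t. a + b * complex_of_real t |a b. True}"
  show "(\<lambda>t. a + b * complex_of_real t) \<in> ?S" by blast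
  fix f assume "f \<in> ?S"
  then obtain a b where f: "f = (\<lambda>t. a + b * complex_of_real t)" by blast
  have "(\<lambda>t. b) \<in> ?S" by (rule CollectI, rule exI[of _ b], rule exI[of _ 0]) simp
  moreover have "\<forall>t. (f has_vector_derivative b) (at t)"
    unfolding f by (auto intro!: derivative_eq_intros has_vector_derivative_real_field)
  ultimately show "\<exists>f'. (f' \<in> ?S \<or> smooth_fun f') \<and> (\<forall>t. (f has_vector_derivative f' t) (at t))"
    by (intro exI[of _ "\<lambda>t. b"]) simp
qed

lemma smooth_fun_const: "smooth_fun (\<lambda>t. c)"
  using smooth_fun_linear[of c 0] by simp

lemma smooth_fun_cmult: "smooth_fun \<phi> \<Longrightarrow> smooth_fun (\<lambda>t. c * \<phi> t)"
  by (rule smooth_fun_mult[OF smooth_fun_const])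

lemma smooth_fun_diff: "smooth_fun \<phi> \<Longrightarrow> smooth_fun \<psi> \<Longrightarrow> smooth_fun (\<lambda>t. \<phi> t - \<psi> t)"
  using smooth_fun_add[OF _ smooth_fun_cmult[of \<psi> "-1"], of \<phi>] by simp

lemma smooth_fun_exp: "smooth_fun (\<lambda>t. exp (\<i> * of_real s * complex_of_real t))"
proof (rule smooth_fun_coinduct)
  let ?e = "\<lambda>t. exp (\<i> * of_real s * complex_of_real t)"
  let ?S = "{\<lambda>t. c * ?e t |c. True}"
  have "?e = (\<lambda>t. 1 * ?e t)" by simp
  then show "?e \<in> ?S" by blast
  fix f assume "f \<in> ?S"
  then obtain c where f: "f = (\<lambda>t. c * ?e t)" by blast
  have "\<forall>t. (f has_vector_derivative (c * (\<i> * of_real s)) * ?e t) (at t)"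
    unfolding f by (auto intro!: derivative_eq_intros has_vector_derivative_real_field)
  then show "\<exists>f'. (f' \<in> ?S \<or> smooth_fun f') \<and> (\<forall>t. (f has_vector_derivative f' t) (at t))"
    by (intro exI[of _ "\<lambda>t. (c * (\<i> * of_real s)) * ?e t"]) blast
qed

lemma smooth_fun_affine:
  assumes "smooth_fun \<phi>"
  shows "smooth_fun (\<lambda>t. \<phi> (a * t + b))"
proof (rule smooth_fun_coinduct)
  let ?S = "{\<lambda>t. c * \<phi> (a * t + b) |c \<phi>. smooth_fun \<phi>}"
  have "(\<lambda>t. \<phi> (a * t + b)) = (\<lambda>t. 1 * \<phi> (a * t + b))" by simp
  then show "(\<lambda>t. \<phi> (a * t + b)) \<in> ?S" using assms by blast
  fix f assume "f \<in> ?S"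
  then obtain c \<phi> where f: "f = (\<lambda>t. c * \<phi> (a * t + b))" "smooth_fun \<phi>" by blast
  have "(f has_vector_derivative (c * of_real a) * iterated_deriv 1 \<phi> (a * t + b)) (at t)" for t
  proof -
    have "((\<lambda>t. a * t + b) has_vector_derivative a) (at t)"
      by (auto intro!: derivative_eq_intros)
    from vector_diff_chain_at[OF this] smooth_fun_has_derivative[OF f(2), of 0 "a * t + b" UNIV]
    have "((\<lambda>t. \<phi> (a * t + b)) has_vector_derivative a *\<^sub>R iterated_deriv 1 \<phi> (a * t + b)) (at t)"
      by (simp add: o_def)
    from has_vector_derivative_mult_right[OF this, of c] show ?thesis
      by (simp add: f(1) scaleR_conv_of_real mult.assoc)
  qed
  then show "\<exists>f'. (f' \<in> ?S \<or> smooth_fun f') \<and> (\<forall>t. (f has_vector_derivative f' t) (at t))"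
    using smooth_fun_iterated_deriv[OF f(2), of 1]
    by (intro exI[of _ "\<lambda>t. (c * of_real a) * iterated_deriv 1 \<phi> (a * t + b)"]) blast
qed

text \<open>The functions \<open>p(1/x) e^{-1/x}\<close>, extended by zero to \<open>x \<le> 0\<close>, are closed under
  differentiation, so that the classical flat function \<open>e^{-1/x}\<close> is smooth.\<close>

definition flat_exp :: "real poly \<Rightarrow> real \<Rightarrow> real" where
  "flat_exp p x = (if x > 0 then poly p (1 / x) * exp (- (1 / x)) else 0)"

lemma tendsto_poly_exp_at_top: "((\<lambda>y::real. poly p y * exp (- y)) \<longlongrightarrow> 0) at_top"
proof -
  have "((\<lambda>y. \<Sum>i\<le>degree p. coeff p i * (y ^ i / exp y)) \<longlongrightarrow> (\<Sum>i\<le>degree p. coeff p i * 0)) at_top"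
    by (intro tendsto_intros tendsto_power_div_exp_0)
  then show ?thesis
    by (simp add: poly_altdef exp_minus field_simps sum_divide_distrib)
qed

lemma flat_exp_has_derivative:
  "(flat_exp p has_real_derivative flat_exp (pCons 0 (pCons 0 (p - pderiv p))) x) (at x)"
proof -
  consider "x > 0" | "x < 0" | "x = 0" by linarith
  then show ?thesis
  proof cases
    case 1
    have "((\<lambda>x. poly p (1 / x) * exp (- (1 / x))) has_real_derivative
        flat_exp (pCons 0 (pCons 0 (p - pderiv p))) x) (at x)"
      using 1 by (auto intro!: derivative_eq_intros DERIV_chain'[OF _ poly_DERIV]
          simp: flat_exp_def field_simps power2_eq_square)
    then show ?thesis
      by (rule has_field_derivative_transform_within[where d = x]) (use 1 in \<open>auto simp: flat_exp_def dist_real_def\<close>)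
  next
    case 2
    have "((\<lambda>x. 0) has_real_derivative flat_exp (pCons 0 (pCons 0 (p - pderiv p))) x) (at x)"
      using 2 by (simp add: flat_exp_def)
    then show ?thesis
      by (rule has_field_derivative_transform_within[where d = "-x"]) (use 2 in \<open>auto simp: flat_exp_def dist_real_def\<close>)
  next
    case 3
    have "((\<lambda>h. flat_exp (pCons 0 p) h) \<longlongrightarrow> 0) (at_right 0)"
    proof -
      have "((\<lambda>h. poly (pCons 0 p) (inverse h) * exp (- inverse h)) \<longlongrightarrow> 0) (at_right 0)"
        using tendsto_poly_exp_at_top filterlim_inverse_at_top_right by (rule filterlim_compose)
      then show ?thesis
        by (rule Lim_transform_eventually)
          (auto simp: flat_exp_def eventually_at_filter inverse_eq_divide)
    qed
    moreover have "((\<lambda>h. flat_exp (pCons 0 p) h) \<longlongrightarrow> 0) (at_left 0)"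
      by (rule Lim_transform_eventually[where f = "\<lambda>h. 0"]) (auto simp: flat_exp_def eventually_at_filter)
    ultimately have "((\<lambda>h. flat_exp (pCons 0 p) h) \<longlongrightarrow> 0) (at 0)"
      by (simp add: filterlim_at_split)
    moreover have "(flat_exp p (0 + h) - flat_exp p 0) / h = flat_exp (pCons 0 p) h" for h
      by (auto simp: flat_exp_def)
    ultimately show ?thesis
      by (simp add: 3 DERIV_def) (simp add: flat_exp_def)
  qed
qed

lemma smooth_fun_flat_exp: "smooth_fun (\<lambda>x. complex_of_real (flat_exp p x))"
proof (rule smooth_fun_coinduct)
  let ?S = "{\<lambda>x. complex_of_real (flat_exp p x) |p. True}"
  show "(\<lambda>x. complex_of_real (flat_exp p x)) \<in> ?S" by blast
  fix f assume "f \<in> ?S"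
  then obtain p where f: "f = (\<lambda>x. complex_of_real (flat_exp p x))" by blast
  show "\<exists>f'. (f' \<in> ?S \<or> smooth_fun f') \<and> (\<forall>t. (f has_vector_derivative f' t) (at t))"
    unfolding f
    by (intro exI[of _ "\<lambda>x. complex_of_real (flat_exp (pCons 0 (pCons 0 (p - pderiv p))) x)"])
      (use flat_exp_has_derivative in \<open>auto intro!: has_vector_derivative_of_real
        simp: has_real_derivative_iff_has_vector_derivative\<close>)
qed

text \<open>The step is the normalised primitive of the bump \<open>flat_exp 1 x * flat_exp 1 (1 - x)\<close>, which is
  supported in the unit interval.\<close>

lemma smooth_step_exists:
  obtains \<sigma> where "smooth_fun \<sigma>" "\<And>t. t \<le> 0 \<Longrightarrow> \<sigma> t = 0" "\<And>t. t \<ge> 1 \<Longrightarrow> \<sigma> t = 1"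
proof -
  define b where "b = (\<lambda>x. flat_exp 1 x * flat_exp 1 (1 - x))"
  have b0: "b x = 0" if "x \<le> 0 \<or> x \<ge> 1" for x
    using that by (auto simp: b_def flat_exp_def)
  have bpos: "b x \<ge> 0" for x by (auto simp: b_def flat_exp_def)
  have cont: "continuous_on S b" for S
    unfolding b_def
    by (intro continuous_intros DERIV_continuous_on[where f = "flat_exp 1", OF flat_exp_has_derivative[THEN DERIV_subset]]
        continuous_on_compose2[where g = "flat_exp 1" and t = UNIV]) auto
  define B where "B = (\<lambda>x. integral {-1..x} b)"
  have B0: "B x = 0" if "x \<le> 0" for x
  proof -
    have "B x = integral {-1..x} (\<lambda>x. 0)"
      unfolding B_def by (rule integral_cong) (use that b0 in auto)
    then show ?thesis by simp
  qed
  have B1: "B x = B 1" if "x \<ge> 1" for x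
  proof -
    have "integral {-1..1} b + integral {1..x} b = integral {-1..x} b"
      by (rule Henstock_Kurzweil_Integration.integral_combine) (use that in \<open>auto intro: integrable_continuous_real cont\<close>)
    moreover have "integral {1..x} b = integral {1..x} (\<lambda>x. 0)"
      by (rule integral_cong) (use b0 in auto)
    ultimately show ?thesis by (simp add: B_def)
  qed
  have "B 1 \<noteq> 0"
  proof
    assume "B 1 = 0"
    then have "b (1/2) = 0"
      using integral_eq_0_iff[of "-1" 1 b] bpos cont by (auto simp: B_def)
    then show False by (simp add: b_def flat_exp_def)
  qed
  have DB: "(B has_real_derivative b x) (at x)" for x
  proof (cases "x > -1")
    case True
    have "(B has_real_derivative b x) (at x within {-1..x+1})"
      unfolding B_def has_real_derivative_iff_has_vector_derivative
      by (rule integral_has_vector_derivative) (use True cont in auto)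
    then show ?thesis
      using True by (simp add: at_within_Icc_at)
  next
    case False
    have "((\<lambda>x. 0) has_real_derivative b x) (at x)" using False b0 by simp
    then show ?thesis
      by (rule has_field_derivative_transform_within[where d = 1]) (use False B0 in \<open>auto simp: dist_real_def\<close>)
  qed
  define \<sigma> where "\<sigma> = (\<lambda>x. complex_of_real (B x / B 1))"
  have sb: "smooth_fun (\<lambda>x. complex_of_real (b x))"
    using smooth_fun_mult[OF smooth_fun_flat_exp[of 1] smooth_fun_affine[OF smooth_fun_flat_exp[of 1], of "-1" 1]]
    by (simp add: b_def add.commute)
  have "smooth_fun \<sigma>"
  proof (rule smooth_fun_coinduct[where S = "{\<sigma>}"])
    fix f assume "f \<in> {\<sigma>}"
    have "(\<sigma> has_vector_derivative of_real (b t / B 1)) (at t)" for t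
      unfolding \<sigma>_def
      using DERIV_cdivide[OF DB[of t], of "B 1"]
      by (intro has_vector_derivative_of_real) (simp add: has_real_derivative_iff_has_vector_derivative)
    then show "\<exists>f'. (f' \<in> {\<sigma>} \<or> smooth_fun f') \<and> (\<forall>t. (f has_vector_derivative f' t) (at t))"
      using smooth_fun_cmult[OF sb, of "1 / of_real (B 1)"] \<open>f \<in> {\<sigma>}\<close>
      by (intro exI[of _ "\<lambda>t. of_real (b t / B 1)"]) (auto simp: mult.commute)
  qed simp
  moreover have "\<sigma> t = 1" if "t \<ge> 1" for t
    unfolding \<sigma>_def B1[OF that] using \<open>B 1 \<noteq> 0\<close> by simp
  moreover have "\<sigma> t = 0" if "t \<le> 0" for t
    by (simp add: \<sigma>_def B0[OF that])
  ultimately show ?thesis using that by blast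
qed

definition smooth_step :: "real \<Rightarrow> complex" where
  "smooth_step = (SOME \<sigma>. smooth_fun \<sigma> \<and> (\<forall>t\<le>0. \<sigma> t = 0) \<and> (\<forall>t\<ge>1. \<sigma> t = 1))"

lemma smooth_step:
  "smooth_fun smooth_step" "t \<le> 0 \<Longrightarrow> smooth_step t = 0" "t \<ge> 1 \<Longrightarrow> smooth_step t = 1"
proof -
  have "\<exists>\<sigma>. smooth_fun \<sigma> \<and> (\<forall>t\<le>0. \<sigma> t = 0) \<and> (\<forall>t\<ge>1. \<sigma> t = 1)"
    by (rule smooth_step_exists) blast
  from someI_ex[OF this]
  have "smooth_fun smooth_step \<and> (\<forall>t\<le>0. smooth_step t = 0) \<and> (\<forall>t\<ge>1. smooth_step t = 1)"
    unfolding smooth_step_def .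
  then show "smooth_fun smooth_step" "t \<le> 0 \<Longrightarrow> smooth_step t = 0" "t \<ge> 1 \<Longrightarrow> smooth_step t = 1"
    by auto
qed

definition plateau :: "real \<Rightarrow> complex" where
  "plateau t = smooth_step (t + 2) - smooth_step (t - 1)"

lemma smooth_fun_plateau: "smooth_fun plateau"
  using smooth_fun_diff[OF smooth_fun_affine[OF smooth_step(1), of 1 2] smooth_fun_affine[OF smooth_step(1), of 1 "-1"]]
  by (simp add: plateau_def[abs_def])

lemma plateau_eq: "\<bar>t\<bar> \<le> 1 \<Longrightarrow> plateau t = 1" "\<bar>t\<bar> \<ge> 2 \<Longrightarrow> plateau t = 0"
  by (auto simp: plateau_def smooth_step abs_if split: if_splits)

text \<open>Differences of neighbouring translates of the step, so that their sum telescopes.\<close>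

definition partition_bump :: "int \<Rightarrow> real \<Rightarrow> complex" where
  "partition_bump k t = smooth_step (t - of_int k) - smooth_step (t - of_int k - 1)"

lemma smooth_fun_partition_bump: "smooth_fun (partition_bump k)"
  using smooth_fun_diff[OF smooth_fun_affine[OF smooth_step(1), of 1 "- of_int k"]
      smooth_fun_affine[OF smooth_step(1), of 1 "- of_int k - 1"]]
  by (simp add: partition_bump_def[abs_def] algebra_simps)

lemma partition_bump_eq_0: "t \<le> of_int k \<or> t \<ge> of_int k + 2 \<Longrightarrow> partition_bump k t = 0"
  by (auto simp: partition_bump_def smooth_step)

lemma sum_partition_bump:
  assumes "\<bar>t\<bar> \<le> real n"
  shows "(\<Sum>k\<in>{- int n - 1..int n}. partition_bump k t) = 1"
proof -
  have *: "(\<Sum>k\<in>{a..<a + int m}. partition_bump k t) = smooth_step (t - of_int a) - smooth_step (t - of_int a - m)" for a m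
  proof (induction m)
    case (Suc m)
    have "{a..<a + int (Suc m)} = insert (a + int m) {a..<a + int m}" by auto
    then show ?case using Suc by (simp add: partition_bump_def algebra_simps)
  qed simp
  have "{- int n - 1..int n} = {(- int n - 1)..<(- int n - 1) + int (2 * n + 2)}" by auto
  then show ?thesis
    using assms *[of "- int n - 1" "2 * n + 2"] by (auto simp: smooth_step algebra_simps abs_if split: if_splits)
qed

subsection \<open>Test functions\<close>

lemma test_functions_UNIV: "\<phi> \<in> test_functions I \<Longrightarrow> \<phi> \<in> test_functions UNIV"
  by (auto simp: test_functions_def)

lemma test_function_smooth: "\<phi> \<in> test_functions I \<Longrightarrow> smooth_fun \<phi>"
  by (simp add: test_functions_def)

lemma test_function_intro:
  assumes "smooth_fun \<phi>" "compact K" "K \<subseteq> I" "\<And>t. t \<notin> K \<Longrightarrow> \<phi> t = 0"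
  shows "\<phi> \<in> test_functions I"
proof -
  have "fun_support \<phi> \<subseteq> K"
    unfolding fun_support_def using assms by (intro closure_minimal compact_imp_closed) auto
  then show ?thesis
    using assms compact_Int_closed[of K "fun_support \<phi>"]
    by (auto simp: test_functions_def fun_support_def inf.absorb2)
qed

lemma test_function_support: "t \<notin> fun_support \<phi> \<Longrightarrow> \<phi> t = 0"
  using closure_subset[of "{t. \<phi> t \<noteq> 0}"] by (auto simp: fun_support_def)

lemma iterated_deriv_eq_0:
  assumes "t \<notin> fun_support \<phi>" "smooth_fun \<phi>"
  shows "iterated_deriv k \<phi> t = 0"
  using assms(1)
proof (induction k arbitrary: t)
  case 0 then show ?case by (simp add: test_function_support)
next
  case (Suc k)
  have "open (- fun_support \<phi>)" by (simp add: fun_support_def open_Compl)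
  then have "((\<lambda>t. 0) has_vector_derivative iterated_deriv (Suc k) \<phi> t) (at t)"
    by (rule has_vector_derivative_transform_within_open[OF smooth_fun_has_derivative[OF assms(2)]])
      (use Suc in auto)
  then show ?case
    using vector_derivative_unique_at has_vector_derivative_const by blast
qed

lemma test_function_iterated_deriv:
  assumes "\<phi> \<in> test_functions I"
  shows "iterated_deriv k \<phi> \<in> test_functions I"
  using assms iterated_deriv_eq_0[of _ \<phi> k]
  by (intro test_function_intro[of _ "fun_support \<phi>"])
    (auto simp: test_functions_def intro: smooth_fun_iterated_deriv)

lemma test_function_mult:
  assumes "\<phi> \<in> test_functions I" "smooth_fun \<psi>"
  shows "(\<lambda>t. \<psi> t * \<phi> t) \<in> test_functions I" "(\<lambda>t. \<phi> t * \<psi> t) \<in> test_functions I"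
  using assms
  by (auto intro!: test_function_intro[of _ "fun_support \<phi>"] smooth_fun_mult simp: test_function_support)
    (auto simp: test_functions_def)

lemma test_function_cmult: "\<phi> \<in> test_functions I \<Longrightarrow> (\<lambda>t. c * \<phi> t) \<in> test_functions I"
  by (rule test_function_mult(1)[OF _ smooth_fun_const])

lemma test_function_add:
  assumes "\<phi> \<in> test_functions I" "\<psi> \<in> test_functions I"
  shows "(\<lambda>t. \<phi> t + \<psi> t) \<in> test_functions I"
  using assms
  by (intro test_function_intro[of _ "fun_support \<phi> \<union> fun_support \<psi>"])
    (auto simp: test_functions_def test_function_support intro: smooth_fun_add)

lemma test_function_diff:
  assumes "\<phi> \<in> test_functions I" "\<psi> \<in> test_functions I"
  shows "(\<lambda>t. \<phi> t - \<psi> t) \<in> test_functions I"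
  using test_function_add[OF assms(1) test_function_cmult[OF assms(2), of "-1"]] by simp

lemma test_function_sum:
  "(\<And>i. i \<in> A \<Longrightarrow> f i \<in> test_functions I) \<Longrightarrow> (\<lambda>t. \<Sum>i\<in>A. f i t) \<in> test_functions I"
  by (induction A rule: infinite_finite_induct)
    (auto intro: test_function_add test_function_intro[of _ "{}"] smooth_fun_zero)

lemma test_function_bound:
  assumes "\<phi> \<in> test_functions I"
  obtains R where "R > 0" "\<And>t. \<bar>t\<bar> \<ge> R \<Longrightarrow> \<phi> t = 0"
proof -
  have "bounded (fun_support \<phi>)" using assms by (simp add: test_functions_def compact_imp_bounded)
  then obtain R where "\<forall>t\<in>fun_support \<phi>. \<bar>t\<bar> \<le> R" by (auto simp: bounded_iff)
  then show ?thesis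
    by (intro that[of "\<bar>R\<bar> + 1"]) (use test_function_support[of _ \<phi>] in force)+
qed

lemma test_function_affine:
  assumes "\<phi> \<in> test_functions UNIV" "a \<noteq> 0"
  shows "(\<lambda>t. \<phi> (a * t + b)) \<in> test_functions UNIV"
proof -
  obtain R where R: "R > 0" "\<And>t. \<bar>t\<bar> \<ge> R \<Longrightarrow> \<phi> t = 0" using test_function_bound[OF assms(1)] by blast
  have "\<phi> (a * t + b) = 0" if "\<bar>t\<bar> > (R + \<bar>b\<bar>) / \<bar>a\<bar>" for t
    using that assms(2) abs_mult[of a t] by (intro R(2)) (auto simp: field_simps)
  then show ?thesis
    by (intro test_function_intro[of _ "{- ((R + \<bar>b\<bar>) / \<bar>a\<bar>)..(R + \<bar>b\<bar>) / \<bar>a\<bar>}"] smooth_fun_affine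
        test_function_smooth[OF assms(1)]) (auto simp: abs_if split: if_splits)
qed

lemma plateau_test_function:
  assumes "r > 0"
  shows "(\<lambda>t. plateau ((t - c) / r)) \<in> test_functions {c - 2 * r..c + 2 * r}"
  using smooth_fun_affine[OF smooth_fun_plateau, of "1/r" "-c/r"] assms plateau_eq(2)
  by (intro test_function_intro[of _ "{c - 2 * r..c + 2 * r}"])
    (auto simp: field_simps abs_if)

section \<open>Dominated integrals of Banach space valued functions\<close>

text \<open>Improper integrals are handled as limits of integrals over \<open>S \<inter> {-r..r}\<close>: when \<open>S\<close> is a
  closed interval, these sets are compact intervals, on which continuity of the integrand suffices.\<close>

lemma integral_exhaust:
  fixes f :: "real \<Rightarrow> 'a::banach"
  assumes "f integrable_on S"
  shows "((\<lambda>r. integral (S \<inter> {-r..r}) f) \<longlongrightarrow> integral S f) at_top"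
proof (rule tendstoI)
  fix e :: real assume "e > 0"
  have "(f has_integral integral S f) S" using assms by (rule integrable_integral)
  then obtain B where B: "B > 0" "\<And>a b. ball 0 B \<subseteq> cbox a b \<Longrightarrow>
      norm (integral (cbox a b) (\<lambda>x. if x \<in> S then f x else 0) - integral S f) < e"
    using \<open>e > 0\<close> unfolding has_integral_alt'[of f] by metis
  show "\<forall>\<^sub>F r in at_top. dist (integral (S \<inter> {-r..r}) f) (integral S f) < e"
  proof (rule eventually_at_top_linorderI[of B])
    fix r assume "B \<le> r"
    then have "ball 0 B \<subseteq> cbox (-r) r" by (auto simp: dist_real_def)
    from B(2)[OF this] show "dist (integral (S \<inter> {-r..r}) f) (integral S f) < e"
      by (simp add: dist_norm integral_restrict_Int Int_commute)
  qed
qed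

lemma closed_interval_Int_Icc:
  fixes S :: "real set"
  assumes "closed S" "is_interval S"
  obtains c d where "S \<inter> {a..b} = {c..d}"
proof -
  have "compact (S \<inter> {a..b})" using assms by (simp add: closed_Int_compact)
  moreover have "connected (S \<inter> {a..b})"
    using assms by (simp add: is_interval_Int is_interval_cc is_interval_connected)
  ultimately show ?thesis using connected_compact_interval_1 that by metis
qed

lemma dominated_integrable_on:
  fixes u :: "real \<Rightarrow> 'a::banach"
  assumes S: "closed S" "is_interval S"
    and "continuous_on S u" "\<And>t. t \<in> S \<Longrightarrow> norm (u t) \<le> b t" "b integrable_on S"
  shows "u integrable_on S"
proof (rule integrable_on_all_intervals_integrable_bound[OF _ assms(4,5)])
  fix l r :: real
  obtain c d where cd: "S \<inter> {l..r} = {c..d}" by (rule closed_interval_Int_Icc[OF S])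
  have "u integrable_on {c..d}"
    by (rule integrable_continuous_real[OF continuous_on_subset[OF assms(3)]]) (use cd in blast)
  then have "u integrable_on (cbox l r \<inter> S)" using cd by (simp add: Int_commute)
  then show "(\<lambda>x. if x \<in> S then u x else 0) integrable_on cbox l r"
    by (simp add: integrable_restrict_Int Int_commute)
qed

lemma norm_integral_diff_le:
  fixes u :: "real \<Rightarrow> 'a::banach"
  assumes "u integrable_on S" "u integrable_on (S \<inter> A)" "b integrable_on S" "b integrable_on (S \<inter> A)"
    and "\<And>t. t \<in> S \<Longrightarrow> norm (u t) \<le> b t"
  shows "norm (integral S u - integral (S \<inter> A) u) \<le> integral S b - integral (S \<inter> A) b"
proof -
  have *: "integral S f - integral (S \<inter> A) f = integral S (\<lambda>t. f t - (if t \<in> A then f t else 0))"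
    "(\<lambda>t. f t - (if t \<in> A then f t else 0)) integrable_on S"
    if "f integrable_on S" "f integrable_on (S \<inter> A)" for f :: "real \<Rightarrow> 'b::banach"
    using that integrable_restrict_Int[of A f S] integral_restrict_Int[of S A f]
    by (simp_all add: Int_commute Henstock_Kurzweil_Integration.integral_diff integrable_diff)
  show ?thesis
    unfolding *(1)[OF assms(1,2)] *(1)[OF assms(3,4)]
    by (rule integral_norm_bound_integral[OF *(2)[OF assms(1,2)] *(2)[OF assms(3,4)]])
      (use assms(5) in auto)
qed

lemma integrable_Int_Icc:
  fixes u :: "real \<Rightarrow> 'a::banach"
  assumes "u integrable_on S"
  shows "u integrable_on (S \<inter> {a..b})"
proof -
  have "(\<lambda>x. if x \<in> S then u x else 0) integrable_on cbox a b"
    using integrable_on_subcbox[of "\<lambda>x. if x \<in> S then u x else 0" UNIV a b] assms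
    by (simp add: integrable_restrict_UNIV)
  then show ?thesis by (simp add: integrable_restrict_Int)
qed

lemma integral_FTC_at_top:
  fixes F :: "real \<Rightarrow> 'a::banach"
  assumes "\<And>t. t \<ge> 0 \<Longrightarrow> (F has_vector_derivative f t) (at t within {0..})"
    and "f integrable_on {0..}" and "(F \<longlongrightarrow> L) at_top"
  shows "integral {0..} f = L - F 0"
proof (rule tendsto_unique[OF _ integral_exhaust[OF assms(2)]])
  have "((\<lambda>r. F r - F 0) \<longlongrightarrow> L - F 0) at_top" using assms(3) by (intro tendsto_intros)
  then show "((\<lambda>r. integral ({0..} \<inter> {- r..r}) f) \<longlongrightarrow> L - F 0) at_top"
  proof (rule Lim_transform_eventually)
    show "\<forall>\<^sub>F r in at_top. F r - F 0 = integral ({0..} \<inter> {- r..r}) f"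
    proof (rule eventually_at_top_linorderI[of 0])
      fix r :: real assume "0 \<le> r"
      then have "(f has_integral F r - F 0) {0..r}"
        by (intro fundamental_theorem_of_calculus has_vector_derivative_within_subset[OF assms(1)]) auto
      moreover have "{0..} \<inter> {- r..r} = {0..r}" using \<open>0 \<le> r\<close> by auto
      ultimately show "F r - F 0 = integral ({0..} \<inter> {- r..r}) f" by (metis integral_unique)
    qed
  qed
qed simp

text \<open>A bound of the form \<open>a s * b t\<close> makes the error of truncating the integral over \<open>t\<close> uniform
  in \<open>s\<close>, which gives both the continuity and the integrability of the inner integral.\<close>

context
  fixes u :: "real \<Rightarrow> real \<Rightarrow> 'a::banach" and a b :: "real \<Rightarrow> real" and S S' :: "real set" and A :: real
  assumes S: "closed S" "is_interval S" and S': "closed S'" "is_interval S'"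
    and cont: "continuous_on (S \<times> S') (\<lambda>(s, t). u s t)"
    and bound: "\<And>s t. s \<in> S \<Longrightarrow> t \<in> S' \<Longrightarrow> norm (u s t) \<le> a s * b t"
    and a: "a integrable_on S" "\<And>s. s \<in> S \<Longrightarrow> 0 \<le> a s" "\<And>s. s \<in> S \<Longrightarrow> a s \<le> A"
    and b: "b integrable_on S'" "\<And>t. t \<in> S' \<Longrightarrow> 0 \<le> b t"
begin

lemma section_integrable:
  assumes "s \<in> S"
  shows "u s integrable_on S'"
proof (rule dominated_integrable_on[OF S'])
  have "continuous_on S' (\<lambda>t. (s, t))" by (intro continuous_intros)
  from continuous_on_compose2[OF cont this] show "continuous_on S' (u s)" using assms by auto
  show "norm (u s t) \<le> a s * b t" if "t \<in> S'" for t using assms that by (rule bound)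
  show "(\<lambda>t. a s * b t) integrable_on S'" using b(1) by (rule integrable_on_mult_right)
qed

lemma section_integral_diff:
  assumes "s \<in> S"
  shows "norm (integral S' (u s) - integral (S' \<inter> {-r..r}) (u s))
     \<le> a s * (integral S' b - integral (S' \<inter> {-r..r}) b)"
proof -
  note u = section_integrable[OF assms]
  note ab = integrable_on_mult_right[OF b(1), of "a s"]
  have "norm (integral S' (u s) - integral (S' \<inter> {-r..r}) (u s))
     \<le> integral S' (\<lambda>t. a s * b t) - integral (S' \<inter> {-r..r}) (\<lambda>t. a s * b t)"
    by (rule norm_integral_diff_le[OF u integrable_Int_Icc[OF u] ab integrable_Int_Icc[OF ab] bound[OF assms]])
  then show ?thesis by (simp add: right_diff_distrib)
qed

lemma continuous_on_section_integral_Int: "continuous_on S (\<lambda>s. integral (S' \<inter> {-r..r}) (u s))"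
proof -
  obtain c d where cd: "S' \<inter> {-r..r} = {c..d}" by (rule closed_interval_Int_Icc[OF S'])
  have "continuous_on (S \<times> cbox c d) (\<lambda>(s, t). u s t)"
    by (rule continuous_on_subset[OF cont]) (use cd in auto)
  from integral_continuous_on_param[OF this] show ?thesis unfolding cd cbox_interval .
qed

lemma continuous_on_section_integral: "continuous_on S (\<lambda>s. integral S' (u s))"
proof (rule uniform_limit_theorem[where F = at_top])
  show "\<forall>\<^sub>F r in at_top. continuous_on S (\<lambda>s. integral (S' \<inter> {-r..r}) (u s))"
    using continuous_on_section_integral_Int by simp
  show "uniform_limit S (\<lambda>r s. integral (S' \<inter> {-r..r}) (u s)) (\<lambda>s. integral S' (u s)) at_top"
  proof (rule uniform_limitI)
    fix e :: real assume "e > 0"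
    have "((\<lambda>r. A * (integral S' b - integral (S' \<inter> {-r..r}) b)) \<longlongrightarrow> A * (integral S' b - integral S' b)) at_top"
      by (intro tendsto_intros integral_exhaust b)
    then have "\<forall>\<^sub>F r in at_top. A * (integral S' b - integral (S' \<inter> {-r..r}) b) < e"
      using \<open>e > 0\<close> by (intro order_tendstoD(2)) auto
    then show "\<forall>\<^sub>F r in at_top. \<forall>s\<in>S. dist (integral (S' \<inter> {-r..r}) (u s)) (integral S' (u s)) < e"
    proof eventually_elim
      case (elim r)
      show ?case
      proof
        fix s assume s: "s \<in> S"
        have "integral (S' \<inter> {-r..r}) b \<le> integral S' b"
          by (rule integral_subset_le) (use b in \<open>auto simp: integrable_Int_Icc\<close>)
        then have "a s * (integral S' b - integral (S' \<inter> {-r..r}) b) \<le> A * (integral S' b - integral (S' \<inter> {-r..r}) b)"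
          using a(3)[OF s] by (intro mult_right_mono) auto
        then show "dist (integral (S' \<inter> {-r..r}) (u s)) (integral S' (u s)) < e"
          using section_integral_diff[OF s, of r] elim by (simp add: dist_norm norm_minus_commute)
      qed
    qed
  qed
qed simp

lemma norm_section_integral_le: "s \<in> S \<Longrightarrow> norm (integral S' (u s)) \<le> a s * integral S' b"
  using integral_norm_bound_integral[OF section_integrable integrable_on_mult_right[OF b(1), of "a s"]] bound
  by simp

lemma section_integral_integrable: "(\<lambda>s. integral S' (u s)) integrable_on S"
  by (rule dominated_integrable_on[OF S continuous_on_section_integral norm_section_integral_le])
    (use a in \<open>auto intro: integrable_on_mult_left\<close>)

lemma iterated_integral_exhaust:
  "((\<lambda>r. integral (S \<inter> {-r..r}) (\<lambda>s. integral (S' \<inter> {-r..r}) (u s)))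
     \<longlongrightarrow> integral S (\<lambda>s. integral S' (u s))) at_top"
proof -
  let ?g = "\<lambda>s. integral S' (u s)" and ?h = "\<lambda>r s. integral (S' \<inter> {-r..r}) (u s)"
  let ?d = "\<lambda>r. integral S' b - integral (S' \<inter> {-r..r}) b"
  have le: "norm (integral (S \<inter> {-r..r}) (?h r) - integral (S \<inter> {-r..r}) ?g) \<le> integral S a * ?d r" for r
  proof -
    have d: "?d r \<ge> 0"
      using integral_subset_le[of "S' \<inter> {-r..r}" S' b] b by (auto simp: integrable_Int_Icc)
    obtain c d where cd: "S \<inter> {-r..r} = {c..d}" by (rule closed_interval_Int_Icc[OF S])
    have h: "?h r integrable_on (S \<inter> {-r..r})"
      unfolding cd
      by (rule integrable_continuous_real[OF continuous_on_subset[OF continuous_on_section_integral_Int]])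
        (use cd in blast)
    have "norm (integral (S \<inter> {-r..r}) (\<lambda>s. ?h r s - ?g s)) \<le> integral (S \<inter> {-r..r}) (\<lambda>s. a s * ?d r)"
      using section_integral_diff[of _ r]
      by (intro integral_norm_bound_integral integrable_diff h integrable_Int_Icc section_integral_integrable
          integrable_on_mult_left a) (auto simp: norm_minus_commute)
    also have "\<dots> \<le> integral S a * ?d r"
      using integral_subset_le[of "S \<inter> {-r..r}" S a] a d
      by (auto simp: integrable_Int_Icc intro!: mult_right_mono)
    finally show ?thesis
      using h by (simp add: Henstock_Kurzweil_Integration.integral_diff integrable_Int_Icc section_integral_integrable)
  qed
  have "((\<lambda>r. integral S a * ?d r) \<longlongrightarrow> integral S a * (integral S' b - integral S' b)) at_top"
    by (intro tendsto_intros integral_exhaust b)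
  then have lim: "((\<lambda>r. integral S a * ?d r) \<longlongrightarrow> 0) at_top" by simp
  have "((\<lambda>r. integral (S \<inter> {-r..r}) (?h r) - integral (S \<inter> {-r..r}) ?g) \<longlongrightarrow> 0) at_top"
    by (rule Lim_null_comparison[OF always_eventually lim]) (use le in blast)
  from tendsto_add[OF this integral_exhaust[OF section_integral_integrable]] show ?thesis by simp
qed

end

text \<open>Both iterated integrals are the limit of integrals over growing rectangles, where the order of
  integration of a continuous function does not matter.\<close>

lemma Fubini_dominated:
  fixes u :: "real \<Rightarrow> real \<Rightarrow> 'a::banach"
  assumes S: "closed S" "is_interval S" and S': "closed S'" "is_interval S'"
    and cont: "continuous_on (S \<times> S') (\<lambda>(s, t). u s t)"
    and bound: "\<And>s t. s \<in> S \<Longrightarrow> t \<in> S' \<Longrightarrow> norm (u s t) \<le> a s * b t"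
    and a: "a integrable_on S" "\<And>s. s \<in> S \<Longrightarrow> 0 \<le> a s" "\<And>s. s \<in> S \<Longrightarrow> a s \<le> A"
    and b: "b integrable_on S'" "\<And>t. t \<in> S' \<Longrightarrow> 0 \<le> b t" "\<And>t. t \<in> S' \<Longrightarrow> b t \<le> B"
  shows "integral S (\<lambda>s. integral S' (\<lambda>t. u s t)) = integral S' (\<lambda>t. integral S (\<lambda>s. u s t))"
proof (rule tendsto_unique[OF _ iterated_integral_exhaust[OF S S' cont bound a b(1,2)]])
  have cont': "continuous_on (S' \<times> S) (\<lambda>(t, s). u s t)"
  proof -
    have "continuous_on (S' \<times> S) (\<lambda>p. (snd p, fst p))" by (intro continuous_intros)
    from continuous_on_compose2[OF cont this] show ?thesis by (simp add: case_prod_unfold image_subset_iff)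
  qed
  have "integral (S \<inter> {-r..r}) (\<lambda>s. integral (S' \<inter> {-r..r}) (u s)) =
      integral (S' \<inter> {-r..r}) (\<lambda>t. integral (S \<inter> {-r..r}) (\<lambda>s. u s t))" for r
  proof -
    obtain c d where cd: "S \<inter> {-r..r} = cbox c d" by (metis closed_interval_Int_Icc[OF S] interval_cbox)
    obtain c' d' where cd': "S' \<inter> {-r..r} = cbox c' d'" by (metis closed_interval_Int_Icc[OF S'] interval_cbox)
    have "continuous_on (cbox (c, c') (d, d')) (\<lambda>(s, t). u s t)"
      by (rule continuous_on_subset[OF cont]) (use cd cd' in \<open>auto simp: cbox_Pair_eq\<close>)
    from integral_swap_continuous[OF this] show ?thesis unfolding cd cd' .
  qed
  then show "((\<lambda>r. integral (S \<inter> {-r..r}) (\<lambda>s. integral (S' \<inter> {-r..r}) (u s)))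
      \<longlongrightarrow> integral S' (\<lambda>t. integral S (\<lambda>s. u s t))) at_top"
    using iterated_integral_exhaust[OF S' S cont' _ b a(1,2)] bound by (simp add: mult.commute)
qed simp

text \<open>Since \<open>\<bar>1 - e\<^sup>-\<^sup>\<alpha>\<^sup>t\<bar> \<le> \<alpha> t\<close>, one moment of the dominating function gives a rate of order \<open>\<alpha>\<close>.\<close>

lemma abel_limit:
  fixes u :: "real \<Rightarrow> 'a::banach"
  assumes "continuous_on {0..} u" "\<And>t. t \<ge> 0 \<Longrightarrow> norm (u t) \<le> b t"
    and b: "b integrable_on {0..}" "(\<lambda>t. t * b t) integrable_on {0..}"
  shows "((\<lambda>\<alpha>. integral {0..} (\<lambda>t. exp (- \<alpha> * t) *\<^sub>R u t)) \<longlongrightarrow> integral {0..} u) (at_right 0)"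
proof -
  let ?C = "integral {0..} (\<lambda>t. t * b t)"
  have S: "closed {0::real..}" "is_interval {0::real..}" by auto
  have u: "u integrable_on {0..}"
    by (rule dominated_integrable_on[OF S assms(1) assms(2) b(1)]) auto
  have "norm (integral {0..} (\<lambda>t. exp (- \<alpha> * t) *\<^sub>R u t) - integral {0..} u) \<le> \<alpha> * ?C" if "\<alpha> > 0" for \<alpha>
  proof -
    have eu: "(\<lambda>t. exp (- \<alpha> * t) *\<^sub>R u t) integrable_on {0..}"
    proof (rule dominated_integrable_on[OF S _ _ b(1)])
      show "continuous_on {0..} (\<lambda>t. exp (- \<alpha> * t) *\<^sub>R u t)"
        by (intro continuous_intros assms(1))
      fix t :: real assume "t \<in> {0..}"
      then show "norm (exp (- \<alpha> * t) *\<^sub>R u t) \<le> b t"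
        using assms(2)[of t] that order_trans[OF mult_right_mono[of "exp (- \<alpha> * t)" 1 "norm (u t)"]] by simp
    qed
    have "norm (integral {0..} (\<lambda>t. exp (- \<alpha> * t) *\<^sub>R u t - u t)) \<le> integral {0..} (\<lambda>t. \<alpha> * (t * b t))"
    proof (rule integral_norm_bound_integral[OF integrable_diff[OF eu u] integrable_on_mult_right[OF b(2)]])
      fix t :: real assume t: "t \<in> {0..}"
      have "norm (exp (- \<alpha> * t) *\<^sub>R u t - u t) = (1 - exp (- \<alpha> * t)) * norm (u t)"
      proof -
        have "exp (- \<alpha> * t) *\<^sub>R u t - u t = (exp (- \<alpha> * t) - 1) *\<^sub>R u t"
          by (simp add: scaleR_left_diff_distrib)
        then show ?thesis using t that by simp
      qed
      also have "\<dots> \<le> (\<alpha> * t) * b t"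
        using exp_ge_add_one_self[of "- \<alpha> * t"] t that assms(2)[of t] by (intro mult_mono) auto
      finally show "norm (exp (- \<alpha> * t) *\<^sub>R u t - u t) \<le> \<alpha> * (t * b t)" by simp
    qed
    then show ?thesis
      using Henstock_Kurzweil_Integration.integral_diff[OF eu u] by simp
  qed
  then have ev: "\<forall>\<^sub>F \<alpha> in at_right 0.
      norm (integral {0..} (\<lambda>t. exp (- \<alpha> * t) *\<^sub>R u t) - integral {0..} u) \<le> \<alpha> * ?C"
    by (rule eventually_at_rightI[of _ 1]) auto
  have "((\<lambda>\<alpha>. \<alpha> * ?C) \<longlongrightarrow> 0 * ?C) (at_right 0)" by (intro tendsto_intros)
  then have lim: "((\<lambda>\<alpha>. \<alpha> * ?C) \<longlongrightarrow> 0) (at_right 0)" by simp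
  have "((\<lambda>\<alpha>. integral {0..} (\<lambda>t. exp (- \<alpha> * t) *\<^sub>R u t) - integral {0..} u) \<longlongrightarrow> 0) (at_right 0)"
    by (rule Lim_null_comparison[OF ev lim])
  then show ?thesis by (subst Lim_null)
qed

section \<open>Fourier transforms of test functions\<close>

lemma integrable_cauchy_kernel: "integrable lborel (\<lambda>x::real. 1 / (1 + x^2))"
  and integral_cauchy_kernel: "(\<integral>x. 1 / (1 + (x::real)^2) \<partial>lborel) = pi"
  using integrable_inverse_1_plus_square LBINT_inverse_1_plus_square
  by (simp_all add: set_integrable_def interval_lebesgue_integral_def set_lebesgue_integral_def inverse_eq_divide)

lemma norm_integrable_on:
  fixes f :: "real \<Rightarrow> 'b::euclidean_space"
  assumes "integrable lborel f" "S \<in> sets borel"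
  shows "(\<lambda>t. norm (f t)) integrable_on S"
    "integral S (\<lambda>t. norm (f t)) \<le> (\<integral>t. norm (f t) \<partial>lborel)"
proof -
  have U: "(\<lambda>t. norm (f t)) integrable_on UNIV"
    using integrable_norm[OF assms(1)] by (rule integrable_on_lborel)
  then have "(\<lambda>t. norm (f t)) absolutely_integrable_on UNIV"
    by (rule nonnegative_absolutely_integrable_1) auto
  then have "(\<lambda>t. norm (f t)) absolutely_integrable_on S"
    by (rule set_integrable_subset) (use assms(2) in auto)
  then show S: "(\<lambda>t. norm (f t)) integrable_on S" by (rule set_lebesgue_integral_eq_integral(1))
  show "integral S (\<lambda>t. norm (f t)) \<le> (\<integral>t. norm (f t) \<partial>lborel)"
    unfolding integral_lborel[OF integrable_norm[OF assms(1)], symmetric]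
    by (rule integral_subset_le[OF _ S U]) auto
qed

lemma cauchy_kernel_shift:
  fixes S :: "real set"
  assumes "closed S"
  shows "(\<lambda>t. 1 / (1 + (t - s)^2)) integrable_on S" "integral S (\<lambda>t. 1 / (1 + (t - s)^2)) \<le> pi"
proof -
  have "integrable lborel (\<lambda>t. 1 / (1 + (t - s)^2))" "(\<integral>t. 1 / (1 + (t - s)^2) \<partial>lborel) = pi"
    using lborel_integrable_real_affine[OF integrable_cauchy_kernel, of 1 "- s"]
      lborel_integral_real_affine[of 1 "\<lambda>t. 1 / (1 + t^2)" "- s"] integral_cauchy_kernel by simp_all
  then show "(\<lambda>t. 1 / (1 + (t - s)^2)) integrable_on S" "integral S (\<lambda>t. 1 / (1 + (t - s)^2)) \<le> pi"
    using norm_integrable_on[of "\<lambda>t. 1 / (1 + (t - s)^2)" S] assms by simp_all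
qed

lemma cauchy_kernel_integrable_on: "closed S \<Longrightarrow> (\<lambda>x::real. 1 / (1 + x^2)) integrable_on S"
  using cauchy_kernel_shift(1)[of S 0] by simp

lemma power_le_cauchy_kernel:
  fixes t :: real
  shows "1 / (1 + t^2)^2 \<le> 1 / (1 + t^2)" "\<bar>t\<bar> * (1 / (1 + t^2)^2) \<le> 1 / (1 + t^2)"
proof -
  have p: "1 + t^2 \<ge> 1" "\<bar>t\<bar> \<le> 1 + t^2"
    using sum_squares_bound[of "\<bar>t\<bar>" 1] by auto
  then show "1 / (1 + t^2)^2 \<le> 1 / (1 + t^2)" "\<bar>t\<bar> * (1 / (1 + t^2)^2) \<le> 1 / (1 + t^2)"
    by (auto simp: divide_simps power2_eq_square mult_right_mono add_pos_nonneg)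
qed

lemma test_function_integrable:
  assumes "\<phi> \<in> test_functions UNIV"
  shows "integrable lborel \<phi>"
proof -
  obtain R where R: "R > 0" "\<And>t. \<bar>t\<bar> \<ge> R \<Longrightarrow> \<phi> t = 0" using test_function_bound[OF assms] by blast
  have "integrable lborel (\<lambda>t. indicator {-R..R} t *\<^sub>R \<phi> t)"
    using smooth_fun_continuous_on[OF test_function_smooth[OF assms], of _ 0]
    by (intro borel_integrable_compact) auto
  also have "(\<lambda>t. indicator {-R..R} t *\<^sub>R \<phi> t) = \<phi>"
    using R(2) by (auto simp: fun_eq_iff indicator_def)
  finally show ?thesis .
qed

lemma test_function_continuous_on: "\<phi> \<in> test_functions I \<Longrightarrow> continuous_on S \<phi>"
  using smooth_fun_continuous_on[of \<phi> S 0] test_function_smooth by simp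

lemma test_function_norm_bound:
  assumes "\<phi> \<in> test_functions I"
  obtains B where "B \<ge> 0" "\<And>t. cmod (\<phi> t) \<le> B"
proof -
  obtain R where R: "R > 0" "\<And>t. \<bar>t\<bar> \<ge> R \<Longrightarrow> \<phi> t = 0" using test_function_bound[OF assms] by blast
  have "compact (\<phi> ` {-R..R})"
    by (intro compact_continuous_image test_function_continuous_on[OF assms]) auto
  then obtain B where B: "\<forall>z\<in>\<phi> ` {-R..R}. cmod z \<le> B" by (meson compact_imp_bounded bounded_iff)
  have "cmod (\<phi> t) \<le> max B 0" for t
  proof (cases "\<bar>t\<bar> \<ge> R")
    case False
    then have "t \<in> {-R..R}" by auto
    then have "cmod (\<phi> t) \<le> B" using B by blast
    then show ?thesis by simp
  qed (use R(2) in auto)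
  then show ?thesis by (rule that[rotated]) simp
qed

lemma test_function_fourier_kernel:
  assumes "\<phi> \<in> test_functions I"
  shows "(\<lambda>t. exp (- \<i> * of_real \<xi> * of_real t) * \<phi> t) \<in> test_functions I"
  using test_function_mult(1)[OF assms smooth_fun_exp[of "-\<xi>"]] by simp

lemma fourier_kernel_integrable_on:
  "\<phi> \<in> test_functions UNIV \<Longrightarrow> (\<lambda>t. exp (- \<i> * of_real \<xi> * of_real t) * \<phi> t) integrable_on UNIV"
  by (intro integrable_on_lborel test_function_integrable test_function_fourier_kernel)

lemma fourier_eq_lborel:
  assumes "\<phi> \<in> test_functions UNIV"
  shows "fourier \<phi> \<xi> = (\<integral>t. exp (- \<i> * of_real \<xi> * of_real t) * \<phi> t \<partial>lborel)"
  unfolding fourier_def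
  by (rule integral_lborel[OF test_function_integrable[OF test_function_fourier_kernel[OF assms]]])

lemma fourier_add:
  assumes "\<phi> \<in> test_functions UNIV" "\<psi> \<in> test_functions UNIV"
  shows "fourier (\<lambda>t. \<phi> t + \<psi> t) \<xi> = fourier \<phi> \<xi> + fourier \<psi> \<xi>"
  unfolding fourier_eq_lborel[OF assms(1)] fourier_eq_lborel[OF assms(2)]
    fourier_eq_lborel[OF test_function_add[OF assms]]
  using test_function_integrable[OF test_function_fourier_kernel[OF assms(1)], of \<xi>]
    test_function_integrable[OF test_function_fourier_kernel[OF assms(2)], of \<xi>]
  by (simp add: distrib_left)

lemma fourier_cmult: "fourier (\<lambda>t. c * \<phi> t) \<xi> = c * fourier \<phi> \<xi>"
proof -
  have "exp (- \<i> * of_real \<xi> * of_real t) * (c * \<phi> t) = c * (exp (- \<i> * of_real \<xi> * of_real t) * \<phi> t)" for t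
    by simp
  then show ?thesis unfolding fourier_def by (simp only: integral_mult_right)
qed

lemma fourier_diff:
  assumes "\<phi> \<in> test_functions UNIV" "\<psi> \<in> test_functions UNIV"
  shows "fourier (\<lambda>t. \<phi> t - \<psi> t) \<xi> = fourier \<phi> \<xi> - fourier \<psi> \<xi>"
  using fourier_add[OF assms(1) test_function_cmult[OF assms(2), of "-1"], of \<xi>] fourier_cmult[of "-1" \<psi> \<xi>]
  by simp

lemma fourier_modulation:
  "fourier (\<lambda>\<xi>. exp (\<i> * of_real s * of_real \<xi>) * \<phi> \<xi>) t = fourier \<phi> (t - s)"
  unfolding fourier_def
  by (rule arg_cong[of _ _ "integral UNIV"]) (auto simp: fun_eq_iff algebra_simps simp flip: exp_add)

lemma fourier_affine:
  assumes "\<phi> \<in> test_functions UNIV" "a > 0"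
  shows "fourier (\<lambda>\<xi>. \<phi> ((\<xi> - b) / a)) t = of_real a * exp (- \<i> * of_real t * of_real b) * fourier \<phi> (a * t)"
proof -
  have \<psi>: "(\<lambda>\<xi>. \<phi> ((\<xi> - b) / a)) \<in> test_functions UNIV"
    using test_function_affine[OF assms(1), of "1/a" "-b/a"] assms(2) by (simp add: diff_divide_distrib)
  have "fourier (\<lambda>\<xi>. \<phi> ((\<xi> - b) / a)) t = (\<integral>\<xi>. exp (- \<i> * of_real t * of_real \<xi>) * \<phi> ((\<xi> - b) / a) \<partial>lborel)"
    by (rule fourier_eq_lborel[OF \<psi>])
  also have "\<dots> = \<bar>a\<bar> *\<^sub>R (\<integral>x. exp (- \<i> * of_real t * of_real (b + a * x)) * \<phi> ((b + a * x - b) / a) \<partial>lborel)"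
    by (rule lborel_integral_real_affine) (use assms(2) in simp)
  also have "(\<lambda>x. exp (- \<i> * of_real t * of_real (b + a * x)) * \<phi> ((b + a * x - b) / a))
      = (\<lambda>x. exp (- \<i> * of_real t * of_real b) * (exp (- \<i> * of_real (a * t) * of_real x) * \<phi> x))"
    using assms(2) by (auto simp: fun_eq_iff algebra_simps simp flip: exp_add)
  finally show ?thesis
    using assms(2) by (simp add: fourier_eq_lborel[OF assms(1)] scaleR_conv_of_real)
qed

lemma integral_deriv_test_function:
  assumes "\<phi> \<in> test_functions UNIV" "\<And>t. (\<phi> has_vector_derivative \<phi>' t) (at t)"
  shows "integral UNIV \<phi>' = 0"
proof -
  obtain R where R: "R > 0" "\<And>t. \<bar>t\<bar> \<ge> R \<Longrightarrow> \<phi> t = 0" using test_function_bound[OF assms(1)] by blast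
  have "\<phi>' = iterated_deriv 1 \<phi>"
    using assms(2) by (auto simp: iterated_deriv_Suc fun_eq_iff intro!: vector_derivative_at[symmetric])
  then have "\<phi>' t = 0" if "\<bar>t\<bar> \<ge> R + 1" for t
  proof -
    have "fun_support \<phi> \<subseteq> {-R..R}"
      unfolding fun_support_def
      by (rule closure_minimal) (use R(2) in \<open>force simp: abs_le_iff not_le\<close>)+
    then have "t \<notin> fun_support \<phi>" using that R(1) by (meson abs_le_iff atLeastAtMost_iff
        less_add_one minus_le_iff not_le order_less_le_trans subsetD)
    then show ?thesis
      using iterated_deriv_eq_0[of t \<phi> 1] test_function_smooth[OF assms(1)] \<open>\<phi>' = _\<close> by simp
  qed
  then have z: "\<phi>' t = 0" if "t \<notin> {-(R+1)..R+1}" for t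
    using that by (auto simp: abs_if)
  have "(\<phi>' has_integral \<phi> (R + 1) - \<phi> (- (R + 1))) {-(R+1)..R+1}"
    using R(1) by (intro fundamental_theorem_of_calculus has_vector_derivative_at_within[OF assms(2)]) auto
  then have "(\<phi>' has_integral 0) {-(R+1)..R+1}" using R by simp
  then have "(\<phi>' has_integral 0) UNIV"
    by (rule has_integral_on_superset) (use z in auto)
  then show ?thesis by (rule integral_unique)
qed

lemma fourier_deriv:
  assumes "\<phi> \<in> test_functions UNIV"
  shows "fourier (iterated_deriv 1 \<phi>) \<xi> = \<i> * of_real \<xi> * fourier \<phi> \<xi>"
proof -
  let ?e = "\<lambda>t. exp (- \<i> * of_real \<xi> * of_real t)"
  have "((\<lambda>t. ?e t * \<phi> t) has_vector_derivative
      ?e t * iterated_deriv 1 \<phi> t - \<i> * of_real \<xi> * (?e t * \<phi> t)) (at t)" for t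
    using smooth_fun_has_derivative[OF test_function_smooth[OF assms], of 0 t UNIV]
    by (auto intro!: derivative_eq_intros has_vector_derivative_mult has_vector_derivative_real_field
        simp: algebra_simps)
  from integral_deriv_test_function[OF test_function_fourier_kernel[OF assms] this]
  have "integral UNIV (\<lambda>t. ?e t * iterated_deriv 1 \<phi> t - \<i> * of_real \<xi> * (?e t * \<phi> t)) = 0" .
  moreover have "(\<lambda>t. ?e t * \<phi> t) integrable_on UNIV" "(\<lambda>t. ?e t * iterated_deriv 1 \<phi> t) integrable_on UNIV"
    by (intro fourier_kernel_integrable_on assms test_function_iterated_deriv)+
  ultimately show ?thesis
    by (simp add: fourier_def Henstock_Kurzweil_Integration.integral_diff integrable_on_mult_right)
qed

lemma norm_fourier_le:
  assumes "\<phi> \<in> test_functions UNIV"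
  shows "cmod (fourier \<phi> \<xi>) \<le> (\<integral>t. cmod (\<phi> t) \<partial>lborel)"
  unfolding fourier_eq_lborel[OF assms]
  using integral_norm_bound[of lborel "\<lambda>t. exp (- \<i> * of_real \<xi> * of_real t) * \<phi> t"]
  by (simp add: norm_mult norm_exp_eq_Re)

text \<open>Each application of \<open>1 - D\<^sup>2\<close> to the test function multiplies the transform by \<open>1 + \<xi>\<^sup>2\<close>. One
  application already makes the transform integrable; a second one leaves room for Peetre's inequality
  and for first moments.\<close>

lemma fourier_one_plus_square:
  assumes "\<phi> \<in> test_functions UNIV"
  shows "(1 + (of_real \<xi>)^2) * fourier \<phi> \<xi> = fourier (\<lambda>t. \<phi> t - iterated_deriv 2 \<phi> t) \<xi>"
proof -
  have "iterated_deriv 1 (iterated_deriv 1 \<phi>) = iterated_deriv 2 \<phi>"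
    by (simp add: iterated_deriv_add numeral_2_eq_2)
  then have "fourier (iterated_deriv 2 \<phi>) \<xi> = - ((of_real \<xi>)^2) * fourier \<phi> \<xi>"
    using fourier_deriv[OF test_function_iterated_deriv[OF assms, of 1]] fourier_deriv[OF assms]
    by (simp add: power2_eq_square mult.left_commute[of "complex_of_real \<xi>" \<i>] mult.assoc)
  then show ?thesis
    by (simp add: fourier_diff[OF assms test_function_iterated_deriv[OF assms]] algebra_simps)
qed

lemma norm_fourier_le_cauchy_kernel:
  assumes "\<phi> \<in> test_functions UNIV"
  shows "cmod (fourier \<phi> \<xi>) \<le> (\<integral>t. cmod (\<phi> t - iterated_deriv 2 \<phi> t) \<partial>lborel) * (1 / (1 + \<xi>^2))"
proof -
  have "cmod (1 + (of_real \<xi>)^2) = 1 + \<xi>^2"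
    using norm_of_real[where 'a = complex, of "1 + \<xi>^2"] by (simp del: norm_of_real)
  then have "(1 + \<xi>^2) * cmod (fourier \<phi> \<xi>) \<le> (\<integral>t. cmod (\<phi> t - iterated_deriv 2 \<phi> t) \<partial>lborel)"
    using norm_fourier_le[OF test_function_diff[OF assms test_function_iterated_deriv[OF assms, of 2]], of \<xi>]
    by (simp flip: fourier_one_plus_square[OF assms] add: norm_mult)
  then show ?thesis by (simp add: field_simps add_pos_nonneg)
qed

lemma fourier_decay:
  assumes "\<phi> \<in> test_functions UNIV"
  obtains C where "C \<ge> 0" "\<And>t. cmod (fourier \<phi> t) \<le> C * (1 / (1 + t^2)^2)"
proof -
  let ?\<psi> = "\<lambda>t. \<phi> t - iterated_deriv 2 \<phi> t"
  define C where "C = (\<integral>t. cmod (?\<psi> t - iterated_deriv 2 ?\<psi> t) \<partial>lborel)"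
  have \<psi>: "?\<psi> \<in> test_functions UNIV"
    by (intro test_function_diff assms test_function_iterated_deriv)
  have "cmod (fourier \<phi> t) \<le> C * (1 / (1 + t^2)^2)" for t
  proof -
    have "cmod (1 + (of_real t)^2) = 1 + t^2"
      using norm_of_real[where 'a = complex, of "1 + t^2"] by (simp del: norm_of_real)
    then have "(1 + t^2) * cmod (fourier \<phi> t) \<le> C * (1 / (1 + t^2))"
      using norm_fourier_le_cauchy_kernel[OF \<psi>, of t] unfolding C_def
      by (simp flip: fourier_one_plus_square[OF assms] add: norm_mult)
    moreover have "0 < 1 + t^2" by (simp add: add_pos_nonneg)
    ultimately have "cmod (fourier \<phi> t) \<le> C * (1 / (1 + t^2)) / (1 + t^2)"
      by (simp only: pos_le_divide_eq mult.commute)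
    then show ?thesis by (simp add: power2_eq_square[of "1 + t^2"])
  qed
  then show ?thesis by (rule that[rotated]) (simp add: C_def)
qed

lemma fourier_has_derivative:
  assumes "\<phi> \<in> test_functions UNIV"
  shows "(fourier \<phi> has_vector_derivative fourier (\<lambda>t. - \<i> * (of_real t * \<phi> t)) \<xi>) (at \<xi>)"
proof -
  obtain R where R: "R > 0" "\<And>t. \<bar>t\<bar> \<ge> R \<Longrightarrow> \<phi> t = 0" using test_function_bound[OF assms] by blast
  have *: "fourier \<psi> \<xi> = integral (cbox (-R) R) (\<lambda>t. exp (- \<i> * of_real \<xi> * of_real t) * \<psi> t)"
    if "\<And>t. \<bar>t\<bar> \<ge> R \<Longrightarrow> \<psi> t = 0" for \<psi> \<xi>
  proof -
    have eq: "(\<lambda>t. exp (- \<i> * of_real \<xi> * of_real t) * \<psi> t) =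
        (\<lambda>t. if t \<in> cbox (-R) R then exp (- \<i> * of_real \<xi> * of_real t) * \<psi> t else 0)"
      using that by (auto simp: fun_eq_iff)
    show ?thesis unfolding fourier_def by (subst eq) (simp only: integral_restrict_UNIV)
  qed
  have c: "continuous_on S \<phi>" for S by (rule test_function_continuous_on[OF assms])
  have "((\<lambda>\<xi>. integral (cbox (-R) R) (\<lambda>t. exp (- \<i> * of_real \<xi> * of_real t) * \<phi> t)) has_vector_derivative
      integral (cbox (-R) R) (\<lambda>t. exp (- \<i> * of_real \<xi> * of_real t) * (- \<i> * (of_real t * \<phi> t)))) (at \<xi> within UNIV)"
  proof (rule leibniz_rule_vector_derivative)
    show "((\<lambda>\<xi>. exp (- \<i> * of_real \<xi> * of_real t) * \<phi> t) has_vector_derivative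
        exp (- \<i> * of_real \<xi> * of_real t) * (- \<i> * (of_real t * \<phi> t))) (at \<xi> within UNIV)" for \<xi> t
      by (rule has_vector_derivative_real_field) (auto intro!: derivative_eq_intros)
    show "(\<lambda>t. exp (- \<i> * of_real \<xi> * of_real t) * \<phi> t) integrable_on cbox (-R) R" for \<xi>
      by (intro integrable_continuous continuous_intros c)
    show "continuous_on (UNIV \<times> cbox (-R) R)
        (\<lambda>(\<xi>, t). exp (- \<i> * of_real \<xi> * of_real t) * (- \<i> * (of_real t * \<phi> t)))"
      unfolding case_prod_unfold
      by (intro continuous_intros continuous_on_compose2[OF c[of UNIV]]) auto
  qed auto
  moreover have "fourier \<phi> = (\<lambda>\<xi>. integral (cbox (-R) R) (\<lambda>t. exp (- \<i> * of_real \<xi> * of_real t) * \<phi> t))"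
    by (rule ext, rule *) (rule R(2))
  ultimately show ?thesis using *[of "\<lambda>t. - \<i> * (of_real t * \<phi> t)" \<xi>] R(2) by simp
qed

lemma continuous_on_fourier: "\<phi> \<in> test_functions UNIV \<Longrightarrow> continuous_on S (fourier \<phi>)"
  using fourier_has_derivative has_vector_derivative_at_within
  by (blast intro: continuous_on_vector_derivative)

lemma continuous_on_fourier_compose:
  "\<phi> \<in> test_functions UNIV \<Longrightarrow> continuous_on S f \<Longrightarrow> continuous_on S (\<lambda>x. fourier \<phi> (f x))"
  by (rule continuous_on_compose2[OF continuous_on_fourier[of \<phi> UNIV]]) auto

lemma fourier_integrable:
  assumes "\<phi> \<in> test_functions UNIV"
  shows "integrable lborel (fourier \<phi>)" "integrable lborel (\<lambda>t. \<bar>t\<bar> * cmod (fourier \<phi> t))"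
proof -
  obtain C where C: "C \<ge> 0" "\<And>t. cmod (fourier \<phi> t) \<le> C * (1 / (1 + t^2)^2)" using fourier_decay[OF assms] by metis
  have [measurable]: "fourier \<phi> \<in> borel_measurable borel"
    by (rule borel_measurable_continuous_onI[OF continuous_on_fourier[OF assms]])
  have k: "integrable lborel (\<lambda>t. C * (1 / (1 + t^2)))"
    by (rule integrable_mult_right[OF integrable_cauchy_kernel])
  show "integrable lborel (fourier \<phi>)"
  proof (rule Bochner_Integration.integrable_bound[OF k])
    have "cmod (fourier \<phi> t) \<le> C * (1 / (1 + t^2))" for t
      using mult_left_mono[OF power_le_cauchy_kernel(1)[of t] C(1)] C(2)[of t] by linarith
    then show "AE t in lborel. norm (fourier \<phi> t) \<le> norm (C * (1 / (1 + t^2)))"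
      using C(1) by (intro AE_I2) simp
  qed measurable
  show "integrable lborel (\<lambda>t. \<bar>t\<bar> * cmod (fourier \<phi> t))"
  proof (rule Bochner_Integration.integrable_bound[OF k])
    have "\<bar>t\<bar> * cmod (fourier \<phi> t) \<le> C * (1 / (1 + t^2))" for t
    proof -
      have "\<bar>t\<bar> * cmod (fourier \<phi> t) \<le> C * (\<bar>t\<bar> * (1 / (1 + t^2)^2))"
        using mult_left_mono[OF C(2)[of t], of "\<bar>t\<bar>"] by (simp add: mult_ac)
      with mult_left_mono[OF power_le_cauchy_kernel(2)[of t] C(1)] show ?thesis by linarith
    qed
    then show "AE t in lborel. norm (\<bar>t\<bar> * cmod (fourier \<phi> t)) \<le> norm (C * (1 / (1 + t^2)))"
      using C(1) by (intro AE_I2) simp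
  qed measurable
qed

subsection \<open>Inversion\<close>

lemma fourier_std_normal_density:
  "(\<integral>s. exp (- \<i> * of_real \<xi> * of_real s) * of_real (std_normal_density s) \<partial>lborel) = of_real (exp (- (\<xi>^2) / 2))"
proof -
  have "char std_normal_distribution (- \<xi>) = of_real (exp (- (\<xi>^2) / 2))"
    by (simp add: char_std_normal_distribution)
  moreover have "char std_normal_distribution (- \<xi>) = (\<integral>s. std_normal_density s *\<^sub>R exp (\<i> * of_real (- \<xi> * s)) \<partial>lborel)"
    unfolding char_def by (rule integral_density) auto
  ultimately show ?thesis by (simp add: scaleR_conv_of_real mult.commute mult.left_commute)
qed

lemma std_normal_density_le: "std_normal_density x \<le> std_normal_density 0"
  by (simp add: std_normal_density_def divide_right_mono)

lemma continuous_on_std_normal_density: "continuous_on S std_normal_density"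
  unfolding normal_density_def by (intro continuous_intros) auto

text \<open>Gaussian summation: inserting a wide Gaussian into the integral of the transform amounts to
  integrating \<open>\<phi>\<close> against a narrow one, because the Gaussian is its own transform.\<close>

lemma integral_gaussian_fourier:
  assumes "\<phi> \<in> test_functions UNIV" "d > 0"
  shows "(\<integral>s. of_real (std_normal_density (d * s)) * fourier \<phi> s \<partial>lborel)
    = of_real (sqrt (2 * pi)) * (\<integral>x. of_real (std_normal_density x) * \<phi> (d * x) \<partial>lborel)"
proof -
  let ?n = "\<lambda>s. std_normal_density (d * s)"
  let ?u = "\<lambda>s \<xi>. (exp (- \<i> * of_real \<xi> * of_real s) * of_real (?n s)) * \<phi> \<xi>"
  have n: "integrable lborel ?n"
    using lborel_integrable_real_affine[OF integrable_std_normal_moment[of 0], of d 0] assms(2) by simp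
  let ?r = "\<lambda>\<xi>. of_real (1 / d * (sqrt (2 * pi) * std_normal_density (\<xi> / d))) * \<phi> \<xi>"
  obtain B where B: "\<And>t. cmod (\<phi> t) \<le> B" using test_function_norm_bound[OF assms(1)] by metis
  have g: "integral UNIV (\<lambda>s. exp (- \<i> * of_real \<xi> * of_real s) * of_real (?n s))
      = of_real (1 / d * (sqrt (2 * pi) * std_normal_density (\<xi> / d)))" for \<xi>
  proof -
    let ?h = "\<lambda>s. exp (- \<i> * of_real (\<xi> / d) * of_real s) * complex_of_real (std_normal_density s)"
    have "integrable lborel (\<lambda>s. complex_of_real (?n s))" using n by (simp only: integrable_of_real)
    then have "integrable lborel (\<lambda>s. exp (- \<i> * of_real \<xi> * of_real s) * of_real (?n s))"
      by (rule Bochner_Integration.integrable_bound) (auto simp: norm_mult norm_exp_eq_Re)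
    then have "integral UNIV (\<lambda>s. exp (- \<i> * of_real \<xi> * of_real s) * of_real (?n s))
        = (\<integral>s. exp (- \<i> * of_real \<xi> * of_real s) * of_real (?n s) \<partial>lborel)"
      by (rule integral_lborel)
    also have "\<dots> = (\<integral>s. ?h (0 + d * s) \<partial>lborel)"
      using assms(2) by (intro Bochner_Integration.integral_cong) (simp_all add: mult.assoc)
    also have "\<dots> = of_real (1 / d) * (\<integral>s. ?h s \<partial>lborel)"
      using lborel_integral_real_affine[of d ?h 0] assms(2) by (simp add: scaleR_conv_of_real)
    also have "(\<integral>s. ?h s \<partial>lborel) = of_real (sqrt (2 * pi) * std_normal_density (\<xi> / d))"
      unfolding fourier_std_normal_density by (simp add: std_normal_density_def)
    finally show ?thesis by (simp only: of_real_mult)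
  qed
  have "integral UNIV (\<lambda>s. integral UNIV (\<lambda>\<xi>. ?u s \<xi>)) = integral UNIV (\<lambda>\<xi>. integral UNIV (\<lambda>s. ?u s \<xi>))"
  proof (rule Fubini_dominated[where a = ?n and A = "std_normal_density 0" and b = "\<lambda>\<xi>. cmod (\<phi> \<xi>)" and B = B])
    show "continuous_on (UNIV \<times> UNIV) (\<lambda>(s, \<xi>). ?u s \<xi>)"
      unfolding case_prod_unfold
      by (intro continuous_intros continuous_on_compose2[OF continuous_on_std_normal_density[of UNIV]]
          continuous_on_compose2[OF test_function_continuous_on[OF assms(1), of UNIV]]) auto
    show "(\<lambda>\<xi>. cmod (\<phi> \<xi>)) integrable_on UNIV"
      by (rule norm_integrable_on(1)[OF test_function_integrable[OF assms(1)]]) simp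
  qed (use B std_normal_density_le integrable_on_lborel[OF n] in \<open>auto simp: norm_mult norm_exp_eq_Re\<close>)
  moreover have "integral UNIV (\<lambda>\<xi>. ?u s \<xi>) = of_real (?n s) * fourier \<phi> s" for s
    by (simp add: fourier_def mult_ac flip: integral_mult_right)
  moreover have "integral UNIV (\<lambda>s. ?u s \<xi>) = ?r \<xi>" for \<xi>
    by (simp only: integral_mult_left g)
  ultimately have eq: "integral UNIV (\<lambda>s. of_real (?n s) * fourier \<phi> s) = integral UNIV ?r" by simp
  have [measurable]: "\<phi> \<in> borel_measurable borel" "fourier \<phi> \<in> borel_measurable borel"
    by (intro borel_measurable_continuous_onI test_function_continuous_on[OF assms(1)] continuous_on_fourier[OF assms(1)])+
  have "integrable lborel (\<lambda>s. of_real (std_normal_density 0) * fourier \<phi> s)"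
    by (intro integrable_mult_right fourier_integrable assms)
  then have l: "integrable lborel (\<lambda>s. of_real (?n s) * fourier \<phi> s)"
    by (rule Bochner_Integration.integrable_bound)
      (auto intro!: AE_I2 mult_right_mono std_normal_density_le simp: norm_mult)
  have "integrable lborel (\<lambda>\<xi>. of_real (1 / d * (sqrt (2 * pi) * std_normal_density 0)) * \<phi> \<xi>)"
    by (intro integrable_mult_right test_function_integrable assms)
  then have r: "integrable lborel ?r"
  proof (rule Bochner_Integration.integrable_bound)
    show "AE \<xi> in lborel. norm (?r \<xi>) \<le> norm (of_real (1 / d * (sqrt (2 * pi) * std_normal_density 0)) * \<phi> \<xi>)"
      unfolding norm_mult norm_of_real using assms(2)
      by (intro AE_I2 mult_right_mono) (auto simp: abs_mult intro!: divide_right_mono mult_left_mono std_normal_density_le)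
  qed measurable
  have "(\<integral>\<xi>. ?r \<xi> \<partial>lborel) = \<bar>d\<bar> *\<^sub>R (\<integral>x. ?r (0 + d * x) \<partial>lborel)"
    by (rule lborel_integral_real_affine) (use assms(2) in simp)
  also have "\<dots> = (\<integral>x. of_real (sqrt (2 * pi)) * (of_real (std_normal_density x) * \<phi> (d * x)) \<partial>lborel)"
    using assms(2) by (simp only: integral_scaleR_right[symmetric]) (simp add: scaleR_conv_of_real mult_ac)
  finally show ?thesis
    using eq unfolding integral_lborel[OF l] integral_lborel[OF r] by simp
qed

lemma integral_fourier:
  assumes "\<phi> \<in> test_functions UNIV"
  shows "integral UNIV (fourier \<phi>) = 2 * of_real pi * \<phi> 0"
proof -
  let ?\<delta> = "\<lambda>n. 1 / real (Suc n)"
  have c: "isCont \<phi> 0" "isCont std_normal_density 0"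
    using test_function_continuous_on[OF assms, of UNIV] continuous_on_std_normal_density[of UNIV]
    by (simp_all add: continuous_on_eq_continuous_at)
  have \<delta>: "(\<lambda>n. ?\<delta> n * w) \<longlonglongrightarrow> 0" for w
    using tendsto_mult[OF LIMSEQ_inverse_real_of_nat tendsto_const[of w]] by (simp add: inverse_eq_divide)
  have [measurable]: "\<phi> \<in> borel_measurable borel" "fourier \<phi> \<in> borel_measurable borel"
    by (intro borel_measurable_continuous_onI test_function_continuous_on[OF assms] continuous_on_fourier[OF assms])+
  obtain B where B: "\<And>t. cmod (\<phi> t) \<le> B" using test_function_norm_bound[OF assms] by metis
  have lim1: "(\<lambda>n. \<integral>s. of_real (std_normal_density (?\<delta> n * s)) * fourier \<phi> s \<partial>lborel)
      \<longlonglongrightarrow> (\<integral>s. of_real (std_normal_density 0) * fourier \<phi> s \<partial>lborel)"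
  proof (rule integral_dominated_convergence[where w = "\<lambda>s. std_normal_density 0 * cmod (fourier \<phi> s)"])
    show "integrable lborel (\<lambda>s. std_normal_density 0 * cmod (fourier \<phi> s))"
      by (intro integrable_mult_right integrable_norm fourier_integrable assms)
    show "AE s in lborel. (\<lambda>n. of_real (std_normal_density (?\<delta> n * s)) * fourier \<phi> s)
        \<longlonglongrightarrow> of_real (std_normal_density 0) * fourier \<phi> s"
      by (intro AE_I2 tendsto_intros isCont_tendsto_compose[OF c(2) \<delta>])
    show "AE s in lborel. norm (of_real (std_normal_density (?\<delta> n * s)) * fourier \<phi> s)
        \<le> std_normal_density 0 * cmod (fourier \<phi> s)" for n
      by (intro AE_I2) (simp add: norm_mult mult_right_mono std_normal_density_le)
  qed measurable
  have lim2: "(\<lambda>n. \<integral>x. of_real (std_normal_density x) * \<phi> (?\<delta> n * x) \<partial>lborel)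
      \<longlonglongrightarrow> (\<integral>x. of_real (std_normal_density x) * \<phi> 0 \<partial>lborel)"
  proof (rule integral_dominated_convergence[where w = "\<lambda>x. std_normal_density x * B"])
    show "integrable lborel (\<lambda>x. std_normal_density x * B)"
      using integrable_std_normal_moment[of 0] by simp
    show "AE x in lborel. (\<lambda>n. of_real (std_normal_density x) * \<phi> (?\<delta> n * x))
        \<longlonglongrightarrow> of_real (std_normal_density x) * \<phi> 0"
      by (intro AE_I2 tendsto_intros isCont_tendsto_compose[OF c(1) \<delta>])
    show "AE x in lborel. norm (of_real (std_normal_density x) * \<phi> (?\<delta> n * x)) \<le> std_normal_density x * B" for n
      by (intro AE_I2) (simp add: norm_mult mult_left_mono B)
  qed measurable
  have "(\<integral>s. of_real (std_normal_density (?\<delta> n * s)) * fourier \<phi> s \<partial>lborel)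
      = of_real (sqrt (2 * pi)) * (\<integral>x. of_real (std_normal_density x) * \<phi> (?\<delta> n * x) \<partial>lborel)" for n
    by (rule integral_gaussian_fourier[OF assms]) simp
  then have "(\<integral>s. of_real (std_normal_density 0) * fourier \<phi> s \<partial>lborel)
      = of_real (sqrt (2 * pi)) * (\<integral>x. of_real (std_normal_density x) * \<phi> 0 \<partial>lborel)"
    using LIMSEQ_unique[OF lim1] tendsto_mult_left[OF lim2, of "of_real (sqrt (2 * pi))"] by presburger
  moreover have n0: "std_normal_density 0 = 1 / sqrt (2 * pi)" by (simp add: std_normal_density_def)
  ultimately have "of_real (1 / sqrt (2 * pi)) * integral UNIV (fourier \<phi>) = of_real (sqrt (2 * pi)) * \<phi> 0"
    by (simp add: n0 integral_lborel fourier_integrable(1)[OF assms])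
  then have "integral UNIV (fourier \<phi>) = (of_real (sqrt (2 * pi)) * of_real (sqrt (2 * pi))) * \<phi> 0"
    by (simp add: field_simps del: of_real_mult)
  moreover have "of_real (sqrt (2 * pi)) * of_real (sqrt (2 * pi)) = 2 * complex_of_real pi"
    unfolding of_real_mult[symmetric] by simp
  ultimately show ?thesis by (simp only:)
qed

lemma fourier_inversion:
  assumes "\<phi> \<in> test_functions UNIV"
  shows "integral UNIV (\<lambda>s. exp (\<i> * of_real s * of_real \<xi>) * fourier \<phi> s) = 2 * of_real pi * \<phi> \<xi>"
proof -
  have "(\<lambda>\<eta>. \<phi> (\<eta> + \<xi>)) \<in> test_functions UNIV"
    using test_function_affine[OF assms, of 1 \<xi>] by simp
  moreover have "fourier (\<lambda>\<eta>. \<phi> (\<eta> + \<xi>)) = (\<lambda>s. exp (\<i> * of_real s * of_real \<xi>) * fourier \<phi> s)"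
    using fourier_affine[OF assms, of 1 "- \<xi>"] by (simp add: fun_eq_iff)
  ultimately show ?thesis
    using integral_fourier[of "\<lambda>\<eta>. \<phi> (\<eta> + \<xi>)"] by simp
qed

text \<open>Transforms convolve to the transform of the product. Inserting the definition of
  \<open>fourier \<psi>\<close> and exchanging the integrals leaves the inversion formula for \<open>\<theta>\<close>.\<close>

lemma integral_fourier_convolution:
  assumes "\<psi> \<in> test_functions UNIV" "\<theta> \<in> test_functions UNIV"
  shows "integral UNIV (\<lambda>s. fourier \<theta> s * fourier \<psi> (t - s)) = 2 * of_real pi * fourier (\<lambda>\<xi>. \<psi> \<xi> * \<theta> \<xi>) t"
proof -
  let ?u = "\<lambda>s \<xi>. fourier \<theta> s * (exp (- \<i> * of_real (t - s) * of_real \<xi>) * \<psi> \<xi>)"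
  obtain C where C: "C \<ge> 0" "\<And>t. cmod (fourier \<theta> t) \<le> C * (1 / (1 + t^2)^2)"
    using fourier_decay[OF assms(2)] by metis
  obtain B where B: "\<And>t. cmod (\<psi> t) \<le> B" using test_function_norm_bound[OF assms(1)] by metis
  have c: "continuous_on S \<psi>" "continuous_on S (fourier \<theta>)" for S
    by (rule test_function_continuous_on[OF assms(1)] continuous_on_fourier[OF assms(2)])+
  have "integral UNIV (\<lambda>s. integral UNIV (\<lambda>\<xi>. ?u s \<xi>)) = integral UNIV (\<lambda>\<xi>. integral UNIV (\<lambda>s. ?u s \<xi>))"
  proof (rule Fubini_dominated[where a = "\<lambda>s. cmod (fourier \<theta> s)" and A = C and b = "\<lambda>\<xi>. cmod (\<psi> \<xi>)" and B = B])
    show "continuous_on (UNIV \<times> UNIV) (\<lambda>(s, \<xi>). ?u s \<xi>)"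
      unfolding case_prod_unfold
      by (intro continuous_intros continuous_on_compose2[OF c(1)[of UNIV]] continuous_on_compose2[OF c(2)[of UNIV]]) auto
    show "(\<lambda>s. cmod (fourier \<theta> s)) integrable_on UNIV" "(\<lambda>\<xi>. cmod (\<psi> \<xi>)) integrable_on UNIV"
      by (intro norm_integrable_on(1) fourier_integrable test_function_integrable assms; simp)+
    have "1 / (1 + s^2)^2 \<le> 1" for s :: real
      by (simp add: divide_le_eq_1 add_pos_nonneg one_le_power)
    then show "cmod (fourier \<theta> s) \<le> C" for s
      using C(2)[of s] mult_left_mono[OF _ C(1), of "1 / (1 + s^2)^2" 1] by (meson order_trans mult_left_le C(1))
  qed (use B in \<open>auto simp: norm_mult norm_exp_eq_Re\<close>)
  moreover have "integral UNIV (\<lambda>\<xi>. ?u s \<xi>) = fourier \<theta> s * fourier \<psi> (t - s)" for s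
    by (simp add: fourier_def)
  moreover have "integral UNIV (\<lambda>s. ?u s \<xi>) = 2 * of_real pi * (exp (- \<i> * of_real t * of_real \<xi>) * (\<psi> \<xi> * \<theta> \<xi>))" for \<xi>
  proof -
    have "?u s \<xi> = (exp (- \<i> * of_real t * of_real \<xi>) * \<psi> \<xi>) * (exp (\<i> * of_real s * of_real \<xi>) * fourier \<theta> s)" for s
    proof -
      have "exp (- \<i> * of_real (t - s) * of_real \<xi>) = exp (- \<i> * of_real t * of_real \<xi>) * exp (\<i> * of_real s * of_real \<xi>)"
        by (simp add: algebra_simps flip: exp_add)
      then show ?thesis by (simp only: mult_ac)
    qed
    then show ?thesis by (simp only: integral_mult_right fourier_inversion[OF assms(2)]) (simp only: mult_ac)
  qed
  ultimately show ?thesis by (simp add: fourier_def)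
qed

section \<open>Bounded semigroups and their resolvents\<close>

lemma bounded_bilinear_scaleC: "bounded_bilinear (scaleC :: complex \<Rightarrow> 'a::complex_banach \<Rightarrow> 'a)"
proof
  fix a a' :: complex and b b' :: 'a and r :: real
  show "(a + a') *\<^sub>C b = a *\<^sub>C b + a' *\<^sub>C b" by (rule scaleC_add_left)
  show "a *\<^sub>C (b + b') = a *\<^sub>C b + a *\<^sub>C b'" by (rule scaleC_add_right)
  show "(r *\<^sub>R a) *\<^sub>C b = r *\<^sub>R (a *\<^sub>C b)"
    by (metis scaleC_of_real scaleC_scaleC scaleR_conv_of_real)
  show "a *\<^sub>C (r *\<^sub>R b) = r *\<^sub>R (a *\<^sub>C b)"
    by (metis scaleC_of_real scaleC_scaleC mult.commute)
  show "\<exists>K. \<forall>a (b::'a). norm (a *\<^sub>C b) \<le> norm a * norm b * K"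
    by (rule exI[of _ 1]) (simp add: norm_scaleC)
qed

interpretation scaleC: bounded_bilinear scaleC by (rule bounded_bilinear_scaleC)

lemmas [continuous_intros] = scaleC.continuous_on
lemmas [tendsto_intros] = scaleC.tendsto
declare norm_scaleC [simp]

lemma scaleC_one [simp]: "1 *\<^sub>C u = u"
  using scaleC_of_real[of 1 u] by simp

lemma scaleC_scaleR: "(r *\<^sub>R c) *\<^sub>C u = r *\<^sub>R (c *\<^sub>C u)"
  by (rule scaleC.scaleR_left)

definition integral_kernel :: "(real \<Rightarrow> complex) \<Rightarrow> bool" where
  "integral_kernel k \<longleftrightarrow> continuous_on {0..} k \<and> (\<lambda>t. cmod (k t)) integrable_on {0..}"

definition orbit_integral :: "(real \<Rightarrow> 'a::complex_banach \<Rightarrow> 'a) \<Rightarrow> (real \<Rightarrow> complex) \<Rightarrow> 'a \<Rightarrow> 'a" where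
  "orbit_integral T k u = integral {0..} (\<lambda>t. k t *\<^sub>C T t u)"

abbreviation laplace_kernel :: "complex \<Rightarrow> real \<Rightarrow> complex" where
  "laplace_kernel \<mu> \<equiv> \<lambda>t. exp (- \<mu> * of_real t)"

lemma integral_kernel_laplace: "Re \<mu> > 0 \<Longrightarrow> integral_kernel (laplace_kernel \<mu>)"
  using has_integral_exp_minus_to_infinity[of "Re \<mu>" 0]
  by (auto simp: integral_kernel_def norm_exp_eq_Re intro!: continuous_intros)

lemma cauchy_kernel_square_integrable:
  "(\<lambda>t::real. 1 / (1 + t^2)^2) integrable_on {0..}" "(\<lambda>t::real. t * (1 / (1 + t^2)^2)) integrable_on {0..}"
proof -
  have k: "(\<lambda>t. 1 / (1 + t^2)) integrable_on {0::real..}" by (rule cauchy_kernel_integrable_on) auto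
  have c: "continuous_on {0..} (\<lambda>t::real. 1 / (1 + t^2)^2)"
    by (intro continuous_intros) (auto simp: add_nonneg_eq_0_iff)
  show "(\<lambda>t::real. 1 / (1 + t^2)^2) integrable_on {0..}"
    by (rule dominated_integrable_on[OF _ _ c _ k]) (use power_le_cauchy_kernel(1) in auto)
  show "(\<lambda>t::real. t * (1 / (1 + t^2)^2)) integrable_on {0..}"
  proof (rule dominated_integrable_on[OF _ _ continuous_on_mult[OF continuous_on_id c] _ k])
    fix t :: real assume "t \<in> {0..}"
    then have "norm (t * (1 / (1 + t^2)^2)) = \<bar>t\<bar> * (1 / (1 + t^2)^2)" by (simp add: abs_mult)
    then show "norm (t * (1 / (1 + t^2)^2)) \<le> 1 / (1 + t^2)" using power_le_cauchy_kernel(2)[of t] by simp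
  qed auto
qed

locale bounded_C0_semigroup =
  fixes T :: "real \<Rightarrow> 'a::complex_banach \<Rightarrow> 'a" and M :: real
  assumes C0: "C0_semigroup T"
    and norm_T_le: "t \<ge> 0 \<Longrightarrow> norm (T t u) \<le> M * norm u"
    and M_nonneg: "M \<ge> 0"
begin

lemma T_0 [simp]: "T 0 u = u"
  using C0 by (simp add: C0_semigroup_def)

lemma T_add: "s \<ge> 0 \<Longrightarrow> t \<ge> 0 \<Longrightarrow> T (s + t) u = T s (T t u)"
  using C0 by (simp add: C0_semigroup_def)

lemma T_bounded_linear: "t \<ge> 0 \<Longrightarrow> bounded_linear (T t)"
  using C0 by (simp add: C0_semigroup_def bounded_clinear_def)

lemma T_scaleC: "t \<ge> 0 \<Longrightarrow> T t (c *\<^sub>C u) = c *\<^sub>C T t u"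
  using C0 by (simp add: C0_semigroup_def bounded_clinear_def)

lemma T_commute: "s \<ge> 0 \<Longrightarrow> t \<ge> 0 \<Longrightarrow> T s (T t u) = T t (T s u)"
  by (metis T_add add.commute)

lemma T_diff_le:
  assumes "s \<ge> 0" "t \<ge> 0"
  shows "norm (T t u - T s u) \<le> M * norm (T \<bar>t - s\<bar> u - u)"
proof -
  have *: "norm (T b u - T a u) \<le> M * norm (T (b - a) u - u)" if "0 \<le> a" "a \<le> b" for a b
  proof -
    have "T b u = T a (T (b - a) u)" using T_add[of a "b - a" u] that by simp
    then have "T b u - T a u = T a (T (b - a) u - u)"
      using linear_diff[OF bounded_linear.linear[OF T_bounded_linear[OF that(1)]]] by simp
    then show ?thesis using norm_T_le[OF that(1)] by simp
  qed
  show ?thesis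
    using *[of s t] *[of t s] assms by (cases "s \<le> t") (auto simp: abs_if norm_minus_commute)
qed

lemma T_near_0:
  assumes "e > 0"
  obtains d where "d > 0" "\<And>t. 0 \<le> t \<Longrightarrow> t < d \<Longrightarrow> norm (T t u - u) < e"
proof -
  have "((\<lambda>t. T t u) \<longlongrightarrow> u) (at_right 0)" using C0 by (simp add: C0_semigroup_def)
  from tendstoD[OF this assms] obtain d where "d > 0" "\<And>t. 0 < t \<Longrightarrow> t < d \<Longrightarrow> dist (T t u) u < e"
    unfolding eventually_at_right_field by auto
  then show ?thesis using assms
    by (intro that[of d]) (metis T_0 dist_norm dist_self order_le_less)+
qed

lemma orbit_continuous_on: "S \<subseteq> {0..} \<Longrightarrow> continuous_on S (\<lambda>t. T t u)"
proof (rule continuous_on_subset[of "{0..}"])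
  show "continuous_on {0..} (\<lambda>t. T t u)"
    unfolding continuous_on_iff
  proof (intro ballI allI impI)
    fix s e :: real assume s: "s \<in> {0..}" and e: "e > 0"
    obtain d where d: "d > 0" "\<And>t. 0 \<le> t \<Longrightarrow> t < d \<Longrightarrow> norm (T t u - u) < e / (M + 1)"
      using T_near_0[of "e / (M + 1)" u] e M_nonneg by auto
    have "dist (T t u) (T s u) < e" if t: "t \<in> {0..}" "dist t s < d" for t
    proof -
      have "norm (T t u - T s u) \<le> M * norm (T \<bar>t - s\<bar> u - u)" using T_diff_le s t by simp
      also have "\<dots> \<le> (M + 1) * norm (T \<bar>t - s\<bar> u - u)" by (simp add: mult_right_mono)
      also have "\<dots> < e" using d(2)[of "\<bar>t - s\<bar>"] t(2) M_nonneg by (simp add: dist_real_def field_simps)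
      finally show ?thesis by (simp add: dist_norm)
    qed
    then show "\<exists>d>0. \<forall>t\<in>{0..}. dist t s < d \<longrightarrow> dist (T t u) (T s u) < e" using d(1) by blast
  qed
qed

lemma orbit_integrable:
  assumes "integral_kernel k"
  shows "(\<lambda>t. k t *\<^sub>C T t u) integrable_on {0..}"
proof (rule dominated_integrable_on)
  show "continuous_on {0..} (\<lambda>t. k t *\<^sub>C T t u)"
    using assms by (intro continuous_intros orbit_continuous_on) (auto simp: integral_kernel_def)
  show "(\<lambda>t. cmod (k t) * (M * norm u)) integrable_on {0..}"
    using assms by (intro integrable_on_mult_left) (auto simp: integral_kernel_def)
  show "norm (k t *\<^sub>C T t u) \<le> cmod (k t) * (M * norm u)" if "t \<in> {0..}" for t
    using norm_T_le[of t u] that by (simp add: mult_left_mono)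
qed auto

lemma norm_orbit_integral_le:
  assumes "integral_kernel k"
  shows "norm (orbit_integral T k u) \<le> integral {0..} (\<lambda>t. cmod (k t)) * (M * norm u)"
proof -
  have "norm (orbit_integral T k u) \<le> integral {0..} (\<lambda>t. cmod (k t) * (M * norm u))"
    unfolding orbit_integral_def
  proof (rule integral_norm_bound_integral[OF orbit_integrable[OF assms]])
    show "(\<lambda>t. cmod (k t) * (M * norm u)) integrable_on {0..}"
      using assms by (intro integrable_on_mult_left) (auto simp: integral_kernel_def)
    show "norm (k t *\<^sub>C T t u) \<le> cmod (k t) * (M * norm u)" if "t \<in> {0..}" for t
      using norm_T_le[of t u] that by (simp add: mult_left_mono)
  qed
  then show ?thesis by simp
qed

lemma orbit_integral_bounded_linear:
  assumes "integral_kernel k"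
  shows "bounded_linear (orbit_integral T k)"
proof (rule bounded_linear_intro)
  fix u v and r :: real
  have "(\<lambda>t. k t *\<^sub>C T t (u + v)) t = k t *\<^sub>C T t u + k t *\<^sub>C T t v" if "t \<in> {0..}" for t
    using linear_add[OF bounded_linear.linear[OF T_bounded_linear]] that by (simp add: scaleC_add_right)
  then have "orbit_integral T k (u + v) = integral {0..} (\<lambda>t. k t *\<^sub>C T t u + k t *\<^sub>C T t v)"
    unfolding orbit_integral_def by (intro integral_cong) auto
  then show "orbit_integral T k (u + v) = orbit_integral T k u + orbit_integral T k v"
    unfolding orbit_integral_def
    by (simp add: Henstock_Kurzweil_Integration.integral_add orbit_integrable[OF assms])
  have "(\<lambda>t. k t *\<^sub>C T t (r *\<^sub>R u)) t = r *\<^sub>R (k t *\<^sub>C T t u)" if "t \<in> {0..}" for t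
    using linear_scale[OF bounded_linear.linear[OF T_bounded_linear]] that by (simp add: scaleC.scaleR_right)
  then have "orbit_integral T k (r *\<^sub>R u) = integral {0..} (\<lambda>t. r *\<^sub>R (k t *\<^sub>C T t u))"
    unfolding orbit_integral_def by (intro integral_cong) auto
  then show "orbit_integral T k (r *\<^sub>R u) = r *\<^sub>R orbit_integral T k u"
    unfolding orbit_integral_def by simp
  show "norm (orbit_integral T k u) \<le> norm u * (integral {0..} (\<lambda>t. cmod (k t)) * M)"
    using norm_orbit_integral_le[OF assms, of u] by (simp add: mult_ac)
qed

text \<open>Operators commuting with the semigroup pass through the integral; in particular all operators
  \<open>orbit_integral T k\<close> commute.\<close>

lemma orbit_integral_commute:
  assumes "integral_kernel k" "bounded_linear S" "\<And>c u. S (c *\<^sub>C u) = c *\<^sub>C S u"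
    and "\<And>t u. t \<ge> 0 \<Longrightarrow> S (T t u) = T t (S u)"
  shows "S (orbit_integral T k u) = orbit_integral T k (S u)"
proof -
  have "S (orbit_integral T k u) = integral {0..} (S \<circ> (\<lambda>t. k t *\<^sub>C T t u))"
    unfolding orbit_integral_def by (rule integral_linear[OF orbit_integrable[OF assms(1)] assms(2), symmetric])
  also have "\<dots> = orbit_integral T k (S u)"
    unfolding orbit_integral_def by (intro integral_cong) (auto simp: assms(3,4))
  finally show ?thesis .
qed

lemma orbit_integral_scaleC:
  assumes "integral_kernel k"
  shows "orbit_integral T k (c *\<^sub>C u) = c *\<^sub>C orbit_integral T k u"
  by (rule orbit_integral_commute[OF assms, symmetric])
    (auto simp: scaleC.bounded_linear_right scaleC_scaleC T_scaleC mult.commute)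

lemma orbit_integral_T:
  "integral_kernel k \<Longrightarrow> s \<ge> 0 \<Longrightarrow> T s (orbit_integral T k u) = orbit_integral T k (T s u)"
  by (rule orbit_integral_commute) (auto simp: T_bounded_linear T_scaleC T_commute)

lemma orbit_integral_orbit_integral:
  "integral_kernel k \<Longrightarrow> integral_kernel k' \<Longrightarrow>
    orbit_integral T k (orbit_integral T k' u) = orbit_integral T k' (orbit_integral T k u)"
  by (rule orbit_integral_commute)
    (auto simp: orbit_integral_bounded_linear orbit_integral_scaleC orbit_integral_T)

text \<open>This is the substitution \<open>t \<mapsto> t + h\<close> in the Laplace integral. The right-hand side is visibly
  differentiable in \<open>h\<close>, although the orbit of a general \<open>u\<close> is not.\<close>

lemma T_laplace:
  assumes "Re \<mu> > 0" "h \<ge> 0"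
  shows "T h (orbit_integral T (laplace_kernel \<mu>) u) =
    exp (\<mu> * of_real h) *\<^sub>C (orbit_integral T (laplace_kernel \<mu>) u - integral {0..h} (\<lambda>t. laplace_kernel \<mu> t *\<^sub>C T t u))"
proof -
  let ?f = "\<lambda>t. laplace_kernel \<mu> t *\<^sub>C T t u"
  note k = integral_kernel_laplace[OF assms(1)]
  have f: "?f integrable_on {0..}" by (rule orbit_integrable[OF k])
  have cf: "continuous_on S ?f" if "S \<subseteq> {0..}" for S
    by (intro continuous_intros orbit_continuous_on that)
  have fh: "T h (?f t) = exp (\<mu> * of_real h) *\<^sub>C ?f (t + h)" if "t \<ge> 0" for t
  proof -
    have "exp (\<mu> * of_real h) * laplace_kernel \<mu> (t + h) = laplace_kernel \<mu> t"
      by (simp add: algebra_simps flip: exp_add)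
    then show ?thesis
      using T_add[OF assms(2) that] assms(2) by (simp add: T_scaleC scaleC_scaleC add.commute)
  qed
  have Tf: "(\<lambda>t. T h (?f t)) integrable_on {0..}"
    using integrable_linear[OF f T_bounded_linear[OF assms(2)]] by (simp add: o_def)
  have "((\<lambda>r. exp (\<mu> * of_real h) *\<^sub>C (integral ({0..} \<inter> {-r..r}) ?f - integral {0..h} ?f))
      \<longlongrightarrow> exp (\<mu> * of_real h) *\<^sub>C (integral {0..} ?f - integral {0..h} ?f)) at_top"
    by (intro tendsto_intros integral_exhaust f)
  moreover have "filterlim (\<lambda>r. r + h) at_top at_top"
    by (rule filterlim_tendsto_add_at_top[OF tendsto_const filterlim_ident, of h, unfolded add.commute[of h]])
  ultimately have lim: "((\<lambda>r. exp (\<mu> * of_real h) *\<^sub>C (integral ({0..} \<inter> {-(r + h)..r + h}) ?f - integral {0..h} ?f))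
      \<longlongrightarrow> exp (\<mu> * of_real h) *\<^sub>C (integral {0..} ?f - integral {0..h} ?f)) at_top"
    by (rule filterlim_compose)
  have "integral {0..} (\<lambda>t. T h (?f t)) = exp (\<mu> * of_real h) *\<^sub>C (integral {0..} ?f - integral {0..h} ?f)"
  proof (rule tendsto_unique[OF _ integral_exhaust[OF Tf]])
    show "((\<lambda>r. integral ({0..} \<inter> {-r..r}) (\<lambda>t. T h (?f t)))
        \<longlongrightarrow> exp (\<mu> * of_real h) *\<^sub>C (integral {0..} ?f - integral {0..h} ?f)) at_top"
      using lim
    proof (rule Lim_transform_eventually)
      show "\<forall>\<^sub>F r in at_top. exp (\<mu> * of_real h) *\<^sub>C (integral ({0..} \<inter> {-(r + h)..r + h}) ?f - integral {0..h} ?f)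
          = integral ({0..} \<inter> {-r..r}) (\<lambda>t. T h (?f t))"
      proof (rule eventually_at_top_linorderI[of 0])
        fix r :: real assume r: "0 \<le> r"
        have eqs: "{0..} \<inter> {-r..r} = {0..r}" "{0..} \<inter> {-(r + h)..r + h} = {0..r + h}" using r assms(2) by auto
        have "integral {0..r} (\<lambda>t. T h (?f t)) = integral {0..r} (\<lambda>t. exp (\<mu> * of_real h) *\<^sub>C ?f (h + t))"
          by (rule integral_cong) (use fh in \<open>auto simp: add.commute[of h]\<close>)
        also have "\<dots> = exp (\<mu> * of_real h) *\<^sub>C integral {0..r} (?f \<circ> ((+) h))"
        proof -
          have "(?f \<circ> ((+) h)) integrable_on {0..r}"
            by (intro integrable_continuous_real continuous_on_compose cf continuous_intros) (use assms(2) in auto)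
          from integral_linear[OF this scaleC.bounded_linear_right[of "exp (\<mu> * of_real h)"]] show ?thesis
            by (simp add: o_def)
        qed
        also have "integral {0..r} (?f \<circ> ((+) h)) = integral {0 + h..r + h} ?f"
          by (rule integral_shift_Icc_real)
        also have "\<dots> = integral {0..r + h} ?f - integral {0..h} ?f"
        proof -
          have "integral {0..h} ?f + integral {h..r + h} ?f = integral {0..r + h} ?f"
            by (rule Henstock_Kurzweil_Integration.integral_combine[OF _ _ integrable_continuous_real[OF cf]])
              (use r assms(2) in auto)
          then show ?thesis by (simp add: algebra_simps)
        qed
        finally show "exp (\<mu> * of_real h) *\<^sub>C (integral ({0..} \<inter> {-(r + h)..r + h}) ?f - integral {0..h} ?f)
          = integral ({0..} \<inter> {-r..r}) (\<lambda>t. T h (?f t))" unfolding eqs by simp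
      qed
    qed
  qed simp
  moreover have "T h (integral {0..} ?f) = integral {0..} (\<lambda>t. T h (?f t))"
    using integral_linear[OF f T_bounded_linear[OF assms(2)]] by (simp add: o_def)
  ultimately show ?thesis by (simp add: orbit_integral_def)
qed

lemma laplace_orbit_has_derivative:
  fixes u assumes "Re \<mu> > 0" "t \<ge> 0"
  defines "z \<equiv> orbit_integral T (laplace_kernel \<mu>) u"
  shows "((\<lambda>t. T t z) has_vector_derivative \<mu> *\<^sub>C T t z - T t u) (at t within {0..})"
proof -
  let ?f = "\<lambda>t. laplace_kernel \<mu> t *\<^sub>C T t u"
  let ?E = "\<lambda>t. exp (\<mu> * complex_of_real t)"
  have F: "((\<lambda>t. integral {0..t} ?f) has_vector_derivative ?f t) (at t within {0..})"
  proof -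
    have "((\<lambda>t. integral {0..t} ?f) has_vector_derivative ?f t) (at t within {0..t + 1})"
      by (rule integral_has_vector_derivative) (use assms(2) in \<open>auto intro!: continuous_intros orbit_continuous_on\<close>)
    moreover have "at t within {0..t + 1} = at t within {0..}"
      by (rule at_within_nhd[of _ "{..<t + 1}"]) auto
    ultimately show ?thesis by simp
  qed
  have E: "(?E has_vector_derivative \<mu> * ?E t) (at t within {0..})"
    by (auto intro!: has_vector_derivative_real_field derivative_eq_intros)
  have "((\<lambda>t. z - integral {0..t} ?f) has_vector_derivative 0 - ?f t) (at t within {0..})"
    by (intro has_vector_derivative_diff has_vector_derivative_const F)
  from bounded_bilinear.has_vector_derivative[OF bounded_bilinear_scaleC E this]
  have D: "((\<lambda>t. ?E t *\<^sub>C (z - integral {0..t} ?f)) has_vector_derivative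
      ?E t *\<^sub>C (0 - ?f t) + (\<mu> * ?E t) *\<^sub>C (z - integral {0..t} ?f)) (at t within {0..})" .
  have Tz: "T t z = ?E t *\<^sub>C (z - integral {0..t} ?f)" if "t \<ge> 0" for t
    unfolding z_def by (rule T_laplace[OF assms(1) that])
  have "?E t *\<^sub>C (0 - ?f t) = - T t u"
    by (simp add: scaleC.minus_right scaleC_scaleC flip: exp_add)
  moreover have "(\<mu> * ?E t) *\<^sub>C (z - integral {0..t} ?f) = \<mu> *\<^sub>C T t z"
    using Tz[OF assms(2)] by (simp add: scaleC_scaleC)
  ultimately have "((\<lambda>t. ?E t *\<^sub>C (z - integral {0..t} ?f)) has_vector_derivative \<mu> *\<^sub>C T t z - T t u) (at t within {0..})"
    using D by (simp add: algebra_simps)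
  then show ?thesis
    by (rule has_vector_derivative_transform[rotated 2]) (use Tz assms(2) in auto)
qed

lemma laplace_in_generator:
  fixes u assumes "Re \<mu> > 0"
  defines "z \<equiv> orbit_integral T (laplace_kernel \<mu>) u"
  shows "((\<lambda>h. (1 / h) *\<^sub>R (T h z - z)) \<longlongrightarrow> \<mu> *\<^sub>C z - u) (at_right 0)"
proof -
  have "((\<lambda>t. T t z) has_vector_derivative \<mu> *\<^sub>C T 0 z - T 0 u) (at 0 within {0..})"
    unfolding z_def by (rule laplace_orbit_has_derivative[OF assms(1)]) simp
  then have "((\<lambda>t. T t z) has_vector_derivative \<mu> *\<^sub>C z - u) (at 0 within {0<..})"
    by (simp add: has_vector_derivative_within_subset[of _ _ _ "{0..}"] subset_iff)
  then have "((\<lambda>y. (1 / norm (y - 0)) *\<^sub>R (T y z - (T 0 z + (y - 0) *\<^sub>R (\<mu> *\<^sub>C z - u)))) \<longlongrightarrow> 0) (at_right 0)"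
    unfolding has_vector_derivative_def has_derivative_within by blast
  then have "((\<lambda>y. (1 / norm (y - 0)) *\<^sub>R (T y z - (T 0 z + (y - 0) *\<^sub>R (\<mu> *\<^sub>C z - u))) + (\<mu> *\<^sub>C z - u))
      \<longlongrightarrow> 0 + (\<mu> *\<^sub>C z - u)) (at_right 0)"
    by (intro tendsto_intros)
  then have "((\<lambda>h. (1 / h) *\<^sub>R (T h z - z)) \<longlongrightarrow> 0 + (\<mu> *\<^sub>C z - u)) (at_right 0)"
  proof (rule Lim_transform_eventually)
    show "\<forall>\<^sub>F h in at_right 0. (1 / norm (h - 0)) *\<^sub>R (T h z - (T 0 z + (h - 0) *\<^sub>R (\<mu> *\<^sub>C z - u))) + (\<mu> *\<^sub>C z - u)
        = (1 / h) *\<^sub>R (T h z - z)"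
      by (rule eventually_at_rightI[of _ 1]) (auto simp: scaleR_diff_right scaleR_add_right)
  qed
  then show ?thesis by simp
qed

text \<open>By the previous lemma the Laplace transform is a right inverse of \<open>\<mu> - A\<close>. As it is bounded and
  commutes with the semigroup, it commutes with \<open>A\<close> and is a left inverse too.\<close>

lemma resolvent_eq_laplace:
  assumes "Re \<mu> > 0"
  shows "resolvent \<mu> (generator T) u = orbit_integral T (laplace_kernel \<mu>) u"
proof -
  let ?L = "orbit_integral T (laplace_kernel \<mu>)"
  note k = integral_kernel_laplace[OF assms]
  interpret L: bounded_linear ?L by (rule orbit_integral_bounded_linear[OF k])
  have lim: "((\<lambda>h. (1 / h) *\<^sub>R (T h (?L v) - ?L v)) \<longlongrightarrow> \<mu> *\<^sub>C ?L v - v) (at_right 0)" for v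
    by (rule laplace_in_generator[OF assms])
  have left: "?L (\<mu> *\<^sub>C v - snd (generator T) v) = v" if v: "v \<in> fst (generator T)" for v
  proof -
    obtain w where w: "((\<lambda>h. (1 / h) *\<^sub>R (T h v - v)) \<longlongrightarrow> w) (at_right 0)"
      using v by (auto simp: generator_def)
    have "((\<lambda>h. (1 / h) *\<^sub>R (T h (?L v) - ?L v)) \<longlongrightarrow> ?L w) (at_right 0)"
    proof (rule Lim_transform_eventually[OF L.tendsto[OF w]])
      show "\<forall>\<^sub>F h in at_right 0. ?L ((1 / h) *\<^sub>R (T h v - v)) = (1 / h) *\<^sub>R (T h (?L v) - ?L v)"
      proof (rule eventually_at_rightI[of _ 1])
        fix h :: real assume "h \<in> {0<..<1}"
        then show "?L ((1 / h) *\<^sub>R (T h v - v)) = (1 / h) *\<^sub>R (T h (?L v) - ?L v)"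
          by (simp only: L.scaleR L.diff orbit_integral_T[OF k] greaterThanLessThan_iff less_imp_le)
      qed simp
    qed
    then have "?L w = \<mu> *\<^sub>C ?L v - v" using tendsto_unique[OF _ _ lim] by simp
    moreover have "snd (generator T) v = w" using w by (simp add: generator_def tendsto_Lim)
    ultimately show ?thesis by (simp only: L.diff orbit_integral_scaleC[OF k]) simp
  qed
  have "inj_on (\<lambda>v. \<mu> *\<^sub>C v - snd (generator T) v) (fst (generator T))"
    by (rule inj_on_inverseI[of _ ?L]) (rule left)
  moreover have "?L u \<in> fst (generator T)" using lim by (auto simp: generator_def)
  moreover have "\<mu> *\<^sub>C ?L u - snd (generator T) (?L u) = u"
    using tendsto_Lim[OF _ lim] by (simp add: generator_def)
  ultimately show ?thesis unfolding resolvent_def by (intro inv_into_f_eq) auto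
qed

text \<open>The distribution \<open>R(i\<sqdot>,A)u\<close> is the Fourier transform of the orbit of \<open>u\<close>: before the limit,
  exchanging the integrals over \<open>\<xi>\<close> and \<open>t\<close> yields the orbit weighted by \<open>e\<^sup>-\<^sup>\<alpha>\<^sup>t\<close>.\<close>

lemma boundary_resolvent_eq:
  assumes "\<phi> \<in> test_functions UNIV"
  shows "boundary_resolvent (generator T) u \<phi> = orbit_integral T (fourier \<phi>) u"
proof -
  obtain B where B: "B \<ge> 0" "\<And>t. cmod (\<phi> t) \<le> B" using test_function_norm_bound[OF assms] by metis
  obtain C where C: "C \<ge> 0" "\<And>t. cmod (fourier \<phi> t) \<le> C * (1 / (1 + t^2)^2)"
    using fourier_decay[OF assms] by metis
  have S: "closed {0::real..}" "is_interval {0::real..}" by auto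
  have cT: "continuous_on {0..} (\<lambda>t. T t u)" by (rule orbit_continuous_on) simp
  have eq: "integral UNIV (\<lambda>\<xi>. \<phi> \<xi> *\<^sub>C resolvent (Complex \<alpha> \<xi>) (generator T) u) =
      integral {0..} (\<lambda>t. exp (- \<alpha> * t) *\<^sub>R (fourier \<phi> t *\<^sub>C T t u))" if \<alpha>: "\<alpha> > 0" for \<alpha>
  proof -
    let ?v = "\<lambda>\<xi> t. (\<phi> \<xi> * exp (- Complex \<alpha> \<xi> * of_real t)) *\<^sub>C T t u"
    have e: "(\<lambda>t. exp (- \<alpha> * t)) integrable_on {0..}"
      using has_integral_exp_minus_to_infinity[OF \<alpha>] by blast
    have "integral UNIV (\<lambda>\<xi>. integral {0..} (\<lambda>t. ?v \<xi> t)) = integral {0..} (\<lambda>t. integral UNIV (\<lambda>\<xi>. ?v \<xi> t))"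
    proof (rule Fubini_dominated[OF _ _ S, where a = "\<lambda>\<xi>. cmod (\<phi> \<xi>)" and A = B
          and b = "\<lambda>t. exp (- \<alpha> * t) * (M * norm u)" and B = "M * norm u"])
      show "continuous_on (UNIV \<times> {0..}) (\<lambda>(\<xi>, t). ?v \<xi> t)"
        unfolding case_prod_unfold Complex_eq
        by (intro continuous_intros continuous_on_compose2[OF test_function_continuous_on[OF assms, of UNIV]]
            continuous_on_compose2[OF cT]) auto
      show "norm (?v \<xi> t) \<le> cmod (\<phi> \<xi>) * (exp (- \<alpha> * t) * (M * norm u))" if "t \<in> {0..}" for \<xi> t
      proof -
        have "norm (?v \<xi> t) = cmod (\<phi> \<xi>) * (exp (- \<alpha> * t) * norm (T t u))"
          by (simp only: norm_scaleC norm_mult norm_exp_eq_Re) simp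
        also have "\<dots> \<le> cmod (\<phi> \<xi>) * (exp (- \<alpha> * t) * (M * norm u))"
          using that by (intro mult_left_mono norm_T_le) auto
        finally show ?thesis .
      qed
      show "(\<lambda>\<xi>. cmod (\<phi> \<xi>)) integrable_on UNIV"
        by (rule norm_integrable_on(1)[OF test_function_integrable[OF assms]]) simp
      show "(\<lambda>t. exp (- \<alpha> * t) * (M * norm u)) integrable_on {0..}"
        by (rule integrable_on_mult_left[OF e])
      show "exp (- \<alpha> * t) * (M * norm u) \<le> M * norm u" if "t \<in> {0..}" for t
        using that \<alpha> M_nonneg by (intro mult_left_le_one_le) auto
    qed (use B M_nonneg in auto)
    moreover have "integral {0..} (\<lambda>t. ?v \<xi> t) = \<phi> \<xi> *\<^sub>C resolvent (Complex \<alpha> \<xi>) (generator T) u" for \<xi>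
    proof -
      have "(\<lambda>t. laplace_kernel (Complex \<alpha> \<xi>) t *\<^sub>C T t u) integrable_on {0..}"
        by (intro orbit_integrable integral_kernel_laplace) (use \<alpha> in simp)
      from integral_linear[OF this scaleC.bounded_linear_right[of "\<phi> \<xi>"]] show ?thesis
        using resolvent_eq_laplace[of "Complex \<alpha> \<xi>" u] \<alpha>
        by (simp add: orbit_integral_def o_def scaleC_scaleC)
    qed
    moreover have "integral UNIV (\<lambda>\<xi>. ?v \<xi> t) = exp (- \<alpha> * t) *\<^sub>R (fourier \<phi> t *\<^sub>C T t u)" for t
    proof -
      have "?v \<xi> t = exp (- \<alpha> * t) *\<^sub>R ((exp (- \<i> * of_real t * of_real \<xi>) * \<phi> \<xi>) *\<^sub>C T t u)" for \<xi>
      proof -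
        have "exp (- Complex \<alpha> \<xi> * of_real t) = exp (- \<alpha> * t) *\<^sub>R exp (- \<i> * of_real t * of_real \<xi>)"
          by (simp add: Complex_eq scaleR_conv_of_real algebra_simps flip: exp_of_real exp_add)
        then show ?thesis by (simp add: mult.commute flip: scaleC_scaleR)
      qed
      moreover have "integral UNIV (\<lambda>\<xi>. (exp (- \<i> * of_real t * of_real \<xi>) * \<phi> \<xi>) *\<^sub>C T t u) = fourier \<phi> t *\<^sub>C T t u"
        using integral_linear[OF fourier_kernel_integrable_on[OF assms] scaleC.bounded_linear_left[of "T t u"]]
        by (simp add: fourier_def o_def)
      ultimately show ?thesis by simp
    qed
    ultimately show ?thesis by simp
  qed
  let ?b = "\<lambda>t::real. C * (1 / (1 + t^2)^2) * (M * norm u)"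
  have "((\<lambda>\<alpha>. integral {0..} (\<lambda>t. exp (- \<alpha> * t) *\<^sub>R (fourier \<phi> t *\<^sub>C T t u)))
      \<longlongrightarrow> integral {0..} (\<lambda>t. fourier \<phi> t *\<^sub>C T t u)) (at_right 0)"
  proof (rule abel_limit[where b = ?b])
    show "continuous_on {0..} (\<lambda>t. fourier \<phi> t *\<^sub>C T t u)"
      by (intro continuous_intros continuous_on_fourier assms cT)
    show "norm (fourier \<phi> t *\<^sub>C T t u) \<le> ?b t" if "t \<ge> 0" for t
      unfolding norm_scaleC by (intro mult_mono C norm_T_le that) (use C in auto)
    show "?b integrable_on {0..}"
      by (intro integrable_on_mult_left integrable_on_mult_right cauchy_kernel_square_integrable(1))
    show "(\<lambda>t. t * ?b t) integrable_on {0..}"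
      using integrable_on_mult_right[OF cauchy_kernel_square_integrable(2), of "C * (M * norm u)"]
      by (simp add: mult_ac)
  qed
  then have "((\<lambda>\<alpha>. integral UNIV (\<lambda>\<xi>. \<phi> \<xi> *\<^sub>C resolvent (Complex \<alpha> \<xi>) (generator T) u))
      \<longlongrightarrow> orbit_integral T (fourier \<phi>) u) (at_right 0)"
    unfolding orbit_integral_def
    by (rule Lim_transform_eventually) (use eq in \<open>auto intro!: eventually_at_rightI[of _ 1]\<close>)
  then show ?thesis unfolding boundary_resolvent_def by (intro tendsto_Lim) auto
qed

end

section \<open>Smoothed orbits\<close>

text \<open>Up to the factor \<open>2\<pi>\<close> this is the part of the orbit with frequencies weighted by \<open>\<phi>\<close>; equivalently,
  it is the pairing of the Fourier transform of the orbit with \<open>e\<^sup>i\<^sup>s\<^sup>\<xi> \<phi>(\<xi>)\<close>. Its behaviour as \<open>s\<close>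
  tends to infinity detects local pseudofunctions.\<close>

definition smoothed_orbit ::
    "(real \<Rightarrow> 'a::complex_banach \<Rightarrow> 'a) \<Rightarrow> (real \<Rightarrow> complex) \<Rightarrow> 'a \<Rightarrow> real \<Rightarrow> 'a" where
  "smoothed_orbit T \<phi> u s = orbit_integral T (\<lambda>t. fourier \<phi> (t - s)) u"

definition fourier_norm :: "(real \<Rightarrow> complex) \<Rightarrow> real" where
  "fourier_norm \<phi> = (\<integral>t. cmod (fourier \<phi> t) \<partial>lborel)"

lemma fourier_norm_nonneg: "fourier_norm \<phi> \<ge> 0"
  by (simp add: fourier_norm_def)

lemma fourier_shift_integrable:
  assumes "\<phi> \<in> test_functions UNIV"
  shows "integrable lborel (\<lambda>t. fourier \<phi> (t - s))"
  using lborel_integrable_real_affine[OF fourier_integrable(1)[OF assms], of 1 "- s"] by simp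

lemma integral_fourier_shift_le:
  assumes "\<phi> \<in> test_functions UNIV" "S \<in> sets borel"
  shows "integral S (\<lambda>t. cmod (fourier \<phi> (t - s))) \<le> fourier_norm \<phi>"
  using norm_integrable_on(2)[OF fourier_shift_integrable[OF assms(1)] assms(2), of s]
    lborel_integral_real_affine[of 1 "\<lambda>t. cmod (fourier \<phi> t)" "- s"]
  by (simp add: fourier_norm_def)

lemma integral_kernel_fourier:
  assumes "\<phi> \<in> test_functions UNIV"
  shows "integral_kernel (\<lambda>t. fourier \<phi> (t - s))"
  unfolding integral_kernel_def
  by (intro conjI continuous_on_fourier_compose[OF assms] continuous_intros
      norm_integrable_on(1)[OF fourier_shift_integrable[OF assms]]) auto

text \<open>Peetre's inequality turns decay in \<open>t - s\<close> and in \<open>s\<close> into a product of decay in \<open>t\<close> and decay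
  in \<open>s\<close>, as required for exchanging integrals.\<close>

lemma peetre: "1 + t^2 \<le> 2 * ((1 + s^2) * (1 + (t - s)^2))" for s t :: real
proof -
  have "t^2 \<le> 2 * s^2 + 2 * (t - s)^2"
    using zero_le_power2[of "2 * s - t"] by (simp add: power2_eq_square algebra_simps)
  moreover have "0 \<le> s^2 * (t - s)^2" by simp
  moreover have "2 * ((1 + s^2) * (1 + (t - s)^2)) = 2 + 2 * s^2 + 2 * (t - s)^2 + 2 * (s^2 * (t - s)^2)"
    by (simp add: distrib_left distrib_right)
  ultimately show ?thesis by linarith
qed

lemma peetre_cauchy_kernel: "1 / (1 + (t - s)^2) \<le> 2 * (1 + s^2) * (1 / (1 + t^2))" for s t :: real
proof -
  have "1 + t^2 > 0" "1 + (t - s)^2 > 0" by (simp_all add: add_pos_nonneg)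
  then show ?thesis using peetre[of t s] by (simp add: field_simps)
qed

lemma fourier_decay_weak:
  assumes "\<phi> \<in> test_functions UNIV"
  obtains C where "C \<ge> 0" "\<And>t. cmod (fourier \<phi> t) \<le> C * (1 / (1 + t^2))"
  using norm_fourier_le_cauchy_kernel[OF assms] by (intro that[rotated]) auto

text \<open>Where \<open>t\<close> lies far to the left of \<open>s\<close> the kernel \<open>fourier \<phi> (t - s)\<close> is small, elsewhere \<open>g\<close> is.\<close>

lemma fourier_average_tendsto_0:
  fixes g :: "real \<Rightarrow> 'a::complex_banach"
  assumes \<phi>: "\<phi> \<in> test_functions UNIV" and S: "closed S" "is_interval S"
    and g: "continuous_on S g" "\<And>t. t \<in> S \<Longrightarrow> norm (g t) \<le> B"
    and lim: "\<And>e. e > 0 \<Longrightarrow> \<exists>r. \<forall>t\<in>S. t \<ge> r \<longrightarrow> norm (g t) \<le> e"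
  shows "((\<lambda>s. integral S (\<lambda>t. fourier \<phi> (t - s) *\<^sub>C g t)) \<longlongrightarrow> 0) at_top"
proof (rule tendstoI)
  fix e :: real assume "e > 0"
  obtain C where C: "C \<ge> 0" "\<And>t. cmod (fourier \<phi> t) \<le> C * (1 / (1 + t^2)^2)"
    using fourier_decay[OF \<phi>] by metis
  define \<epsilon> where "\<epsilon> = e / (C * pi + 1)"
  have Cp: "C * pi + 1 > 0" using C(1) by (simp add: add_nonneg_pos)
  have \<epsilon>: "\<epsilon> > 0" using \<open>e > 0\<close> Cp by (simp add: \<epsilon>_def)
  obtain r where r: "\<And>t. t \<in> S \<Longrightarrow> t \<ge> r \<Longrightarrow> norm (g t) \<le> \<epsilon> / 2" using lim[of "\<epsilon> / 2"] \<epsilon> by auto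
  have fi: "(\<lambda>t. fourier \<phi> (t - s) *\<^sub>C g t) integrable_on S" for s
  proof (rule dominated_integrable_on[OF S])
    show "continuous_on S (\<lambda>t. fourier \<phi> (t - s) *\<^sub>C g t)"
      by (intro continuous_intros g continuous_on_fourier_compose[OF \<phi>])
    show "(\<lambda>t. cmod (fourier \<phi> (t - s)) * B) integrable_on S"
      by (intro integrable_on_mult_left norm_integrable_on(1) fourier_shift_integrable \<phi>) (use S in auto)
    show "norm (fourier \<phi> (t - s) *\<^sub>C g t) \<le> cmod (fourier \<phi> (t - s)) * B" if "t \<in> S" for t
      using g(2)[OF that] by (simp add: mult_left_mono)
  qed
  have bound: "norm (integral S (\<lambda>t. fourier \<phi> (t - s) *\<^sub>C g t)) < e"
    if s: "s \<ge> r" "\<bar>B\<bar> * (1 / (1 + (s - r)^2)) < \<epsilon> / 2" for s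
  proof -
    have pt: "norm (fourier \<phi> (t - s) *\<^sub>C g t) \<le> (C * \<epsilon>) * (1 / (1 + (t - s)^2))" if t: "t \<in> S" for t
    proof -
      have p: "1 + (t - s)^2 > 0" "1 + (s - r)^2 > 0" by (simp_all add: add_pos_nonneg)
      have "1 / (1 + (t - s)^2) * norm (g t) \<le> \<epsilon>"
      proof (cases "t \<ge> r")
        case True
        have "1 / (1 + (t - s)^2) * norm (g t) \<le> 1 * norm (g t)"
          by (intro mult_right_mono) (auto simp: divide_le_eq_1 add_pos_nonneg)
        then show ?thesis using r[OF t True] \<epsilon> by linarith
      next
        case False
        then have "\<bar>s - r\<bar> \<le> \<bar>t - s\<bar>" using s(1) by auto
        then have "(s - r)^2 \<le> (t - s)^2" by (simp add: abs_le_square_iff)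
        then have "1 / (1 + (t - s)^2) \<le> 1 / (1 + (s - r)^2)" using p by (intro divide_left_mono) auto
        then have "1 / (1 + (t - s)^2) * norm (g t) \<le> 1 / (1 + (s - r)^2) * \<bar>B\<bar>"
          using g(2)[OF t] p by (intro mult_mono) auto
        moreover have "1 / (1 + (s - r)^2) * \<bar>B\<bar> < \<epsilon> / 2" using s(2) by (simp only: mult.commute)
        ultimately show ?thesis using \<epsilon> by linarith
      qed
      then have "C * (1 / (1 + (t - s)^2)) * (1 / (1 + (t - s)^2) * norm (g t)) \<le> C * (1 / (1 + (t - s)^2)) * \<epsilon>"
        using C(1) p by (intro mult_left_mono) auto
      moreover have "norm (fourier \<phi> (t - s) *\<^sub>C g t) \<le> C * (1 / (1 + (t - s)^2)^2) * norm (g t)"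
        using C(2)[of "t - s"] by (simp only: norm_scaleC mult_right_mono norm_ge_zero)
      ultimately show ?thesis by (simp add: power2_eq_square[of "1 + _"] mult_ac)
    qed
    have "norm (integral S (\<lambda>t. fourier \<phi> (t - s) *\<^sub>C g t)) \<le> integral S (\<lambda>t. (C * \<epsilon>) * (1 / (1 + (t - s)^2)))"
      by (rule integral_norm_bound_integral[OF fi integrable_on_mult_right[OF cauchy_kernel_shift(1)[OF S(1)]] pt])
    also have "\<dots> \<le> (C * \<epsilon>) * pi"
      using cauchy_kernel_shift(2)[OF S(1), of s] C(1) \<epsilon>
      by (simp only: integral_mult_right) (intro mult_left_mono, auto)
    also have "\<dots> < e"
    proof -
      have "\<epsilon> * (C * pi) < \<epsilon> * (C * pi + 1)" using \<epsilon> by simp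
      also have "\<dots> = e" using Cp by (simp add: \<epsilon>_def)
      finally show ?thesis by (simp add: mult_ac)
    qed
    finally show ?thesis .
  qed
  have "((\<lambda>s. \<bar>B\<bar> * (1 / (1 + (s - r)^2))) \<longlongrightarrow> 0) at_top" by real_asymp
  then have "\<forall>\<^sub>F s in at_top. \<bar>B\<bar> * (1 / (1 + (s - r)^2)) < \<epsilon> / 2" using \<epsilon> by (intro order_tendstoD(2)) auto
  then show "\<forall>\<^sub>F s in at_top. dist (integral S (\<lambda>t. fourier \<phi> (t - s) *\<^sub>C g t)) 0 < e"
    using eventually_ge_at_top[of r] by eventually_elim (simp only: dist_0_norm dist_commute[of _ 0] bound)
qed

context bounded_C0_semigroup
begin

lemma norm_smoothed_orbit_le:
  assumes "\<phi> \<in> test_functions UNIV"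
  shows "norm (smoothed_orbit T \<phi> u s) \<le> fourier_norm \<phi> * (M * norm u)"
proof -
  have "integral {0..} (\<lambda>t. cmod (fourier \<phi> (t - s))) * (M * norm u) \<le> fourier_norm \<phi> * (M * norm u)"
    by (intro mult_right_mono integral_fourier_shift_le assms) (use M_nonneg in auto)
  then show ?thesis
    using norm_orbit_integral_le[OF integral_kernel_fourier[OF assms], of s u]
    unfolding smoothed_orbit_def by linarith
qed

lemma smoothed_orbit_add:
  assumes "\<phi> \<in> test_functions UNIV" "\<psi> \<in> test_functions UNIV"
  shows "smoothed_orbit T (\<lambda>\<xi>. \<phi> \<xi> + \<psi> \<xi>) u s = smoothed_orbit T \<phi> u s + smoothed_orbit T \<psi> u s"
  using orbit_integrable[OF integral_kernel_fourier[OF assms(1)], of s u]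
    orbit_integrable[OF integral_kernel_fourier[OF assms(2)], of s u]
  by (simp add: smoothed_orbit_def orbit_integral_def fourier_add[OF assms] scaleC_add_left
      Henstock_Kurzweil_Integration.integral_add)

lemma smoothed_orbit_zero: "smoothed_orbit T (\<lambda>\<xi>. 0) u s = 0"
  by (simp add: smoothed_orbit_def orbit_integral_def fourier_def scaleC.zero_left)

lemma smoothed_orbit_sum:
  assumes "\<And>i. i \<in> A \<Longrightarrow> \<phi> i \<in> test_functions UNIV"
  shows "smoothed_orbit T (\<lambda>\<xi>. \<Sum>i\<in>A. \<phi> i \<xi>) u s = (\<Sum>i\<in>A. smoothed_orbit T (\<phi> i) u s)"
  using assms
  by (induction A rule: infinite_finite_induct)
    (simp_all add: smoothed_orbit_zero smoothed_orbit_add test_function_sum)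

lemma orbit_integral_scale_kernel:
  assumes "integral_kernel k"
  shows "orbit_integral T (\<lambda>t. c * k t) u = c *\<^sub>C orbit_integral T k u"
  using integral_linear[OF orbit_integrable[OF assms] scaleC.bounded_linear_right[of c], of u]
  by (simp add: orbit_integral_def o_def scaleC_scaleC)

text \<open>The bound from Peetre's inequality grows with \<open>s\<close>, so it is used on bounded intervals only.\<close>

lemma continuous_on_smoothed_orbit:
  assumes "\<phi> \<in> test_functions UNIV"
  shows "continuous_on UNIV (smoothed_orbit T \<phi> u)"
proof -
  obtain C where C: "C \<ge> 0" "\<And>t. cmod (fourier \<phi> t) \<le> C * (1 / (1 + t^2))"
    using fourier_decay_weak[OF assms] by metis
  have "isCont (smoothed_orbit T \<phi> u) r" for r
  proof -
    let ?S = "{r - 1..r + 1}" and ?a = "\<lambda>s::real. C * (2 * (1 + s^2))"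
    let ?b = "\<lambda>t. 1 / (1 + t^2) * (M * norm u)"
    have ca: "continuous_on ?S ?a" by (intro continuous_intros)
    then obtain A where A: "\<And>s. s \<in> ?S \<Longrightarrow> ?a s \<le> A"
      using continuous_attains_sup[of ?S ?a] by fastforce
    have "continuous_on ?S (\<lambda>s. integral {0..} (\<lambda>t. fourier \<phi> (t - s) *\<^sub>C T t u))"
    proof (rule continuous_on_section_integral[where a = ?a and b = ?b and A = A])
      show "continuous_on (?S \<times> {0..}) (\<lambda>(s, t). fourier \<phi> (t - s) *\<^sub>C T t u)"
        unfolding case_prod_unfold
        by (intro continuous_intros continuous_on_fourier_compose[OF assms]
            continuous_on_compose2[OF orbit_continuous_on[of "{0..}"]]) auto
      show "norm (fourier \<phi> (t - s) *\<^sub>C T t u) \<le> ?a s * ?b t" if "t \<in> {0..}" for s t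
      proof -
        have "cmod (fourier \<phi> (t - s)) \<le> C * (2 * (1 + s^2) * (1 / (1 + t^2)))"
          using C(2)[of "t - s"] mult_left_mono[OF peetre_cauchy_kernel[of t s] C(1)] by linarith
        moreover have "norm (T t u) \<le> M * norm u" using that by (intro norm_T_le) auto
        ultimately have "cmod (fourier \<phi> (t - s)) * norm (T t u) \<le> C * (2 * (1 + s^2) * (1 / (1 + t^2))) * (M * norm u)"
          using C(1) by (intro mult_mono) auto
        then show ?thesis by (simp add: mult_ac)
      qed
      show "?a integrable_on ?S" by (rule integrable_continuous_real[OF ca])
      show "?b integrable_on {0..}" by (intro integrable_on_mult_left cauchy_kernel_integrable_on) auto
    qed (use A C(1) M_nonneg in auto)
    then have "continuous_on ?S (smoothed_orbit T \<phi> u)"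
      by (simp add: smoothed_orbit_def[abs_def] orbit_integral_def)
    then show ?thesis by (rule continuous_on_interior) simp
  qed
  then show ?thesis by (simp add: continuous_on_eq_continuous_at)
qed

text \<open>The orbit lives on \<open>t \<ge> 0\<close>, where \<open>fourier \<phi> (t - s)\<close> is small if \<open>s\<close> is very negative.\<close>

lemma smoothed_orbit_at_bot:
  assumes "\<phi> \<in> test_functions UNIV"
  shows "(smoothed_orbit T \<phi> u \<longlongrightarrow> 0) at_bot"
proof -
  obtain C where C: "C \<ge> 0" "\<And>t. cmod (fourier \<phi> t) \<le> C * (1 / (1 + t^2)^2)"
    using fourier_decay[OF assms] by metis
  have S: "closed {0::real..}" "is_interval {0::real..}" by auto
  let ?K = "C * (M * norm u) * pi"
  have le: "norm (smoothed_orbit T \<phi> u s) \<le> 1 / (1 + s^2) * ?K" if s: "s \<le> 0" for s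
  proof -
    let ?c = "1 / (1 + s^2) * (C * (M * norm u))"
    have "norm (smoothed_orbit T \<phi> u s) \<le> integral {0..} (\<lambda>t. ?c * (1 / (1 + (t - s)^2)))"
      unfolding smoothed_orbit_def orbit_integral_def
    proof (rule integral_norm_bound_integral[OF orbit_integrable[OF integral_kernel_fourier[OF assms]]
          integrable_on_mult_right[OF cauchy_kernel_shift(1)[OF S(1)]]])
      fix t :: real assume t: "t \<in> {0..}"
      have p: "1 + s^2 > 0" "1 + (t - s)^2 > 0" by (simp_all add: add_pos_nonneg)
      have "\<bar>s\<bar> \<le> \<bar>t - s\<bar>" using s t by auto
      then have "s^2 \<le> (t - s)^2" by (simp add: abs_le_square_iff)
      then have "1 / (1 + (t - s)^2) \<le> 1 / (1 + s^2)" using p by (intro divide_left_mono) auto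
      then have "1 / (1 + (t - s)^2) * (1 / (1 + (t - s)^2)) \<le> 1 / (1 + s^2) * (1 / (1 + (t - s)^2))"
        using p by (intro mult_right_mono) auto
      then have "1 / (1 + (t - s)^2)^2 \<le> 1 / (1 + s^2) * (1 / (1 + (t - s)^2))"
        by (simp add: power2_eq_square[of "1 + _"])
      then have "cmod (fourier \<phi> (t - s)) \<le> C * (1 / (1 + s^2) * (1 / (1 + (t - s)^2)))"
        using C(2)[of "t - s"] mult_left_mono[OF _ C(1)] by (meson order_trans)
      moreover have "norm (T t u) \<le> M * norm u" using t by (intro norm_T_le) auto
      ultimately have "cmod (fourier \<phi> (t - s)) * norm (T t u)
          \<le> C * (1 / (1 + s^2) * (1 / (1 + (t - s)^2))) * (M * norm u)"
        using C(1) by (intro mult_mono) auto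
      then show "norm (fourier \<phi> (t - s) *\<^sub>C T t u) \<le> ?c * (1 / (1 + (t - s)^2))"
        by (simp add: mult_ac)
    qed
    also have "\<dots> \<le> ?c * pi"
      using cauchy_kernel_shift(2)[OF S(1), of s] C(1) M_nonneg
      by (simp only: integral_mult_right) (intro mult_left_mono, auto)
    finally show ?thesis by (simp add: mult_ac)
  qed
  have "((\<lambda>s. 1 / (1 + s^2) * ?K) \<longlongrightarrow> 0 * ?K) at_bot"
    by (intro tendsto_mult tendsto_const) real_asymp
  then have lim: "((\<lambda>s. 1 / (1 + s^2) * ?K) \<longlongrightarrow> 0) at_bot" by simp
  show ?thesis
    by (rule Lim_null_comparison[OF eventually_at_bot_linorderI[of 0] lim]) (rule le)
qed

text \<open>As a distribution, the Fourier transform of the smoothed orbit is that of the orbit multiplied by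
  \<open>2\<pi> \<phi>\<close>.\<close>

lemma fourier_pairing_smoothed_orbit:
  assumes "\<phi> \<in> test_functions UNIV" "\<theta> \<in> test_functions UNIV"
  shows "integral UNIV (\<lambda>s. fourier \<theta> s *\<^sub>C smoothed_orbit T \<phi> u s)
    = (2 * of_real pi) *\<^sub>C orbit_integral T (fourier (\<lambda>\<xi>. \<phi> \<xi> * \<theta> \<xi>)) u"
proof -
  obtain C where C: "C \<ge> 0" "\<And>t. cmod (fourier \<theta> t) \<le> C * (1 / (1 + t^2)^2)"
    using fourier_decay[OF assms(2)] by metis
  obtain C' where C': "C' \<ge> 0" "\<And>t. cmod (fourier \<phi> t) \<le> C' * (1 / (1 + t^2))"
    using fourier_decay_weak[OF assms(1)] by metis
  have S: "closed {0::real..}" "is_interval {0::real..}" by auto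
  let ?v = "\<lambda>s t. (fourier \<theta> s * fourier \<phi> (t - s)) *\<^sub>C T t u"
  have k1: "1 / (1 + s^2) \<le> 1" for s :: real by (simp add: divide_le_eq_1 add_pos_nonneg)
  have "integral UNIV (\<lambda>s. integral {0..} (\<lambda>t. ?v s t)) = integral {0..} (\<lambda>t. integral UNIV (\<lambda>s. ?v s t))"
  proof (rule Fubini_dominated[OF _ _ S, where a = "\<lambda>s. (2 * C * C') * (1 / (1 + s^2))" and A = "2 * C * C'"
        and b = "\<lambda>t. 1 / (1 + t^2) * (M * norm u)" and B = "M * norm u"])
    show "continuous_on (UNIV \<times> {0..}) (\<lambda>(s, t). ?v s t)"
      unfolding case_prod_unfold
      by (intro continuous_intros continuous_on_fourier_compose[OF assms(1)]
          continuous_on_fourier_compose[OF assms(2)]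
          continuous_on_compose2[OF orbit_continuous_on[of "{0..}"]]) auto
    show "norm (?v s t) \<le> (2 * C * C') * (1 / (1 + s^2)) * (1 / (1 + t^2) * (M * norm u))" if "t \<in> {0..}" for s t
    proof -
      have p: "1 + s^2 > 0" by (simp add: add_pos_nonneg)
      have "cmod (fourier \<phi> (t - s)) \<le> C' * (2 * (1 + s^2) * (1 / (1 + t^2)))"
        using C'(2)[of "t - s"] mult_left_mono[OF peetre_cauchy_kernel[of t s] C'(1)] by linarith
      then have "cmod (fourier \<theta> s) * cmod (fourier \<phi> (t - s)) \<le> (C * (1 / (1 + s^2)^2)) * (C' * (2 * (1 + s^2) * (1 / (1 + t^2))))"
        using C C'(1) by (intro mult_mono) auto
      also have "\<dots> = (2 * C * C') * (1 / (1 + s^2)) * (1 / (1 + t^2))"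
      proof -
        have "(C * (1 / p^2)) * (C' * (2 * p * q)) = (2 * C * C') * (1 / p) * q" if "p > 0" for p q :: real
          using that by (simp add: power2_eq_square)
        from this[OF p] show ?thesis .
      qed
      finally have le: "cmod (fourier \<theta> s) * cmod (fourier \<phi> (t - s))
          \<le> (2 * C * C') * (1 / (1 + s^2)) * (1 / (1 + t^2))" .
      have "cmod (fourier \<theta> s) * cmod (fourier \<phi> (t - s)) * norm (T t u)
          \<le> (2 * C * C') * (1 / (1 + s^2)) * (1 / (1 + t^2)) * (M * norm u)"
        by (rule mult_mono[OF le norm_T_le]) (use C(1) C'(1) that in auto)
      then show ?thesis by (simp add: norm_mult mult_ac)
    qed
    show "(\<lambda>s. (2 * C * C') * (1 / (1 + s^2))) integrable_on UNIV"
      by (intro integrable_on_mult_right cauchy_kernel_integrable_on) auto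
    show "(\<lambda>t. 1 / (1 + t^2) * (M * norm u)) integrable_on {0..}"
      by (intro integrable_on_mult_left cauchy_kernel_integrable_on) auto
    show "(2 * C * C') * (1 / (1 + s^2)) \<le> 2 * C * C'" for s
      using C(1) C'(1) by (intro mult_left_le k1) auto
    show "1 / (1 + t^2) * (M * norm u) \<le> M * norm u" for t
      using M_nonneg by (intro mult_left_le_one_le k1) auto
  qed (use C(1) C'(1) M_nonneg in auto)
  moreover have "integral {0..} (\<lambda>t. ?v s t) = fourier \<theta> s *\<^sub>C smoothed_orbit T \<phi> u s" for s
    using orbit_integral_scale_kernel[OF integral_kernel_fourier[OF assms(1)], of "fourier \<theta> s" s u]
    by (simp add: smoothed_orbit_def orbit_integral_def)
  moreover have "integral UNIV (\<lambda>s. ?v s t) = (2 * of_real pi * fourier (\<lambda>\<xi>. \<phi> \<xi> * \<theta> \<xi>) t) *\<^sub>C T t u" for t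
  proof -
    have "(\<lambda>s. fourier \<theta> s * fourier \<phi> (t - s)) integrable_on UNIV"
    proof (rule dominated_integrable_on)
      show "continuous_on UNIV (\<lambda>s. fourier \<theta> s * fourier \<phi> (t - s))"
        by (intro continuous_intros continuous_on_fourier_compose[OF assms(1)]
          continuous_on_fourier[OF assms(2)])
      show "(\<lambda>s. cmod (fourier \<theta> s) * C') integrable_on UNIV"
        by (intro integrable_on_mult_left norm_integrable_on(1) fourier_integrable assms) simp
      have "cmod (fourier \<phi> s) \<le> C'" for s
        using C'(2)[of s] mult_left_le[OF k1[of s] C'(1)] by linarith
      then show "norm (fourier \<theta> s * fourier \<phi> (t - s)) \<le> cmod (fourier \<theta> s) * C'" for s
        by (simp add: norm_mult mult_left_mono)
    qed auto
    from integral_linear[OF this scaleC.bounded_linear_left[of "T t u"]] show ?thesis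
      by (simp add: o_def integral_fourier_convolution[OF assms])
  qed
  moreover have "(\<lambda>\<xi>. \<phi> \<xi> * \<theta> \<xi>) \<in> test_functions UNIV"
    by (rule test_function_mult(2)[OF assms(1) test_function_smooth[OF assms(2)]])
  then have "integral_kernel (fourier (\<lambda>\<xi>. \<phi> \<xi> * \<theta> \<xi>))" using integral_kernel_fourier[of _ 0] by simp
  then have "integral {0..} (\<lambda>t. (2 * of_real pi * fourier (\<lambda>\<xi>. \<phi> \<xi> * \<theta> \<xi>) t) *\<^sub>C T t u)
      = (2 * of_real pi) *\<^sub>C orbit_integral T (fourier (\<lambda>\<xi>. \<phi> \<xi> * \<theta> \<xi>)) u"
    using orbit_integral_scale_kernel[of "fourier (\<lambda>\<xi>. \<phi> \<xi> * \<theta> \<xi>)" "2 * of_real pi" u]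
    by (simp add: orbit_integral_def)
  ultimately show ?thesis by simp
qed

end

section \<open>The singular support of the boundary resolvent\<close>

lemma seminorm_ball_openin:
  assumes "\<phi> \<in> V" "r > 0"
  shows "openin (seminorm_topology V p) {\<psi> \<in> V. p k (\<lambda>t. \<psi> t - \<phi> t) < r}"
  unfolding seminorm_topology_def
  by (rule topology_generated_by_Basis) (use assms in blast)

lemma topspace_test_topology: "topspace (test_topology K) \<subseteq> test_functions K"
  by (auto simp: test_topology_def seminorm_topology_def topology_generated_by_topspace)

context bounded_C0_semigroup
begin

text \<open>Two derivatives control the \<open>L\<^sup>1\<close> norm of the transform of \<open>\<phi>\<close>, and thus the pairing with the
  bounded orbit; this is what continuity of the distribution rests on.\<close>

lemma norm_boundary_resolvent_le:
  assumes \<phi>: "\<phi> \<in> test_functions K" and R: "K \<subseteq> {-R..R}" "R \<ge> 0"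
  shows "norm (boundary_resolvent (generator T) u \<phi>) \<le> 2 * R * pi * (M * norm u) *
    ((SUP t. cmod (iterated_deriv 0 \<phi> t)) + (SUP t. cmod (iterated_deriv 2 \<phi> t)))"
proof -
  let ?p = "\<lambda>k. SUP t. cmod (iterated_deriv k \<phi> t)"
  have \<phi>': "\<phi> \<in> test_functions UNIV" by (rule test_functions_UNIV[OF \<phi>])
  have le_p: "cmod (iterated_deriv k \<phi> t) \<le> ?p k" for k t
  proof -
    obtain B where "\<And>t. cmod (iterated_deriv k \<phi> t) \<le> B"
      using test_function_norm_bound[OF test_function_iterated_deriv[OF \<phi>, of k]] by metis
    then show ?thesis by (intro cSUP_upper bdd_aboveI2) auto
  qed
  let ?h = "\<lambda>t. \<phi> t - iterated_deriv 2 \<phi> t"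
  have h: "?h \<in> test_functions UNIV" by (intro test_function_diff \<phi>' test_function_iterated_deriv)
  have sup: "?h t = 0" if "t \<notin> {-R..R}" for t
  proof -
    have "fun_support \<phi> \<subseteq> {-R..R}" using \<phi> R(1) by (auto simp: test_functions_def)
    then have "t \<notin> fun_support \<phi>" using that by blast
    then show ?thesis
      using test_function_support iterated_deriv_eq_0 test_function_smooth[OF \<phi>] by simp
  qed
  have "(\<integral>t. cmod (?h t) \<partial>lborel) \<le> (\<integral>t. indicator {-R..R} t *\<^sub>R (?p 0 + ?p 2) \<partial>lborel)"
  proof (rule integral_mono)
    show "integrable lborel (\<lambda>t. cmod (?h t))" by (rule integrable_norm[OF test_function_integrable[OF h]])
    show "integrable lborel (\<lambda>t. indicator {-R..R} t *\<^sub>R (?p 0 + ?p 2))"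
      by (intro borel_integrable_compact) auto
    show "cmod (?h t) \<le> indicator {-R..R} t *\<^sub>R (?p 0 + ?p 2)" for t
      using sup[of t] norm_triangle_ineq4[of "\<phi> t" "iterated_deriv 2 \<phi> t"] le_p[of 0 t] le_p[of 2 t]
      by (cases "t \<in> {-R..R}") auto
  qed
  also have "\<dots> = 2 * R * (?p 0 + ?p 2)" using R(2) by simp
  finally have hle: "(\<integral>t. cmod (?h t) \<partial>lborel) \<le> 2 * R * (?p 0 + ?p 2)" .
  have S: "closed {0::real..}" "is_interval {0::real..}" by auto
  have "integral {0..} (\<lambda>t. cmod (fourier \<phi> t)) \<le> integral {0..} (\<lambda>t. (\<integral>t. cmod (?h t) \<partial>lborel) * (1 / (1 + (t - 0)^2)))"
    by (intro integral_le norm_integrable_on(1) fourier_integrable \<phi>' integrable_on_mult_right cauchy_kernel_shift(1) S(1))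
      (use norm_fourier_le_cauchy_kernel[OF \<phi>'] in auto)
  also have "\<dots> \<le> (\<integral>t. cmod (?h t) \<partial>lborel) * pi"
    using cauchy_kernel_shift(2)[OF S(1), of 0]
    by (simp only: integral_mult_right) (intro mult_left_mono, auto)
  also have "\<dots> \<le> 2 * R * (?p 0 + ?p 2) * pi" by (rule mult_right_mono[OF hle]) simp
  finally have "integral {0..} (\<lambda>t. cmod (fourier \<phi> t)) * (M * norm u) \<le> 2 * R * (?p 0 + ?p 2) * pi * (M * norm u)"
    by (rule mult_right_mono) (use M_nonneg in simp)
  moreover have "norm (orbit_integral T (fourier \<phi>) u) \<le> integral {0..} (\<lambda>t. cmod (fourier \<phi> t)) * (M * norm u)"
    using norm_orbit_integral_le[OF integral_kernel_fourier[OF \<phi>', of 0]] by simp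
  ultimately show ?thesis
    unfolding boundary_resolvent_eq[OF \<phi>'] by (simp add: mult_ac)
qed

lemma boundary_resolvent_add:
  assumes "\<phi> \<in> test_functions I" "\<psi> \<in> test_functions I"
  shows "boundary_resolvent (generator T) u (\<lambda>t. \<phi> t + \<psi> t) =
    boundary_resolvent (generator T) u \<phi> + boundary_resolvent (generator T) u \<psi>"
  using smoothed_orbit_add[OF assms[THEN test_functions_UNIV], of u 0]
  by (simp add: boundary_resolvent_eq[OF assms(1)[THEN test_functions_UNIV]]
      boundary_resolvent_eq[OF assms(2)[THEN test_functions_UNIV]]
      boundary_resolvent_eq[OF test_function_add[OF assms, THEN test_functions_UNIV]] smoothed_orbit_def)

lemma boundary_resolvent_cmult:
  assumes "\<phi> \<in> test_functions I"
  shows "boundary_resolvent (generator T) u (\<lambda>t. c * \<phi> t) = c *\<^sub>C boundary_resolvent (generator T) u \<phi>"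
proof -
  note \<phi> = test_functions_UNIV[OF assms]
  have "fourier (\<lambda>t. c * \<phi> t) = (\<lambda>t. c * fourier \<phi> t)" by (rule ext) (rule fourier_cmult)
  then show ?thesis
    using orbit_integral_scale_kernel[OF integral_kernel_fourier[OF \<phi>, of 0], of c u]
    by (simp add: boundary_resolvent_eq[OF \<phi>] boundary_resolvent_eq[OF test_function_cmult[OF \<phi>]])
qed

lemma boundary_resolvent_diff:
  assumes "\<phi> \<in> test_functions I" "\<psi> \<in> test_functions I"
  shows "boundary_resolvent (generator T) u (\<lambda>t. \<phi> t - \<psi> t) =
    boundary_resolvent (generator T) u \<phi> - boundary_resolvent (generator T) u \<psi>"
  using boundary_resolvent_add[OF assms(1) test_function_cmult[OF assms(2), of "-1"], of u]
    boundary_resolvent_cmult[OF assms(2), of u "-1"]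
  by (simp add: scaleC.minus_left)

lemma boundary_resolvent_distribution: "distribution_on I (boundary_resolvent (generator T) u)"
  unfolding distribution_on_def
proof (intro conjI ballI allI impI)
  fix K assume K: "compact K \<and> K \<subseteq> I"
  let ?f = "boundary_resolvent (generator T) u"
  obtain R where R: "K \<subseteq> {-R..R}" "R \<ge> 0"
  proof -
    obtain B where "\<forall>x\<in>K. norm x \<le> B" using K compact_imp_bounded bounded_iff by metis
    then show ?thesis by (intro that[of "\<bar>B\<bar>"]) force+
  qed
  define c where "c = 2 * R * pi * (M * norm u)"
  have c: "c \<ge> 0" using R(2) M_nonneg by (simp add: c_def)
  let ?p = "\<lambda>k \<phi>. SUP t. cmod (iterated_deriv k \<phi> t)"
  show "continuous_map (test_topology K) euclidean ?f"
    unfolding continuous_map_def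
  proof (intro conjI allI impI)
    fix U :: "'a set" assume "openin euclidean U"
    then have U: "open U" by simp
    let ?W = "{\<phi> \<in> topspace (test_topology K). ?f \<phi> \<in> U}"
    show "openin (test_topology K) ?W"
      unfolding openin_subopen[of _ ?W]
    proof
      fix \<phi> assume \<phi>W: "\<phi> \<in> ?W"
      then have \<phi>: "\<phi> \<in> test_functions K" using topspace_test_topology by blast
      obtain e where e: "e > 0" "ball (?f \<phi>) e \<subseteq> U" using U \<phi>W open_contains_ball by (metis (mono_tags, lifting) mem_Collect_eq)
      define r where "r = e / (c + 1) / 2"
      have r: "r > 0" using e(1) c by (simp add: r_def)
      let ?B = "\<lambda>k. {\<psi> \<in> test_functions K. ?p k (\<lambda>t. \<psi> t - \<phi> t) < r}"
      have op: "openin (test_topology K) (?B 0 \<inter> ?B 2)"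
        unfolding test_topology_def by (intro openin_Int seminorm_ball_openin \<phi> r)
      have "?p k (\<lambda>t. \<phi> t - \<phi> t) = 0" for k
        using iterated_deriv_eq_0[of _ "\<lambda>t. 0" k] smooth_fun_zero by (simp add: fun_support_def)
      then have mem: "\<phi> \<in> ?B 0 \<inter> ?B 2" using \<phi> r by simp
      have "?f \<psi> \<in> U" if "\<psi> \<in> ?B 0 \<inter> ?B 2" for \<psi>
      proof -
        have \<psi>: "\<psi> \<in> test_functions K" "?p 0 (\<lambda>t. \<psi> t - \<phi> t) < r" "?p 2 (\<lambda>t. \<psi> t - \<phi> t) < r" using that by auto
        have "norm (?f \<psi> - ?f \<phi>) \<le> c * (?p 0 (\<lambda>t. \<psi> t - \<phi> t) + ?p 2 (\<lambda>t. \<psi> t - \<phi> t))"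
          using norm_boundary_resolvent_le[OF test_function_diff[OF \<psi>(1) \<phi>] R, of u]
          unfolding boundary_resolvent_diff[OF \<psi>(1) \<phi>] c_def .
        also have "\<dots> \<le> c * (r + r)" using \<psi>(2,3) c by (intro mult_left_mono) auto
        also have "\<dots> < (c + 1) * (r + r)" using r by simp
        also have "\<dots> = (c + 1) * (e / (c + 1))" by (simp only: r_def field_sum_of_halves)
        also have "\<dots> = e" using c by simp
        finally show ?thesis using e(2) by (auto simp: dist_norm norm_minus_commute)
      qed
      moreover have "?B 0 \<inter> ?B 2 \<subseteq> topspace (test_topology K)" using op by (rule openin_subset)
      ultimately have "?B 0 \<inter> ?B 2 \<subseteq> ?W" by blast
      then show "\<exists>V. openin (test_topology K) V \<and> \<phi> \<in> V \<and> V \<subseteq> ?W" using op mem by blast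
    qed
  qed simp
qed (use boundary_resolvent_add boundary_resolvent_cmult in auto)

lemma smoothed_orbit_eq_boundary_resolvent:
  assumes "\<phi> \<in> test_functions UNIV"
  shows "smoothed_orbit T \<phi> u s =
    boundary_resolvent (generator T) u (\<lambda>\<xi>. exp (\<i> * of_real s * of_real \<xi>) * \<phi> \<xi>)"
proof -
  have "(\<lambda>\<xi>. exp (\<i> * of_real s * of_real \<xi>) * \<phi> \<xi>) \<in> test_functions UNIV"
    by (rule test_function_mult(1)[OF assms smooth_fun_exp])
  from boundary_resolvent_eq[OF this, of u] show ?thesis
    by (simp add: smoothed_orbit_def fourier_modulation[abs_def])
qed

text \<open>Near \<open>\<xi>\<close> the boundary resolvent is the transform of a \<open>C\<^sub>0\<close> function \<open>g\<close>. If \<open>\<phi>\<close> is supported there,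
  pairing with \<open>e\<^sup>i\<^sup>s\<^sup>\<xi> \<phi>(\<xi>)\<close> shows that the orbit and \<open>g\<close> have the same smoothing by \<open>\<phi>\<close>, and that of
  \<open>g\<close> vanishes at infinity.\<close>

lemma smoothed_orbit_tendsto_0_off_sing_supp:
  assumes "\<xi> \<notin> sing_supp_PF (boundary_resolvent (generator T) u)"
  obtains V where "open V" "\<xi> \<in> V"
    "\<And>\<phi>. \<phi> \<in> test_functions V \<Longrightarrow> (smoothed_orbit T \<phi> u \<longlongrightarrow> 0) at_top"
proof -
  let ?f = "boundary_resolvent (generator T) u"
  obtain U where "\<xi> \<in> U" "local_pseudofunction U ?f"
    using assms by (auto simp: sing_supp_PF_def)
  then obtain V h where V: "open V" "\<xi> \<in> V" and h: "h \<in> pseudofunctions" "\<And>\<phi>. \<phi> \<in> test_functions V \<Longrightarrow> ?f \<phi> = h \<phi>"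
    unfolding local_pseudofunction_def by blast
  obtain g :: "real \<Rightarrow> 'a" where g: "g \<in> C0_functions" "h = fourier_distribution (function_distribution g)"
    using h(1) by (auto simp: pseudofunctions_def)
  have cg: "continuous_on UNIV g" and lim: "(g \<longlongrightarrow> 0) at_infinity" using g(1) by (auto simp: C0_functions_def)
  have far: "\<exists>r. \<forall>t. \<bar>t\<bar> \<ge> r \<longrightarrow> norm (g t) \<le> e" if "e > 0" for e
  proof -
    obtain r where "\<forall>t. r \<le> norm t \<longrightarrow> dist (g t) 0 < e"
      using tendstoD[OF lim \<open>e > 0\<close>] unfolding eventually_at_infinity by blast
    then have "\<forall>t. \<bar>t\<bar> \<ge> r \<longrightarrow> norm (g t) \<le> e" by (simp add: less_imp_le)
    then show ?thesis by blast
  qed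
  obtain B where B: "\<And>t. norm (g t) \<le> B"
  proof -
    obtain r where r: "\<And>t. \<bar>t\<bar> \<ge> r \<Longrightarrow> norm (g t) \<le> 1" using far[of 1] by auto
    have "compact (g ` {-r..r})" by (intro compact_continuous_image continuous_on_subset[OF cg]) auto
    then obtain B where B: "\<And>y. y \<in> g ` {-r..r} \<Longrightarrow> norm y \<le> B" using compact_imp_bounded bounded_iff by metis
    have "norm (g t) \<le> max 1 B" for t
    proof (cases "\<bar>t\<bar> \<ge> r")
      case False
      then have "g t \<in> g ` {-r..r}" by (intro imageI) auto
      then show ?thesis using B[of "g t"] by simp
    next
      case True then show ?thesis using r[OF True] by simp
    qed
    then show ?thesis by (rule that)
  qed
  have "(smoothed_orbit T \<phi> u \<longlongrightarrow> 0) at_top" if \<phi>: "\<phi> \<in> test_functions V" for \<phi>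
  proof -
    note \<phi>' = test_functions_UNIV[OF \<phi>]
    have "smoothed_orbit T \<phi> u = (\<lambda>s. integral UNIV (\<lambda>t. fourier \<phi> (t - s) *\<^sub>C g t))"
    proof
      fix s
      have "(\<lambda>\<xi>. exp (\<i> * of_real s * of_real \<xi>) * \<phi> \<xi>) \<in> test_functions V"
        by (rule test_function_mult(1)[OF \<phi> smooth_fun_exp])
      then show "smoothed_orbit T \<phi> u s = integral UNIV (\<lambda>t. fourier \<phi> (t - s) *\<^sub>C g t)"
        unfolding smoothed_orbit_eq_boundary_resolvent[OF \<phi>']
        by (simp add: h(2) g(2) fourier_distribution_def function_distribution_def fourier_modulation)
    qed
    moreover have "((\<lambda>s. integral UNIV (\<lambda>t. fourier \<phi> (t - s) *\<^sub>C g t)) \<longlongrightarrow> 0) at_top"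
    proof (rule fourier_average_tendsto_0[OF \<phi>' _ _ cg B])
      fix e :: real assume "e > 0"
      then obtain r where "\<forall>t. \<bar>t\<bar> \<ge> r \<longrightarrow> norm (g t) \<le> e" using far by blast
      then show "\<exists>r. \<forall>t\<in>UNIV. t \<ge> r \<longrightarrow> norm (g t) \<le> e" by (intro exI[of _ "\<bar>r\<bar>"]) auto
    qed auto
    ultimately show ?thesis by simp
  qed
  then show ?thesis using that V by blast
qed

text \<open>The smoothed orbit, divided by \<open>2\<pi>\<close>, is itself the \<open>C\<^sub>0\<close> function whose transform is the boundary
  resolvent on \<open>U\<close>, because multiplication by \<open>\<phi>\<close> does nothing there.\<close>

lemma not_in_sing_suppI:
  assumes \<phi>: "\<phi> \<in> test_functions UNIV" and U: "open U" "\<xi> \<in> U" "\<And>\<eta>. \<eta> \<in> U \<Longrightarrow> \<phi> \<eta> = 1"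
    and lim: "(smoothed_orbit T \<phi> u \<longlongrightarrow> 0) at_top"
  shows "\<xi> \<notin> sing_supp_PF (boundary_resolvent (generator T) u)"
proof -
  let ?f = "boundary_resolvent (generator T) u"
  define g where "g = (\<lambda>s. (1 / (2 * of_real pi)) *\<^sub>C smoothed_orbit T \<phi> u s)"
  have "(smoothed_orbit T \<phi> u \<longlongrightarrow> 0) at_infinity"
    unfolding at_infinity_eq_at_top_bot by (rule filterlim_sup[OF lim smoothed_orbit_at_bot[OF \<phi>]])
  from scaleC.tendsto[OF tendsto_const this] have "g \<in> C0_functions"
    unfolding C0_functions_def g_def
    by (auto intro!: continuous_intros continuous_on_smoothed_orbit[OF \<phi>] simp: scaleC.zero_right)
  then have ps: "fourier_distribution (function_distribution g) \<in> pseudofunctions"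
    by (auto simp: pseudofunctions_def)
  have eq: "?f \<theta> = fourier_distribution (function_distribution g) \<theta>" if \<theta>: "\<theta> \<in> test_functions U" for \<theta>
  proof -
    note \<theta>' = test_functions_UNIV[OF \<theta>]
    have p: "(\<lambda>\<xi>. \<phi> \<xi> * \<theta> \<xi>) = \<theta>"
    proof
      fix \<eta> show "\<phi> \<eta> * \<theta> \<eta> = \<theta> \<eta>"
        using U(3)[of \<eta>] test_function_support[of \<eta> \<theta>] \<theta> by (cases "\<eta> \<in> U") (auto simp: test_functions_def)
    qed
    have i: "(\<lambda>s. fourier \<theta> s *\<^sub>C smoothed_orbit T \<phi> u s) integrable_on UNIV"
    proof (rule dominated_integrable_on)
      show "continuous_on UNIV (\<lambda>s. fourier \<theta> s *\<^sub>C smoothed_orbit T \<phi> u s)"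
        by (intro continuous_intros continuous_on_fourier[OF \<theta>'] continuous_on_smoothed_orbit[OF \<phi>])
      show "norm (fourier \<theta> s *\<^sub>C smoothed_orbit T \<phi> u s) \<le> cmod (fourier \<theta> s) * (fourier_norm \<phi> * (M * norm u))" for s
        using norm_smoothed_orbit_le[OF \<phi>, of u s] by (simp add: mult_left_mono)
      show "(\<lambda>s. cmod (fourier \<theta> s) * (fourier_norm \<phi> * (M * norm u))) integrable_on UNIV"
        by (intro integrable_on_mult_left norm_integrable_on(1) fourier_integrable \<theta>') simp
    qed auto
    have "fourier_distribution (function_distribution g) \<theta>
        = integral UNIV (\<lambda>s. (1 / (2 * of_real pi)) *\<^sub>C (fourier \<theta> s *\<^sub>C smoothed_orbit T \<phi> u s))"
      by (simp add: fourier_distribution_def function_distribution_def g_def scaleC_scaleC mult.commute)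
    also have "\<dots> = (1 / (2 * of_real pi)) *\<^sub>C integral UNIV (\<lambda>s. fourier \<theta> s *\<^sub>C smoothed_orbit T \<phi> u s)"
      using integral_linear[OF i scaleC.bounded_linear_right] by (simp add: o_def)
    also have "\<dots> = orbit_integral T (fourier \<theta>) u"
      unfolding fourier_pairing_smoothed_orbit[OF \<phi> \<theta>'] p scaleC_scaleC by simp
    finally show ?thesis by (simp add: boundary_resolvent_eq[OF \<theta>'])
  qed
  have "local_pseudofunction U ?f"
    unfolding local_pseudofunction_def
    using boundary_resolvent_distribution ps eq U(1) by blast
  then show ?thesis using U(1,2) by (auto simp: sing_supp_PF_def)
qed

text \<open>A test function whose support avoids the singular support is a finite sum of test functions
  supported in intervals so short that each lies in an open set all of whose test functions give
  smoothed orbits tending to \<open>0\<close>.\<close>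

lemma smoothed_orbit_tendsto_0:
  assumes \<phi>: "\<phi> \<in> test_functions UNIV"
    and disj: "fun_support \<phi> \<inter> sing_supp_PF (boundary_resolvent (generator T) u) = {}"
  shows "(smoothed_orbit T \<phi> u \<longlongrightarrow> 0) at_top"
proof -
  let ?good = "{V. open V \<and> (\<forall>\<psi>\<in>test_functions V. (smoothed_orbit T \<psi> u \<longlongrightarrow> 0) at_top)}"
  have comp: "compact (fun_support \<phi>)" using \<phi> by (simp add: test_functions_def)
  have "fun_support \<phi> \<subseteq> \<Union>?good"
  proof
    fix \<xi> assume "\<xi> \<in> fun_support \<phi>"
    then have "\<xi> \<notin> sing_supp_PF (boundary_resolvent (generator T) u)" using disj by blast
    then obtain V where "open V" "\<xi> \<in> V" "\<And>\<psi>. \<psi> \<in> test_functions V \<Longrightarrow> (smoothed_orbit T \<psi> u \<longlongrightarrow> 0) at_top"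
      using smoothed_orbit_tendsto_0_off_sing_supp by metis
    then show "\<xi> \<in> \<Union>?good" by blast
  qed
  moreover have "open V" if "V \<in> ?good" for V using that by blast
  ultimately obtain e where e: "e > 0" "\<And>\<xi>. \<xi> \<in> fun_support \<phi> \<Longrightarrow> \<exists>V\<in>?good. ball \<xi> e \<subseteq> V"
    by (rule Heine_Borel_lemma[OF comp]) blast+
  define d where "d = e / 3"
  have d: "d > 0" using e(1) by (simp add: d_def)
  obtain R where R: "R > 0" "\<And>t. \<bar>t\<bar> \<ge> R \<Longrightarrow> \<phi> t = 0" using test_function_bound[OF \<phi>] by blast
  obtain n where n: "R / d \<le> real n" using real_arch_simple by blast
  let ?\<phi> = "\<lambda>k t. partition_bump k (t / d) * \<phi> t"
  have sm: "smooth_fun (\<lambda>t. partition_bump k (t / d))" for k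
    using smooth_fun_affine[OF smooth_fun_partition_bump[of k], of "1 / d" 0] by simp
  have tf: "?\<phi> k \<in> test_functions UNIV" for k by (rule test_function_mult(1)[OF \<phi> sm])
  have "\<phi> = (\<lambda>t. \<Sum>k\<in>{- int n - 1..int n}. ?\<phi> k t)"
  proof
    fix t show "\<phi> t = (\<Sum>k\<in>{- int n - 1..int n}. ?\<phi> k t)"
    proof (cases "\<bar>t\<bar> \<ge> R")
      case False
      then have "\<bar>t / d\<bar> \<le> real n" using n d divide_right_mono[of "\<bar>t\<bar>" R d] by simp
      from sum_partition_bump[OF this] show ?thesis by (simp flip: sum_distrib_right)
    qed (simp add: R(2))
  qed
  then have "smoothed_orbit T \<phi> u = (\<lambda>s. \<Sum>k\<in>{- int n - 1..int n}. smoothed_orbit T (?\<phi> k) u s)"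
    using smoothed_orbit_sum[of "{- int n - 1..int n}" ?\<phi> u] tf by (auto simp: fun_eq_iff)
  moreover have "(smoothed_orbit T (?\<phi> k) u \<longlongrightarrow> 0) at_top" for k
  proof (cases "\<exists>\<xi>\<in>fun_support \<phi>. \<xi> \<in> {of_int k * d..(of_int k + 2) * d}")
    case True
    then obtain \<xi> where \<xi>: "\<xi> \<in> fun_support \<phi>" "\<xi> \<in> {of_int k * d..(of_int k + 2) * d}" by blast
    then obtain V where V: "V \<in> ?good" "ball \<xi> e \<subseteq> V" using e(2) by blast
    have "{of_int k * d..(of_int k + 2) * d} \<subseteq> ball \<xi> e"
      using \<xi>(2) d by (auto simp: dist_real_def d_def algebra_simps)
    moreover have "?\<phi> k t = 0" if "t \<notin> {of_int k * d..(of_int k + 2) * d}" for t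
      using that d partition_bump_eq_0[of "t / d" k] by (auto simp: field_simps)
    ultimately have "?\<phi> k \<in> test_functions V"
      using V(2) by (intro test_function_intro[of _ "{of_int k * d..(of_int k + 2) * d}"])
        (auto intro: smooth_fun_mult sm test_function_smooth[OF \<phi>])
    then show ?thesis using V(1) by blast
  next
    case False
    have "?\<phi> k t = 0" for t
    proof (cases "t \<in> fun_support \<phi>")
      case True
      with False have "t \<notin> {of_int k * d..(of_int k + 2) * d}" by blast
      then show ?thesis using d partition_bump_eq_0[of "t / d" k] by (auto simp: field_simps)
    qed (simp add: test_function_support)
    then have "?\<phi> k = (\<lambda>t. 0)" by (rule ext)
    moreover have "smoothed_orbit T (\<lambda>t. 0) u = (\<lambda>s. 0)" by (simp add: fun_eq_iff smoothed_orbit_zero)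
    ultimately show ?thesis by simp
  qed
  then have "((\<lambda>s. \<Sum>k\<in>{- int n - 1..int n}. smoothed_orbit T (?\<phi> k) u s) \<longlongrightarrow> (\<Sum>k\<in>{- int n - 1..int n}. 0)) at_top"
    by (intro tendsto_sum)
  ultimately show ?thesis by simp
qed

end

section \<open>Countable singular support and decay of the orbit\<close>

text \<open>Otherwise all the sets \<open>S - {a}\<close> would be dense and open in \<open>S\<close>, although their
  intersection is empty.\<close>

lemma countable_closed_has_isolated_point:
  fixes S :: "real set"
  assumes "closed S" "countable S" "S \<noteq> {}"
  obtains a r where "a \<in> S" "r > 0" "S \<inter> ball a r = {a}"
proof -
  have "\<exists>a\<in>S. a \<notin> closure (S - {a})"
  proof (rule ccontr)
    assume none: "\<not> ?thesis"
    let ?G = "(\<lambda>a. S - {a}) ` S"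
    have "S \<subseteq> closure (\<Inter>?G)"
    proof (rule Baire[OF assms(1)])
      show "countable ?G" using assms(2) by simp
      fix U assume "U \<in> ?G"
      then obtain a where a: "a \<in> S" "U = S - {a}" by blast
      have "U = S \<inter> (- {a})" using a by blast
      then have "openin (top_of_set S) U" by (metis openin_open_Int open_Compl closed_singleton)
      moreover have "S \<subseteq> closure U"
        using none a closure_subset[of "S - {a}"] by blast
      ultimately show "openin (top_of_set S) U \<and> S \<subseteq> closure U" by blast
    qed
    moreover have "\<Inter>?G = {}" using assms(3) by blast
    ultimately show False using assms(3) by simp
  qed
  then obtain a where a: "a \<in> S" "a \<notin> closure (S - {a})" by blast
  then obtain r where "r > 0" "ball a r \<subseteq> - closure (S - {a})"
    using open_contains_ball[of "- closure (S - {a})"] by (auto simp: open_Compl)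
  then have "S \<inter> ball a r = {a}" using a closure_subset[of "S - {a}"] by auto
  then show ?thesis using that[OF a(1) \<open>r > 0\<close>] by blast
qed

lemma closed_sing_supp_PF: "closed (sing_supp_PF f)"
  unfolding sing_supp_PF_def by (auto intro!: closed_Compl)

context bounded_C0_semigroup
begin

lemma orbit_tendsto_0_imp_smoothed:
  assumes "((\<lambda>t. T t u) \<longlongrightarrow> 0) at_top" "\<phi> \<in> test_functions UNIV"
  shows "(smoothed_orbit T \<phi> u \<longlongrightarrow> 0) at_top"
proof -
  have "((\<lambda>s. integral {0..} (\<lambda>t. fourier \<phi> (t - s) *\<^sub>C T t u)) \<longlongrightarrow> 0) at_top"
  proof (rule fourier_average_tendsto_0[OF assms(2), where B = "M * norm u"])
    fix e :: real assume "e > 0"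
    then obtain r where "\<And>t. t \<ge> r \<Longrightarrow> dist (T t u) 0 < e"
      using tendstoD[OF assms(1)] unfolding eventually_at_top_linorder by blast
    then show "\<exists>r. \<forall>t\<in>{0..}. t \<ge> r \<longrightarrow> norm (T t u) \<le> e" by (intro exI[of _ r]) (auto simp: less_imp_le)
  qed (auto intro: orbit_continuous_on norm_T_le)
  then show ?thesis by (simp add: smoothed_orbit_def[abs_def] orbit_integral_def)
qed

text \<open>The kernels \<open>fourier (\<lambda>\<xi>. plateau (d * \<xi>))\<close> form an approximate identity as \<open>d \<rightarrow> 0\<close>, and
  the orbit is uniformly continuous.\<close>

lemma smoothed_imp_orbit_tendsto_0:
  assumes "\<And>\<phi>. \<phi> \<in> test_functions UNIV \<Longrightarrow> (smoothed_orbit T \<phi> u \<longlongrightarrow> 0) at_top"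
  shows "((\<lambda>t. T t u) \<longlongrightarrow> 0) at_top"
proof (rule tendstoI)
  fix e :: real assume e: "e > 0"
  have plateau: "plateau \<in> test_functions UNIV"
    using plateau_test_function[of 1 0] by (auto intro: test_functions_UNIV)
  define A1 where "A1 = (\<integral>t. \<bar>t\<bar> * cmod (fourier plateau t) \<partial>lborel)"
  have A1: "A1 \<ge> 0" by (simp add: A1_def)
  define \<epsilon> where "\<epsilon> = e / (M * fourier_norm plateau + 1)"
  have den: "M * fourier_norm plateau + 1 > 0"
    using M_nonneg fourier_norm_nonneg by (simp add: add_nonneg_pos)
  have \<epsilon>: "\<epsilon> > 0" using e den by (simp add: \<epsilon>_def)
  obtain r where r: "r > 0" "\<And>t. 0 \<le> t \<Longrightarrow> t < r \<Longrightarrow> norm (T t u - u) < \<epsilon>" using T_near_0[OF \<epsilon>] by metis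
  define K where "K = (M + 1) * norm u / r"
  have K: "K \<ge> 0" using r(1) M_nonneg by (simp add: K_def)
  \<comment> \<open>A modulus of continuity that can be integrated against the kernel.\<close>
  have modulus: "norm (T t u - u) \<le> \<epsilon> + K * t" if "t \<ge> 0" for t
  proof (cases "t < r")
    case True
    then show ?thesis using r(2)[OF that True] K that by (simp add: add_increasing2 less_imp_le)
  next
    case False
    have "norm (T t u - u) \<le> (M + 1) * norm u"
      using norm_triangle_ineq4[of "T t u" u] norm_T_le[OF that, of u] by (simp add: algebra_simps)
    also have "\<dots> = K * r" using r(1) by (simp add: K_def)
    also have "\<dots> \<le> K * t" using False K by (intro mult_left_mono) auto
    finally show ?thesis using \<epsilon> by simp
  qed
  \<comment> \<open>Rescaling by \<open>d\<close> keeps the \<open>L\<^sup>1\<close> norm of the kernel and multiplies its first moment by \<open>d\<close>.\<close>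
  define d where "d = e / (M * K * A1 + 1)"
  have den': "M * K * A1 + 1 > 0" using M_nonneg K A1 by (simp add: add_nonneg_pos)
  have d: "d > 0" using e den' by (simp add: d_def)
  define \<phi> where "\<phi> = (\<lambda>\<xi>. plateau (d * \<xi>))"
  have \<phi>: "\<phi> \<in> test_functions UNIV"
    using test_function_affine[OF plateau, of d 0] d by (simp add: \<phi>_def)
  have \<phi>0: "\<phi> 0 = 1" by (simp add: \<phi>_def plateau_eq)
  have fourier_\<phi>: "fourier \<phi> t = of_real (1 / d) * fourier plateau (t / d)" for t
    using fourier_affine[OF plateau, of "1 / d" 0 t] d by (simp add: \<phi>_def mult.commute)
  have n0: "fourier_norm \<phi> = fourier_norm plateau"
    using lborel_integral_real_affine[of d "\<lambda>t. cmod (fourier \<phi> t)" 0] d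
    by (simp add: fourier_norm_def fourier_\<phi> norm_mult norm_divide)
  have n1: "(\<integral>t. \<bar>t\<bar> * cmod (fourier \<phi> t) \<partial>lborel) = d * A1"
    using lborel_integral_real_affine[of d "\<lambda>t. \<bar>t\<bar> * cmod (fourier \<phi> t)" 0] d
    by (simp add: A1_def fourier_\<phi> norm_mult norm_divide abs_mult)
  have S: "closed {0::real..}" "is_interval {0::real..}" and S': "closed {..0::real}" "is_interval {..0::real}" by auto
  \<comment> \<open>Extending the orbit by the constant \<open>u\<close> to negative times makes it uniformly continuous on the whole
    line, at the price of a tail that vanishes as \<open>s \<rightarrow> \<infinity>\<close>.\<close>
  define G where "G = (\<lambda>t. T (max t 0) u)"
  have cG: "continuous_on S G" for S
    unfolding G_def by (intro continuous_on_compose2[OF orbit_continuous_on[of "{0..}"]] continuous_intros) auto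
  have G_nonneg: "G t = T t u" if "t \<ge> 0" for t using that by (simp add: G_def max_absorb1)
  have G_le: "norm (G t) \<le> M * norm u" for t unfolding G_def by (rule norm_T_le) simp
  have G_diff: "norm (G t - T s u) \<le> M * (\<epsilon> + K * \<bar>t - s\<bar>)" if "s \<ge> 0" for s t
  proof -
    have "norm (G t - T s u) \<le> M * norm (T \<bar>max t 0 - s\<bar> u - u)" using T_diff_le[OF that] by (simp add: G_def)
    also have "\<dots> \<le> M * (\<epsilon> + K * \<bar>max t 0 - s\<bar>)" using M_nonneg by (intro mult_left_mono modulus) auto
    also have "\<dots> \<le> M * (\<epsilon> + K * \<bar>t - s\<bar>)" using M_nonneg K that by (intro mult_left_mono add_left_mono) auto
    finally show ?thesis .
  qed
  have Gi: "(\<lambda>t. fourier \<phi> (t - s) *\<^sub>C G t) integrable_on S" if "closed S" "is_interval S" for S s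
  proof (rule dominated_integrable_on[OF that])
    show "continuous_on S (\<lambda>t. fourier \<phi> (t - s) *\<^sub>C G t)"
      by (intro continuous_intros cG continuous_on_fourier_compose[OF \<phi>])
    show "(\<lambda>t. cmod (fourier \<phi> (t - s)) * (M * norm u)) integrable_on S"
      by (intro integrable_on_mult_left norm_integrable_on(1) fourier_shift_integrable \<phi>) (use that in simp)
    show "norm (fourier \<phi> (t - s) *\<^sub>C G t) \<le> cmod (fourier \<phi> (t - s)) * (M * norm u)" for t
      using G_le[of t] by (simp add: mult_left_mono)
  qed
  let ?D = "\<lambda>s. integral UNIV (\<lambda>t. fourier \<phi> (t - s) *\<^sub>C (G t - T s u))"
  let ?tail = "\<lambda>s. integral {..0} (\<lambda>t. fourier \<phi> (t - s) *\<^sub>C u)"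
  have Di: "(\<lambda>t. fourier \<phi> (t - s) *\<^sub>C T s u) integrable_on UNIV"
    "integral UNIV (\<lambda>t. fourier \<phi> (t - s) *\<^sub>C T s u) = (2 * of_real pi) *\<^sub>C T s u" for s
  proof -
    have i: "(\<lambda>t. fourier \<phi> (t - s)) integrable_on UNIV"
      by (rule integrable_on_lborel[OF fourier_shift_integrable[OF \<phi>]])
    have "integral UNIV (\<lambda>t. fourier \<phi> (t - s)) = (\<integral>t. fourier \<phi> (t - s) \<partial>lborel)"
      by (rule integral_lborel[OF fourier_shift_integrable[OF \<phi>]])
    also have "\<dots> = (\<integral>t. fourier \<phi> t \<partial>lborel)"
      using lborel_integral_real_affine[of 1 "fourier \<phi>" "- s"] by simp
    also have "\<dots> = integral UNIV (fourier \<phi>)"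
      by (rule integral_lborel[OF fourier_integrable(1)[OF \<phi>], symmetric])
    finally have "integral UNIV (\<lambda>t. fourier \<phi> (t - s)) = 2 * of_real pi"
      using integral_fourier[OF \<phi>] \<phi>0 by simp
    then show "(\<lambda>t. fourier \<phi> (t - s) *\<^sub>C T s u) integrable_on UNIV"
      "integral UNIV (\<lambda>t. fourier \<phi> (t - s) *\<^sub>C T s u) = (2 * of_real pi) *\<^sub>C T s u"
      using integrable_linear[OF i scaleC.bounded_linear_left[of "T s u"]]
        integral_linear[OF i scaleC.bounded_linear_left[of "T s u"]] by (simp_all add: o_def)
  qed
  have D: "norm (?D s) < 2 * e" if s: "s \<ge> 0" for s
  proof -
    have sh: "integrable lborel (\<lambda>t. \<bar>t - s\<bar> * cmod (fourier \<phi> (t - s)))"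
      using lborel_integrable_real_affine[OF fourier_integrable(2)[OF \<phi>], of 1 "- s"] by simp
    have sh': "(\<integral>t. \<bar>t - s\<bar> * cmod (fourier \<phi> (t - s)) \<partial>lborel) = d * A1"
      using lborel_integral_real_affine[of 1 "\<lambda>t. \<bar>t\<bar> * cmod (fourier \<phi> t)" "- s"] n1 by simp
    have gi: "(\<lambda>t. \<bar>t - s\<bar> * cmod (fourier \<phi> (t - s))) integrable_on UNIV"
      "integral UNIV (\<lambda>t. \<bar>t - s\<bar> * cmod (fourier \<phi> (t - s))) = d * A1"
      using integrable_on_lborel[OF sh] integral_lborel[OF sh] sh' by simp_all
    have fn: "(\<lambda>t. cmod (fourier \<phi> (t - s))) integrable_on UNIV"
      "integral UNIV (\<lambda>t. cmod (fourier \<phi> (t - s))) \<le> fourier_norm \<phi>"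
      by (intro norm_integrable_on(1) fourier_shift_integrable \<phi> integral_fourier_shift_le; simp)+
    let ?b = "\<lambda>t. M * \<epsilon> * cmod (fourier \<phi> (t - s)) + M * K * (\<bar>t - s\<bar> * cmod (fourier \<phi> (t - s)))"
    have b: "?b integrable_on UNIV" by (intro integrable_add integrable_on_mult_right fn(1) gi(1))
    have le: "norm (fourier \<phi> (t - s) *\<^sub>C (G t - T s u)) \<le> ?b t" for t
      using mult_left_mono[OF G_diff[OF s, of t] norm_ge_zero[of "fourier \<phi> (t - s)"]]
      by (simp add: algebra_simps)
    have i: "(\<lambda>t. fourier \<phi> (t - s) *\<^sub>C (G t - T s u)) integrable_on UNIV"
      by (rule dominated_integrable_on[OF _ _ _ le b])
        (auto intro!: continuous_on_fourier_compose[OF \<phi>] continuous_intros cG)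
    have "norm (?D s) \<le> integral UNIV ?b" by (rule integral_norm_bound_integral[OF i b le])
    also have "\<dots> = M * \<epsilon> * integral UNIV (\<lambda>t. cmod (fourier \<phi> (t - s)))
        + M * K * integral UNIV (\<lambda>t. \<bar>t - s\<bar> * cmod (fourier \<phi> (t - s)))"
      by (simp only: Henstock_Kurzweil_Integration.integral_add[OF integrable_on_mult_right[OF fn(1)] integrable_on_mult_right[OF gi(1)]]
          integral_mult_right)
    also have "\<dots> \<le> M * \<epsilon> * fourier_norm plateau + M * K * (d * A1)"
      using fn(2) gi(2) M_nonneg \<epsilon> K unfolding n0 by (intro add_mono mult_left_mono) auto
    also have "\<dots> < e + e"
    proof (rule add_strict_mono)
      have "\<epsilon> * (M * fourier_norm plateau) < \<epsilon> * (M * fourier_norm plateau + 1)" using \<epsilon> by simp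
      also have "\<dots> = e" using den by (simp add: \<epsilon>_def)
      finally show "M * \<epsilon> * fourier_norm plateau < e" by (simp add: mult_ac)
      have "d * (M * K * A1) < d * (M * K * A1 + 1)" using d by simp
      also have "\<dots> = e" using den' by (simp add: d_def)
      finally show "M * K * (d * A1) < e" by (simp add: mult_ac)
    qed
    finally show ?thesis by simp
  qed
  have decomp: "(2 * of_real pi) *\<^sub>C T s u = smoothed_orbit T \<phi> u s + ?tail s - ?D s" for s
  proof -
    have "((\<lambda>t. fourier \<phi> (t - s) *\<^sub>C G t) has_integral (?tail s + smoothed_orbit T \<phi> u s)) ({..0} \<union> {0..})"
    proof (rule has_integral_Un)
      have "integral {..0} (\<lambda>t. fourier \<phi> (t - s) *\<^sub>C G t) = ?tail s"
        by (rule integral_cong) (simp add: G_def max_absorb2)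
      then show "((\<lambda>t. fourier \<phi> (t - s) *\<^sub>C G t) has_integral ?tail s) {..0}"
        using integrable_integral[OF Gi[OF S', of s]] by simp
      have "integral {0..} (\<lambda>t. fourier \<phi> (t - s) *\<^sub>C G t) = smoothed_orbit T \<phi> u s"
        unfolding smoothed_orbit_def orbit_integral_def by (rule integral_cong) (simp add: G_nonneg)
      then show "((\<lambda>t. fourier \<phi> (t - s) *\<^sub>C G t) has_integral smoothed_orbit T \<phi> u s) {0..}"
        using integrable_integral[OF Gi[OF S, of s]] by simp
      have "{..0} \<inter> {0..} = {0::real}" by auto
      then show "negligible ({..0} \<inter> {0::real..})" by simp
    qed
    moreover have "{..0} \<union> {0..} = (UNIV :: real set)" by auto
    ultimately have "integral UNIV (\<lambda>t. fourier \<phi> (t - s) *\<^sub>C G t) = ?tail s + smoothed_orbit T \<phi> u s"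
      using integral_unique by metis
    then show ?thesis
      by (simp add: scaleC.diff_right Henstock_Kurzweil_Integration.integral_diff Gi Di)
  qed
  have "(?tail \<longlongrightarrow> 0) at_top"
  proof (rule fourier_average_tendsto_0[OF \<phi> S', where B = "norm u"])
    show "\<exists>r. \<forall>t\<in>{..0::real}. t \<ge> r \<longrightarrow> norm u \<le> e" for e by (intro exI[of _ 1]) auto
  qed auto
  from tendstoD[OF this e] tendstoD[OF assms[OF \<phi>] e] eventually_ge_at_top[of 0]
  show "\<forall>\<^sub>F t in at_top. dist (T t u) 0 < e"
  proof eventually_elim
    case (elim s)
    have "2 * pi * norm (T s u) = norm ((2 * of_real pi) *\<^sub>C T s u)" by (simp add: norm_mult)
    also have "\<dots> \<le> norm (smoothed_orbit T \<phi> u s) + norm (?tail s) + norm (?D s)"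
      unfolding decomp by (meson norm_triangle_ineq norm_triangle_ineq4 add_right_mono order_trans)
    also have "\<dots> < 4 * e" using elim D[of s] by simp
    also have "\<dots> \<le> 2 * pi * e" using pi_ge_two e by (intro mult_right_mono) auto
    finally show ?case by simp
  qed
qed

text \<open>With \<open>\<mu> = \<alpha> + i \<xi>\<^sub>0\<close> and \<open>z = R(\<mu>,A)u\<close> one has \<open>u = \<alpha> z + (i \<xi>\<^sub>0 - A) z\<close>. Integration by
  parts moves \<open>i \<xi>\<^sub>0 - A\<close> onto the kernel, where it becomes multiplication of \<open>\<phi>\<close> by \<open>\<xi> - \<xi>\<^sub>0\<close>.\<close>

lemma smoothed_orbit_resolvent_identity:
  fixes u \<xi>\<^sub>0 \<alpha>
  assumes \<phi>: "\<phi> \<in> test_functions UNIV" and \<alpha>: "\<alpha> > 0"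
  defines "\<mu> \<equiv> complex_of_real \<alpha> + \<i> * complex_of_real \<xi>\<^sub>0"
  defines "z \<equiv> orbit_integral T (laplace_kernel \<mu>) u"
  shows "smoothed_orbit T \<phi> u s = fourier \<phi> (- s) *\<^sub>C z
    - \<i> *\<^sub>C orbit_integral T (laplace_kernel \<mu>) (smoothed_orbit T (\<lambda>\<xi>. (of_real \<xi> - of_real \<xi>\<^sub>0) * \<phi> \<xi>) u s)
    + \<alpha> *\<^sub>R smoothed_orbit T \<phi> z s"
proof -
  let ?\<phi>1 = "\<lambda>\<xi>. (complex_of_real \<xi> - of_real \<xi>\<^sub>0) * \<phi> \<xi>"
  have Re: "Re \<mu> > 0" using \<alpha> by (simp add: \<mu>_def)
  have \<phi>1: "?\<phi>1 \<in> test_functions UNIV"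
    using test_function_mult(1)[OF \<phi> smooth_fun_linear[of "- of_real \<xi>\<^sub>0" 1]] by (simp add: algebra_simps)
  have D: "fourier (\<lambda>\<xi>. - \<i> * (of_real \<xi> * \<phi> \<xi>)) t = - \<i> * fourier ?\<phi>1 t - \<i> * of_real \<xi>\<^sub>0 * fourier \<phi> t" for t
  proof -
    have "(\<lambda>\<xi>. - \<i> * (of_real \<xi> * \<phi> \<xi>)) = (\<lambda>\<xi>. - \<i> * ?\<phi>1 \<xi> + (- \<i> * of_real \<xi>\<^sub>0) * \<phi> \<xi>)"
      by (auto simp: fun_eq_iff algebra_simps)
    then show ?thesis
      using fourier_add[OF test_function_cmult[OF \<phi>1, of "- \<i>"] test_function_cmult[OF \<phi>, of "- \<i> * of_real \<xi>\<^sub>0"], of t]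
        fourier_cmult[of "- \<i>" ?\<phi>1 t] fourier_cmult[of "- \<i> * of_real \<xi>\<^sub>0" \<phi> t] by simp
  qed
  let ?F = "\<lambda>t. fourier \<phi> (t - s) *\<^sub>C T t z"
  let ?f = "\<lambda>t. (- \<i>) *\<^sub>C (fourier ?\<phi>1 (t - s) *\<^sub>C T t z) + (\<alpha> *\<^sub>R (fourier \<phi> (t - s) *\<^sub>C T t z) - fourier \<phi> (t - s) *\<^sub>C T t u)"
  note i1 = orbit_integrable[OF integral_kernel_fourier[OF \<phi>1], of s z]
    and i2 = orbit_integrable[OF integral_kernel_fourier[OF \<phi>], of s z]
    and i3 = orbit_integrable[OF integral_kernel_fourier[OF \<phi>], of s u]
  have i1': "(\<lambda>t. (- \<i>) *\<^sub>C (fourier ?\<phi>1 (t - s) *\<^sub>C T t z)) integrable_on {0..}"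
    "integral {0..} (\<lambda>t. (- \<i>) *\<^sub>C (fourier ?\<phi>1 (t - s) *\<^sub>C T t z)) = (- \<i>) *\<^sub>C smoothed_orbit T ?\<phi>1 z s"
    using integrable_linear[OF i1 scaleC.bounded_linear_right[of "- \<i>"]]
      integral_linear[OF i1 scaleC.bounded_linear_right[of "- \<i>"]]
    by (simp_all add: o_def smoothed_orbit_def orbit_integral_def)
  have "integral {0..} ?f = 0 - ?F 0"
  proof (rule integral_FTC_at_top)
    fix t :: real assume t: "t \<ge> 0"
    have "((\<lambda>t. t - s) has_vector_derivative 1) (at t within {0..})"
      by (auto intro!: derivative_eq_intros)
    from vector_diff_chain_within[OF this has_vector_derivative_at_within[OF fourier_has_derivative[OF \<phi>]]]
    have 1: "((\<lambda>t. fourier \<phi> (t - s)) has_vector_derivative - \<i> * fourier ?\<phi>1 (t - s) - \<i> * of_real \<xi>\<^sub>0 * fourier \<phi> (t - s)) (at t within {0..})"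
      unfolding D by (simp add: o_def)
    have 2: "((\<lambda>t. T t z) has_vector_derivative \<mu> *\<^sub>C T t z - T t u) (at t within {0..})"
      unfolding z_def by (rule laplace_orbit_has_derivative[OF Re t])
    from bounded_bilinear.has_vector_derivative[OF bounded_bilinear_scaleC 1 2]
    show "(?F has_vector_derivative ?f t) (at t within {0..})"
      by (rule has_vector_derivative_eq_rhs)
        (simp add: \<mu>_def scaleC.add_right scaleC.diff_right scaleC.diff_left scaleC.add_left scaleC.minus_left scaleC_scaleC
          algebra_simps flip: scaleC_of_real)
  next
    show "?f integrable_on {0..}"
      by (intro integrable_add integrable_diff integrable_cmul i1' i2 i3)
    obtain C where C: "C \<ge> 0" "\<And>t. cmod (fourier \<phi> t) \<le> C * (1 / (1 + t^2))"
      using fourier_decay_weak[OF \<phi>] by metis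
    have lim: "((\<lambda>t. C * (1 / (1 + (t - s)^2)) * (M * norm z)) \<longlongrightarrow> 0) at_top" by real_asymp
    have le: "norm (?F t) \<le> C * (1 / (1 + (t - s)^2)) * (M * norm z)" if "t \<ge> 0" for t
      unfolding norm_scaleC by (intro mult_mono C norm_T_le that) (use C in auto)
    show "(?F \<longlongrightarrow> 0) at_top"
      by (rule Lim_null_comparison[OF eventually_at_top_linorderI[of 0] lim]) (rule le)
  qed
  moreover have "integral {0..} ?f = (- \<i>) *\<^sub>C smoothed_orbit T ?\<phi>1 z s + (\<alpha> *\<^sub>R smoothed_orbit T \<phi> z s - smoothed_orbit T \<phi> u s)"
    using i1' i2 i3
    by (simp add: Henstock_Kurzweil_Integration.integral_add Henstock_Kurzweil_Integration.integral_diff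
        integrable_diff integrable_cmul smoothed_orbit_def orbit_integral_def)
  moreover have "smoothed_orbit T ?\<phi>1 z s = orbit_integral T (laplace_kernel \<mu>) (smoothed_orbit T ?\<phi>1 u s)"
    unfolding smoothed_orbit_def z_def
    by (rule orbit_integral_orbit_integral[OF integral_kernel_fourier[OF \<phi>1] integral_kernel_laplace[OF Re]])
  ultimately show ?thesis by (simp add: scaleC.minus_left algebra_simps)
qed

text \<open>It suffices to smooth the orbit with a plateau \<open>\<phi>\<close> around \<open>\<xi>\<^sub>0\<close>. First, smoothing with
  \<open>(\<xi> - \<xi>\<^sub>0) \<phi>(\<xi>)\<close> gives a function tending to \<open>0\<close>: up to a function with arbitrarily small
  transform in \<open>L\<^sup>1\<close>, this test function vanishes near \<open>\<xi>\<^sub>0\<close>. Secondly, the resolvent identity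
  above reduces smoothing with \<open>\<phi>\<close> to this case, up to terms that are small because
  \<open>\<alpha> R(\<alpha> + i \<xi>\<^sub>0,A)u\<close> tends to \<open>0\<close>. Here the semigroup enters: its bounded operators
  commute with the resolvent, which makes the last error uniform in time.\<close>

lemma isolated_not_in_sing_supp:
  fixes u \<xi>\<^sub>0
  defines "S \<equiv> sing_supp_PF (boundary_resolvent (generator T) u)"
  assumes r: "r > 0" "S \<inter> ball \<xi>\<^sub>0 r \<subseteq> {\<xi>\<^sub>0}"
    and abel: "((\<lambda>\<alpha>. \<alpha> * norm (resolvent (complex_of_real \<alpha> + \<i> * complex_of_real \<xi>\<^sub>0) (generator T) u)) \<longlongrightarrow> 0) (at_right 0)"
  shows "\<xi>\<^sub>0 \<notin> S"
proof -
  define r' where "r' = r / 3"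
  have r': "r' > 0" using r(1) by (simp add: r'_def)
  define \<phi> where "\<phi> = (\<lambda>\<xi>. plateau ((\<xi> - \<xi>\<^sub>0) / r'))"
  define \<phi>1 where "\<phi>1 = (\<lambda>\<xi>. (complex_of_real \<xi> - of_real \<xi>\<^sub>0) * \<phi> \<xi>)"
  have \<phi>: "\<phi> \<in> test_functions UNIV"
    using plateau_test_function[OF r', of \<xi>\<^sub>0] by (auto simp: \<phi>_def intro: test_functions_UNIV)
  have \<phi>1: "\<phi>1 \<in> test_functions UNIV"
    using test_function_mult(1)[OF \<phi> smooth_fun_linear[of "- of_real \<xi>\<^sub>0" 1]] by (simp add: \<phi>1_def algebra_simps)
  have lim1: "(smoothed_orbit T \<phi>1 u \<longlongrightarrow> 0) at_top"
  proof (rule tendstoI)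
    fix e :: real assume e: "e > 0"
    define m where "m = (\<lambda>x. complex_of_real x * plateau x)"
    have m: "m \<in> test_functions UNIV"
      using test_function_mult(1)[OF test_functions_UNIV[OF plateau_test_function[of 1 0]] smooth_fun_linear[of 0 1]]
      by (simp add: m_def)
    define c where "c = fourier_norm m * (M * norm u)"
    have c: "c \<ge> 0" using M_nonneg by (simp add: c_def fourier_norm_nonneg)
    define d where "d = min r' (e / (2 * (c + 1)))"
    have d: "d > 0" "d \<le> r'" using r' e c by (auto simp: d_def)
    have dc: "d * c < e / 2"
    proof -
      have "d * c < d * (c + 1)" using d(1) by simp
      also have "\<dots> \<le> e / (2 * (c + 1)) * (c + 1)" using c by (intro mult_right_mono) (auto simp: d_def)
      also have "\<dots> = e / 2" using c by (simp add: field_simps)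
      finally show ?thesis .
    qed
    \<comment> \<open>The function \<open>h\<close> equals \<open>\<xi> - \<xi>\<^sub>0\<close> near \<open>\<xi>\<^sub>0\<close>, and by scaling its transform has \<open>L\<^sup>1\<close> norm
      proportional to \<open>d\<close>.\<close>
    define h where "h = (\<lambda>\<xi>. complex_of_real d * m ((\<xi> - \<xi>\<^sub>0) / d))"
    have hm: "(\<lambda>\<xi>. m ((\<xi> - \<xi>\<^sub>0) / d)) \<in> test_functions UNIV"
      using test_function_affine[OF m, of "1 / d" "- \<xi>\<^sub>0 / d"] d(1) by (simp add: diff_divide_distrib)
    then have h: "h \<in> test_functions UNIV" unfolding h_def by (rule test_function_cmult)
    have "fourier_norm h = d * fourier_norm m"
    proof -
      have "cmod (fourier h t) = d * (d * cmod (fourier m (d * t)))" for t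
        unfolding h_def fourier_cmult fourier_affine[OF m d(1)]
        using d(1) by (simp add: norm_mult norm_exp_eq_Re)
      then show ?thesis
        using lborel_integral_real_affine[of d "\<lambda>t. cmod (fourier m t)" 0] d(1)
        by (simp add: fourier_norm_def)
    qed
    then have small: "norm (smoothed_orbit T h u s) < e / 2" for s
      using norm_smoothed_orbit_le[OF h, of u s] dc by (simp add: c_def mult_ac)
    have diff: "(\<lambda>\<xi>. \<phi>1 \<xi> - h \<xi>) \<in> test_functions UNIV" by (rule test_function_diff[OF \<phi>1 h])
    have "fun_support (\<lambda>\<xi>. \<phi>1 \<xi> - h \<xi>) \<subseteq> {\<xi>. d \<le> \<bar>\<xi> - \<xi>\<^sub>0\<bar> \<and> \<bar>\<xi> - \<xi>\<^sub>0\<bar> \<le> 2 * r'}"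
      unfolding fun_support_def
    proof (rule closure_minimal)
      show "closed {\<xi>. d \<le> \<bar>\<xi> - \<xi>\<^sub>0\<bar> \<and> \<bar>\<xi> - \<xi>\<^sub>0\<bar> \<le> 2 * r'}"
        by (intro closed_Collect_conj closed_Collect_le continuous_intros)
      have "\<phi>1 \<xi> - h \<xi> = 0" if "\<bar>\<xi> - \<xi>\<^sub>0\<bar> < d \<or> 2 * r' < \<bar>\<xi> - \<xi>\<^sub>0\<bar>" for \<xi>
        using that
      proof
        assume "\<bar>\<xi> - \<xi>\<^sub>0\<bar> < d"
        then have "\<bar>(\<xi> - \<xi>\<^sub>0) / d\<bar> \<le> 1" "\<bar>(\<xi> - \<xi>\<^sub>0) / r'\<bar> \<le> 1" using d r' by auto
        then show ?thesis using d(1) by (simp add: \<phi>1_def \<phi>_def h_def m_def plateau_eq)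
      next
        assume "2 * r' < \<bar>\<xi> - \<xi>\<^sub>0\<bar>"
        then have "\<bar>(\<xi> - \<xi>\<^sub>0) / d\<bar> \<ge> 2" "\<bar>(\<xi> - \<xi>\<^sub>0) / r'\<bar> \<ge> 2" using d r' by (auto simp: field_simps)
        then show ?thesis by (simp add: \<phi>1_def \<phi>_def h_def m_def plateau_eq)
      qed
      then show "{\<xi>. \<phi>1 \<xi> - h \<xi> \<noteq> 0} \<subseteq> {\<xi>. d \<le> \<bar>\<xi> - \<xi>\<^sub>0\<bar> \<and> \<bar>\<xi> - \<xi>\<^sub>0\<bar> \<le> 2 * r'}"
        by (auto simp: not_less[symmetric] simp del: eq_iff_diff_eq_0 right_minus_eq)
    qed
    moreover have "\<xi> \<notin> S" if "d \<le> \<bar>\<xi> - \<xi>\<^sub>0\<bar>" "\<bar>\<xi> - \<xi>\<^sub>0\<bar> \<le> 2 * r'" for \<xi>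
    proof
      assume "\<xi> \<in> S"
      moreover have "\<xi> \<in> ball \<xi>\<^sub>0 r" using that(2) r(1) by (auto simp: dist_real_def r'_def abs_minus_commute)
      ultimately have "\<xi> = \<xi>\<^sub>0" using r(2) by blast
      then show False using that(1) d(1) by simp
    qed
    ultimately have "fun_support (\<lambda>\<xi>. \<phi>1 \<xi> - h \<xi>) \<inter> S = {}" by blast
    then have "(smoothed_orbit T (\<lambda>\<xi>. \<phi>1 \<xi> - h \<xi>) u \<longlongrightarrow> 0) at_top"
      unfolding S_def by (rule smoothed_orbit_tendsto_0[OF diff])
    from tendstoD[OF this, of "e / 2"] e
    have "\<forall>\<^sub>F s in at_top. dist (smoothed_orbit T (\<lambda>\<xi>. \<phi>1 \<xi> - h \<xi>) u s) 0 < e / 2" by simp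
    then show "\<forall>\<^sub>F s in at_top. dist (smoothed_orbit T \<phi>1 u s) 0 < e"
    proof eventually_elim
      case (elim s)
      have "smoothed_orbit T \<phi>1 u s = smoothed_orbit T (\<lambda>\<xi>. \<phi>1 \<xi> - h \<xi>) u s + smoothed_orbit T h u s"
        using smoothed_orbit_add[OF diff h, of u s] by simp
      then show ?case
        using elim small[of s] norm_triangle_ineq[of "smoothed_orbit T (\<lambda>\<xi>. \<phi>1 \<xi> - h \<xi>) u s" "smoothed_orbit T h u s"]
        by simp
    qed
  qed
  have "(smoothed_orbit T \<phi> u \<longlongrightarrow> 0) at_top"
  proof (rule tendstoI)
    fix e :: real assume e: "e > 0"
    let ?\<mu> = "\<lambda>\<alpha>. complex_of_real \<alpha> + \<i> * complex_of_real \<xi>\<^sub>0"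
    let ?c = "fourier_norm \<phi> * M"
    have "((\<lambda>\<alpha>. ?c * (\<alpha> * norm (resolvent (?\<mu> \<alpha>) (generator T) u))) \<longlongrightarrow> ?c * 0) (at_right 0)"
      by (intro tendsto_intros abel)
    then have "\<forall>\<^sub>F \<alpha> in at_right 0. ?c * (\<alpha> * norm (resolvent (?\<mu> \<alpha>) (generator T) u)) < e / 2"
      using e by (intro order_tendstoD(2)) auto
    moreover have "\<forall>\<^sub>F \<alpha> in at_right 0. \<alpha> > (0::real)" by (rule eventually_at_right_less)
    ultimately have "\<forall>\<^sub>F \<alpha> in at_right 0. \<alpha> > 0 \<and> ?c * (\<alpha> * norm (resolvent (?\<mu> \<alpha>) (generator T) u)) < e / 2"
      by eventually_elim simp
    then obtain \<alpha> where \<alpha>: "\<alpha> > 0" "?c * (\<alpha> * norm (resolvent (?\<mu> \<alpha>) (generator T) u)) < e / 2"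
      using eventually_happens'[OF trivial_limit_at_right_real] by blast
    let ?L = "orbit_integral T (laplace_kernel (?\<mu> \<alpha>))"
    define z where "z = ?L u"
    have z: "resolvent (?\<mu> \<alpha>) (generator T) u = z"
      unfolding z_def by (rule resolvent_eq_laplace) (use \<alpha>(1) in simp)
    have L: "bounded_linear ?L"
      by (intro orbit_integral_bounded_linear integral_kernel_laplace) (use \<alpha>(1) in simp)
    let ?w = "\<lambda>s. fourier \<phi> (- s) *\<^sub>C z - \<i> *\<^sub>C ?L (smoothed_orbit T \<phi>1 u s)"
    have "((\<lambda>s. fourier \<phi> (- s)) \<longlongrightarrow> 0) at_top"
    proof -
      obtain C where C: "C \<ge> 0" "\<And>t. cmod (fourier \<phi> t) \<le> C * (1 / (1 + t^2))"
        using fourier_decay_weak[OF \<phi>] by metis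
      have lim: "((\<lambda>s. C * (1 / (1 + (- s)^2))) \<longlongrightarrow> 0) at_top" by real_asymp
      show ?thesis by (rule Lim_null_comparison[OF always_eventually lim]) (use C(2) in blast)
    qed
    moreover have "((\<lambda>s. ?L (smoothed_orbit T \<phi>1 u s)) \<longlongrightarrow> ?L 0) at_top"
      by (rule bounded_linear.tendsto[OF L lim1])
    ultimately have "(?w \<longlongrightarrow> 0 *\<^sub>C z - \<i> *\<^sub>C ?L 0) at_top" by (intro tendsto_intros)
    then have "(?w \<longlongrightarrow> 0) at_top"
      by (simp only: scaleC.zero_left scaleC.zero_right linear_0[OF bounded_linear.linear[OF L]] diff_zero)
    from tendstoD[OF this, of "e / 2"] e have "\<forall>\<^sub>F s in at_top. dist (?w s) 0 < e / 2" by simp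
    then show "\<forall>\<^sub>F s in at_top. dist (smoothed_orbit T \<phi> u s) 0 < e"
    proof eventually_elim
      case (elim s)
      have id: "smoothed_orbit T \<phi> u s = ?w s + \<alpha> *\<^sub>R smoothed_orbit T \<phi> z s"
        unfolding z_def \<phi>1_def by (rule smoothed_orbit_resolvent_identity[OF \<phi> \<alpha>(1)])
      have "norm (\<alpha> *\<^sub>R smoothed_orbit T \<phi> z s) \<le> \<alpha> * (fourier_norm \<phi> * (M * norm z))"
        using norm_smoothed_orbit_le[OF \<phi>, of z s] \<alpha>(1) by (simp add: mult_left_mono)
      also have "\<dots> < e / 2" using \<alpha>(2) unfolding z by (simp add: mult_ac)
      finally have "norm (\<alpha> *\<^sub>R smoothed_orbit T \<phi> z s) < e / 2" .
      then show ?case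
        using elim norm_triangle_ineq[of "?w s" "\<alpha> *\<^sub>R smoothed_orbit T \<phi> z s"] unfolding id by simp
    qed
  qed
  then show ?thesis
    unfolding S_def
  proof (rule not_in_sing_suppI[OF \<phi> open_ball[of \<xi>\<^sub>0 r'], rotated 2])
    show "\<xi>\<^sub>0 \<in> ball \<xi>\<^sub>0 r'" using r' by simp
    fix \<eta> assume "\<eta> \<in> ball \<xi>\<^sub>0 r'"
    then have "\<bar>(\<eta> - \<xi>\<^sub>0) / r'\<bar> \<le> 1" using r' by (simp add: dist_real_def abs_minus_commute)
    then show "\<phi> \<eta> = 1" by (simp add: \<phi>_def plateau_eq)
  qed
qed

lemma orbit_tendsto_0_iff_sing_supp_empty:
  "((\<lambda>t. T t u) \<longlongrightarrow> 0) at_top \<longleftrightarrow> sing_supp_PF (boundary_resolvent (generator T) u) = {}"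
proof
  assume lim: "((\<lambda>t. T t u) \<longlongrightarrow> 0) at_top"
  have "\<xi> \<notin> sing_supp_PF (boundary_resolvent (generator T) u)" for \<xi>
  proof (rule not_in_sing_suppI[OF _ open_ball[of \<xi> 1] _ _ orbit_tendsto_0_imp_smoothed[OF lim]])
    show "(\<lambda>t. plateau ((t - \<xi>) / 1)) \<in> test_functions UNIV"
      by (rule test_functions_UNIV[OF plateau_test_function]) simp
    then show "(\<lambda>t. plateau ((t - \<xi>) / 1)) \<in> test_functions UNIV" .
  qed (auto simp: dist_real_def plateau_eq)
  then show "sing_supp_PF (boundary_resolvent (generator T) u) = {}" by blast
next
  assume "sing_supp_PF (boundary_resolvent (generator T) u) = {}"
  then show "((\<lambda>t. T t u) \<longlongrightarrow> 0) at_top"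
    by (intro smoothed_imp_orbit_tendsto_0 smoothed_orbit_tendsto_0) auto
qed

lemma countable_sing_supp_imp_empty:
  fixes u
  defines "S \<equiv> sing_supp_PF (boundary_resolvent (generator T) u)"
  assumes "countable S"
    and "\<And>\<xi>. \<xi> \<in> S \<Longrightarrow>
      ((\<lambda>\<alpha>. \<alpha> * norm (resolvent (complex_of_real \<alpha> + \<i> * complex_of_real \<xi>) (generator T) u)) \<longlongrightarrow> 0) (at_right 0)"
  shows "S = {}"
proof (rule ccontr)
  assume "S \<noteq> {}"
  moreover have "closed S" unfolding S_def by (rule closed_sing_supp_PF)
  ultimately obtain \<xi> r where \<xi>: "\<xi> \<in> S" "r > 0" "S \<inter> ball \<xi> r = {\<xi>}"
    using countable_closed_has_isolated_point[OF _ assms(2)] by metis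
  have "\<xi> \<notin> S"
    unfolding S_def
    by (rule isolated_not_in_sing_supp[OF \<xi>(2)]) (use \<xi>(3) assms(3)[OF \<xi>(1)] in \<open>simp_all add: S_def\<close>)
  with \<xi>(1) show False by contradiction
qed

end

theorem theorem1p5:
  fixes T :: "real \<Rightarrow> 'a::complex_banach \<Rightarrow> 'a"
    and A :: "'a unbounded_op" and x :: 'a
  assumes "C0_semigroup T" and "bounded_semigroup T" and "A = generator T"
  shows "(((\<lambda>t. norm (T t x)) \<longlongrightarrow> 0) at_top \<longleftrightarrow> PF_spectrum A x = {}) \<and>
    (PF_spectrum A x = {} \<longleftrightarrow>
      countable (PF_spectrum A x) \<and>
      (\<forall>\<xi>::real. \<i> * complex_of_real \<xi> \<in> PF_spectrum A x \<longrightarrow>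
        ((\<lambda>\<alpha>::real. \<alpha> * norm (resolvent (complex_of_real \<alpha> + \<i> * complex_of_real \<xi>) A x))
           \<longlongrightarrow> 0) (at_right 0)))"
proof -
  obtain B where B: "\<And>t. t \<ge> 0 \<Longrightarrow> onorm (T t) \<le> B"
    using assms(2) by (auto simp: bounded_semigroup_def bdd_above_def)
  interpret bounded_C0_semigroup T "\<bar>B\<bar>"
  proof
    fix t :: real and u assume t: "t \<ge> 0"
    have "bounded_linear (T t)"
      using assms(1) t by (simp add: C0_semigroup_def bounded_clinear_def)
    then have "norm (T t u) \<le> onorm (T t) * norm u" by (rule onorm)
    also have "\<dots> \<le> \<bar>B\<bar> * norm u" using B[OF t] by (intro mult_right_mono) auto
    finally show "norm (T t u) \<le> \<bar>B\<bar> * norm u" .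
  qed (use assms(1) in auto)
  let ?S = "sing_supp_PF (boundary_resolvent (generator T) x)"
  have spectrum: "PF_spectrum A x = (\<lambda>\<xi>. \<i> * complex_of_real \<xi>) ` ?S"
    by (simp add: PF_spectrum_def assms(3))
  have inj: "inj_on (\<lambda>\<xi>. \<i> * complex_of_real \<xi>) X" for X by (rule inj_onI) simp
  have empty: "PF_spectrum A x = {} \<longleftrightarrow> ?S = {}" unfolding spectrum by simp
  have "?S = {}"
    if c: "countable (PF_spectrum A x)"
      and abel: "\<forall>\<xi>::real. \<i> * complex_of_real \<xi> \<in> PF_spectrum A x \<longrightarrow>
        ((\<lambda>\<alpha>::real. \<alpha> * norm (resolvent (complex_of_real \<alpha> + \<i> * complex_of_real \<xi>) A x)) \<longlongrightarrow> 0) (at_right 0)"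
  proof (rule countable_sing_supp_imp_empty)
    show "countable ?S" using countable_image_inj_on[OF c[unfolded spectrum] inj] .
    show "((\<lambda>\<alpha>. \<alpha> * norm (resolvent (complex_of_real \<alpha> + \<i> * complex_of_real \<xi>) (generator T) x)) \<longlongrightarrow> 0) (at_right 0)"
      if "\<xi> \<in> ?S" for \<xi>
      using abel[rule_format, of \<xi>] that unfolding spectrum by (simp add: assms(3))
  qed
  then have "PF_spectrum A x = {} \<longleftrightarrow>
      countable (PF_spectrum A x) \<and>
      (\<forall>\<xi>::real. \<i> * complex_of_real \<xi> \<in> PF_spectrum A x \<longrightarrow>
        ((\<lambda>\<alpha>::real. \<alpha> * norm (resolvent (complex_of_real \<alpha> + \<i> * complex_of_real \<xi>) A x)) \<longlongrightarrow> 0) (at_right 0))"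
    unfolding empty by (auto simp: spectrum)
  moreover have "((\<lambda>t. norm (T t x)) \<longlongrightarrow> 0) at_top \<longleftrightarrow> PF_spectrum A x = {}"
    unfolding empty tendsto_norm_zero_iff by (rule orbit_tendsto_0_iff_sing_supp_empty)
  ultimately show ?thesis by blast
qed

end
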